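(* Let $n,m\ge 1$ be integers and let $\gamma=(\gamma_1,\dots,\gamma_n)\in\mathbb{R}^n$ with $|\gamma_j|<1/2$ for $j=1,\dots,n$. Suppose that the functions $\varphi_j\in C^{2(m-j)-1}(\mathbb{R}^n_+)$, $j=0,\dots,m-1$, are continuous and bounded, and that all derivatives of $\varphi_j$ up to order $2(m-j)-1$ inclusive (order zero, i.e. $\varphi_j$ itself, included) vanish at $x_k=0$, $k=1,\dots,n$, for every $j=0,\dots,m-1$. Put $$f_k(x)=\sum_{j=0}^{k}(-1)^{j}\binom{k}{j}\Delta_B^{j}\varphi_{k-j}(x),\qquad k=0,\dots,m-1,$$ $$G(x,s,t)=\prod_{j=1}^n\left[s_j^{\gamma_j+1} I_{\gamma_j}\!\left(\frac{x_js_j}{2t}\right)\right]\exp\left[-\frac{|x|^2+|s|^2}{4t}\right].$$ Then the function $$u(x,t)=\frac{1}{(2t)^n}\prod_{j=1}^n x_j^{-\gamma_j}\sum_{k=0}^{m-1}\frac{t^k}{k!}\int_{\mathbb{R}^n_+} f_k(s)\,G(x,s,t)\,ds,\qquad x\in\mathbb{R}^n_+,\ t>0,$$ is a classical solution of the homogeneous equation $$\left(\frac{\partial}{\partial t}-\Delta_B\right)^m u(x,t)=0,\qquad x\in\mathbb{R}^n_+,\ t>0,$$ satisfying the initial conditions $$\left.\frac{\partial^k u}{\partial t^k}\right|_{t=0}=\varphi_k(x),\qquad x\in\mathbb{R}^n_+,\ k=0,\dots,m-1,$$ and the boundary conditions $$\left.\frac{\partial^{2k+1}u}{\partial x_j^{2k+1}}\right|_{x_j=0}=0,\qquad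 t>0,\ j=1,\dots,n,\ k=0,\dots,m-1.$$
   Context: $\mathbb{R}^n_+=\{x\in\mathbb{R}^n: x_k>0,\ k=1,\dots,n\}$ and $|x|^2=\sum_{j=1}^n x_j^2$. The Bessel differential operator in the variable $x_k$ is $B_{\gamma_k}^{x_k}=\frac{\partial^2}{\partial x_k^2}+\frac{2\gamma_k+1}{x_k}\frac{\partial}{\partial x_k}$, and $\Delta_B=\sum_{k=1}^n B_{\gamma_k}^{x_k}$; powers of operators are compositions, the zeroth power being the identity. $I_\nu$ is the modified Bessel function of the first kind of order $\nu$ (Bessel function of imaginary argument). Values at $t=0$ and at $x_j=0$ are understood as limits from the interior of the domain.
   Formalization: The integrals of f_k(s)G(x,s,t) over R^n_+ for 1 ≤ k ≤ m−1 are additionally assumed to converge absolutely for all x and t>0; bounded φ_j may have unbounded derivatives, so without this u may be undefined (e.g. n=1, m=2, φ_1=0, φ_0=sin(exp(x^4)) cut off near 0). *)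

theory Defs
  imports "HOL-Analysis.Analysis"
begin

definition pos_orthant :: "(real^'n) set" where
  "pos_orthant = {x. \<forall>k. x $ k > 0}"

definition orthant_face :: "'n \<Rightarrow> (real^'n) set" where
  "orthant_face k = {x. x $ k = 0 \<and> (\<forall>i. x $ i \<ge> 0)}"

definition partial :: "'n \<Rightarrow> (real^'n \<Rightarrow> real) \<Rightarrow> real^'n \<Rightarrow> real" where
  "partial k f x = deriv (\<lambda>h. f (x + h *\<^sub>R axis k 1)) 0"

definition has_partial_on :: "'n \<Rightarrow> (real^'n) set \<Rightarrow> (real^'n \<Rightarrow> real) \<Rightarrow> bool" where
  "has_partial_on k U f \<longleftrightarrow> (\<forall>x\<in>U. (\<lambda>h. f (x + h *\<^sub>R axis k 1)) differentiable (at 0))"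

text \<open>For a list of indices, the mixed partial derivative that differentiates once for each
  entry; the last entry acts first.\<close>

definition mixed_partial :: "'n list \<Rightarrow> (real^'n \<Rightarrow> real) \<Rightarrow> real^'n \<Rightarrow> real" where
  "mixed_partial ks f = foldr partial ks f"

fun Ck_on :: "nat \<Rightarrow> (real^'n) set \<Rightarrow> (real^'n \<Rightarrow> real) \<Rightarrow> bool" where
  "Ck_on 0 U f \<longleftrightarrow> continuous_on U f"
| "Ck_on (Suc N) U f \<longleftrightarrow>
     continuous_on U f \<and> (\<forall>k. has_partial_on k U f \<and> Ck_on N U (partial k f))"

definition time_deriv :: "(real^'n \<Rightarrow> real \<Rightarrow> real) \<Rightarrow> real^'n \<Rightarrow> real \<Rightarrow> real" where
  "time_deriv u x t = deriv (u x) t"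

text \<open>Parabolic smoothness on U x J, a derivative in t counting twice: all mixed derivatives
  with i differentiations in t and l differentiations in x, in any order, exist and are jointly
  continuous whenever 2 * i + l is at most N.  For N = 2 * m this is the class of functions for
  which all derivatives occurring in the m-th power of the heat operator are classical.\<close>

fun parabolic_Ck_on ::
  "nat \<Rightarrow> (real^'n) set \<Rightarrow> real set \<Rightarrow> (real^'n \<Rightarrow> real \<Rightarrow> real) \<Rightarrow> bool" where
  "parabolic_Ck_on 0 U J u \<longleftrightarrow> continuous_on (U \<times> J) (\<lambda>(x, t). u x t)"
| "parabolic_Ck_on (Suc 0) U J u \<longleftrightarrow>
     continuous_on (U \<times> J) (\<lambda>(x, t). u x t) \<and>
     (\<forall>k. (\<forall>t\<in>J. has_partial_on k U (\<lambda>y. u y t)) \<and>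
          parabolic_Ck_on 0 U J (\<lambda>x t. partial k (\<lambda>y. u y t) x))"
| "parabolic_Ck_on (Suc (Suc N)) U J u \<longleftrightarrow>
     continuous_on (U \<times> J) (\<lambda>(x, t). u x t) \<and>
     (\<forall>k. (\<forall>t\<in>J. has_partial_on k U (\<lambda>y. u y t)) \<and>
          parabolic_Ck_on (Suc N) U J (\<lambda>x t. partial k (\<lambda>y. u y t) x)) \<and>
     (\<forall>x\<in>U. \<forall>t\<in>J. u x differentiable (at t)) \<and>
     parabolic_Ck_on N U J (time_deriv u)"

definition bessel_op :: "real^'n \<Rightarrow> 'n \<Rightarrow> (real^'n \<Rightarrow> real) \<Rightarrow> real^'n \<Rightarrow> real" where
  "bessel_op \<gamma> k f x =
     partial k (partial k f) x + (2 * \<gamma> $ k + 1) / (x $ k) * partial k f x"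

definition bessel_laplacian :: "real^'n \<Rightarrow> (real^'n \<Rightarrow> real) \<Rightarrow> real^'n \<Rightarrow> real" where
  "bessel_laplacian \<gamma> f x = (\<Sum>k\<in>UNIV. bessel_op \<gamma> k f x)"

definition bessel_heat_op ::
  "real^'n \<Rightarrow> (real^'n \<Rightarrow> real \<Rightarrow> real) \<Rightarrow> real^'n \<Rightarrow> real \<Rightarrow> real" where
  "bessel_heat_op \<gamma> u x t = time_deriv u x t - bessel_laplacian \<gamma> (\<lambda>y. u y t) x"

text \<open>The modified Bessel function of the first kind, for z > 0 and \<nu> not a negative integer.\<close>

definition bessel_I :: "real \<Rightarrow> real \<Rightarrow> real" where
  "bessel_I \<nu> z =
     (z / 2) powr \<nu> * (\<Sum>k. (z / 2) ^ (2 * k) / (fact k * Gamma (\<nu> + real k + 1)))"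

definition cauchy_data ::
  "real^'n \<Rightarrow> (nat \<Rightarrow> real^'n \<Rightarrow> real) \<Rightarrow> nat \<Rightarrow> real^'n \<Rightarrow> real" where
  "cauchy_data \<gamma> \<phi> k x =
     (\<Sum>j=0..k. (-1) ^ j * real (k choose j) * (bessel_laplacian \<gamma> ^^ j) (\<phi> (k - j)) x)"

definition heat_G :: "real^'n \<Rightarrow> real^'n \<Rightarrow> real^'n \<Rightarrow> real \<Rightarrow> real" where
  "heat_G \<gamma> x s t =
     (\<Prod>j\<in>UNIV. (s $ j) powr (\<gamma> $ j + 1) * bessel_I (\<gamma> $ j) (x $ j * s $ j / (2 * t)))
     * exp (- ((norm x)\<^sup>2 + (norm s)\<^sup>2) / (4 * t))"

definition polyheat_solution ::
  "real^'n \<Rightarrow> nat \<Rightarrow> (nat \<Rightarrow> real^'n \<Rightarrow> real) \<Rightarrow> real^'n \<Rightarrow> real \<Rightarrow> real" where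
  "polyheat_solution \<gamma> m \<phi> x t =
     1 / (2 * t) ^ CARD('n) * (\<Prod>j\<in>UNIV. (x $ j) powr (- (\<gamma> $ j)))
     * (\<Sum>k=0..<m. t ^ k / fact k *
         (LINT s:pos_orthant|lborel. cauchy_data \<gamma> \<phi> k s * heat_G \<gamma> x s t))"

end

theory Submission
  imports Defs
begin

text \<open>Poisson's integral writes \<open>z powr (- \<nu>) * I\<^sub>\<nu> z\<close> as an average of \<open>exp (z * sin \<theta>)\<close>, so the heat
  kernel of \<open>\<Delta>\<^sub>B\<close> is an average over \<open>\<theta>\<close> of Gaussians \<open>t powr (- N) * exp (- R / (4 * t))\<close> with
  \<open>R = |s|\<^sup>2 + |x|\<^sup>2 - 2 * (\<Sum>j. x\<^sub>j s\<^sub>j sin \<theta>\<^sub>j)\<close>. Hence the integral \<open>P f\<close> of \<open>f\<close> against this kernel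
  extends smoothly to \<open>x \<in> \<real>\<^sup>n\<close> and is even in every \<open>x\<^sub>j\<close>, which gives the boundary conditions, and
  its \<open>r\<close>-th time derivative is bounded by \<open>C t\<^sup>-\<^sup>r P |f|\<close> at time \<open>2 t\<close>. The heat equation for
  the kernel is an exact derivative in \<open>\<theta>\<close>, and \<open>(\<partial>\<^sub>t - \<Delta>\<^sub>B)\<close> maps \<open>t\<^sup>k / k! P f\<close> to
  \<open>t\<^sup>k\<^sup>-\<^sup>1 / (k-1)! P f\<close>, so its \<open>m\<close>-th power annihilates \<open>u\<close>. For the initial conditions only the
  behaviour of the data near \<open>x\<close> matters: after multiplying by a cut-off, Green's identity moves
  time derivatives onto the data as powers of \<open>\<Delta>\<^sub>B\<close>, the surplus derivatives are absorbed by powers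
  of \<open>t\<close>, and binomial inversion recovers \<open>\<phi>\<^sub>k\<close> from the \<open>f\<^sub>l\<close>.\<close>

section \<open>Regularity classes and differentiation under the integral sign\<close>

text \<open>The data \<open>cauchy_data \<gamma> \<phi> k\<close> with k \<ge> 1 contain derivatives
  of the \<phi> that need not be bounded, so no sup norm is available: everything is stated for
  functions that are integrable against the weight times every Gaussian, and estimates are made
  under the integral. Two obstacles shape the behaviour at t = 0. The operator is singular at the
  faces, and the k-th datum has only 2(m - k) - 1 derivatives, one short of what m - k powers of the
  operator would need. A cut-off supported inside the open orthant removes the first: Green's
  identity then has no boundary terms. The second is harmless because at most m - 1 time derivatives
  are taken; a derivative too many for the datum always comes with a positive power of t left over
  from t^k / k!. One abstract family of Gaussian integrals serves twice, because R is symmetric in x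
  and s. Integrated over s and \<theta> it yields the solution as a function of x; integrated over
  \<theta> alone it yields the kernel as a function of s, which is the function that Green's
  identity acts on.\<close>

abbreviation has_partial :: "'n \<Rightarrow> (real^'n \<Rightarrow> real) \<Rightarrow> real \<Rightarrow> real^'n \<Rightarrow> bool" where
  "has_partial k f d x \<equiv> ((\<lambda>h. f (x + h *\<^sub>R axis k 1)) has_real_derivative d) (at 0)"

lemma partialI: "has_partial k f d x \<Longrightarrow> partial k f x = d"
  unfolding partial_def by (rule DERIV_imp_deriv)

lemma has_partial_on_iff: "has_partial_on k U f \<longleftrightarrow> (\<forall>x\<in>U. has_partial k f (partial k f x) x)"
  unfolding has_partial_on_def partial_def by (simp add: DERIV_deriv_iff_real_differentiable)

lemma has_partial_onI: "(\<And>x. x \<in> U \<Longrightarrow> has_partial k f (d x) x) \<Longrightarrow> has_partial_on k U f"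
  unfolding has_partial_on_def using real_differentiable_def by blast

lemma eventually_line_in_open:
  fixes x :: "real^'n"
  assumes "open U" "x \<in> U"
  shows "eventually (\<lambda>h. x + h *\<^sub>R axis k 1 \<in> U) (nhds 0)"
proof -
  have "((\<lambda>h. x + h *\<^sub>R axis k 1) \<longlongrightarrow> x + 0 *\<^sub>R axis k 1) (nhds 0)"
    by (intro tendsto_intros filterlim_ident)
  then show ?thesis using assms by (auto dest: topological_tendstoD)
qed

lemma has_partial_cong_open:
  assumes "open U" "x \<in> U" "\<And>y. y \<in> U \<Longrightarrow> f y = g y"
  shows "has_partial k f d x \<longleftrightarrow> has_partial k g d x"
  by (rule DERIV_cong_ev[OF refl _ refl])
     (use eventually_line_in_open[OF assms(1,2), of k] assms(3) in \<open>auto elim: eventually_mono\<close>)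

text \<open>\<open>deriv\<close> is defined from the derivative relation alone, and this relation is
  the same for both functions. Equality therefore holds also where neither derivative exists, and no
  differentiability has to be carried along.\<close>

lemma partial_cong_open:
  assumes "open U" "x \<in> U" "\<And>y. y \<in> U \<Longrightarrow> f y = g y"
  shows "partial k f x = partial k g x"
  unfolding partial_def deriv_def using has_partial_cong_open[OF assms(1,2), of f g] assms(3) by simp

lemma has_partial_on_cong:
  assumes "open U" "\<And>y. y \<in> U \<Longrightarrow> f y = g y"
  shows "has_partial_on k U f \<longleftrightarrow> has_partial_on k U g"
  unfolding has_partial_on_def real_differentiable_def
  by (intro ball_cong refl iff_exI has_partial_cong_open[OF assms(1)] assms(2))

lemma Ck_on_cong:
  assumes "open U" "\<And>y. y \<in> U \<Longrightarrow> f y = g y"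
  shows "Ck_on N U f \<longleftrightarrow> Ck_on N U g"
  using assms(2)
proof (induction N arbitrary: f g)
  case 0
  then show ?case by (simp cong: continuous_on_cong)
next
  case (Suc N)
  have "continuous_on U f \<longleftrightarrow> continuous_on U g" using Suc.prems by (simp cong: continuous_on_cong)
  moreover have "has_partial_on k U f \<longleftrightarrow> has_partial_on k U g" for k
    using assms(1) Suc.prems by (rule has_partial_on_cong)
  moreover have "Ck_on N U (partial k f) \<longleftrightarrow> Ck_on N U (partial k g)" for k
    using partial_cong_open[OF assms(1) _ Suc.prems] by (intro Suc.IH)
  ultimately show ?case by simp
qed

lemma Ck_on_continuous: "Ck_on N U f \<Longrightarrow> continuous_on U f"
  by (cases N) auto

lemma Ck_on_SucD: "Ck_on (Suc N) U f \<Longrightarrow> Ck_on N U f"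
proof (induction N arbitrary: f)
  case (Suc N)
  have "Ck_on N U (partial k f)" for k
    using Suc.prems by (intro Suc.IH) (subst (asm) Ck_on.simps(2), blast)
  then show ?case using Suc.prems by simp
qed simp

lemma Ck_on_mono: "M \<le> N \<Longrightarrow> Ck_on N U f \<Longrightarrow> Ck_on M U f"
  by (induction rule: inc_induct) (auto dest: Ck_on_SucD simp del: Ck_on.simps)

lemma Ck_on_partial: "Ck_on (Suc N) U f \<Longrightarrow> Ck_on N U (partial k f)"
  by simp

lemma Ck_on_has_partial: "Ck_on (Suc N) U f \<Longrightarrow> x \<in> U \<Longrightarrow> has_partial k f (partial k f x) x"
  by (simp add: has_partial_on_iff)

lemma Ck_on_SucI:
  assumes "open U" "continuous_on U f" "\<And>k x. x \<in> U \<Longrightarrow> has_partial k f (f' k x) x"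
    "\<And>k. Ck_on N U (f' k)"
  shows "Ck_on (Suc N) U f"
proof -
  have "Ck_on N U (partial k f)" for k
    using assms(3)[THEN partialI, of _ k] assms(4)[of k]
    by (subst Ck_on_cong[OF assms(1), where g="f' k"])
  then show ?thesis using assms(2,3) by (auto intro: has_partial_onI)
qed

lemma Ck_on_const: "open U \<Longrightarrow> Ck_on N U (\<lambda>x. c)"
proof (induction N arbitrary: c)
  case (Suc N)
  then show ?case by (intro Ck_on_SucI[where f'="\<lambda>k x. 0"]) auto
qed auto

lemma Ck_on_add:
  assumes "open U"
  shows "Ck_on N U f \<Longrightarrow> Ck_on N U g \<Longrightarrow> Ck_on N U (\<lambda>x. f x + g x)"
proof (induction N arbitrary: f g)
  case 0
  then show ?case by (simp add: continuous_on_add)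
next
  case (Suc N)
  show ?case
  proof (rule Ck_on_SucI[OF assms, where f'="\<lambda>k x. partial k f x + partial k g x"])
    show "continuous_on U (\<lambda>x. f x + g x)" using Suc.prems by (simp add: continuous_on_add)
  qed (use Suc in \<open>auto intro!: DERIV_add Ck_on_has_partial simp del: Ck_on.simps\<close>,
       auto)
qed

lemma has_partial_mult:
  assumes "has_partial k f f' x" "has_partial k g g' x"
  shows "has_partial k (\<lambda>x. f x * g x) (f' * g x + f x * g') x"
  using DERIV_mult[OF assms] by (simp add: algebra_simps)

lemma Ck_on_mult:
  assumes "open U"
  shows "Ck_on N U f \<Longrightarrow> Ck_on N U g \<Longrightarrow> Ck_on N U (\<lambda>x. f x * g x)"
proof (induction N arbitrary: f g)
  case 0
  then show ?case by (simp add: continuous_on_mult)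
next
  case (Suc N)
  show ?case
  proof (rule Ck_on_SucI[OF assms, where f'="\<lambda>k x. partial k f x * g x + f x * partial k g x"])
    show "continuous_on U (\<lambda>x. f x * g x)" using Suc.prems by (simp add: continuous_on_mult)
    show "Ck_on N U (\<lambda>x. partial k f x * g x + f x * partial k g x)" for k
      by (intro Ck_on_add assms Suc.IH Ck_on_partial Suc.prems Ck_on_SucD)
  qed (intro has_partial_mult Ck_on_has_partial[OF Suc.prems(1)] Ck_on_has_partial[OF Suc.prems(2)])
qed

lemma Ck_on_sum:
  assumes "open U" "finite I" "\<And>i. i \<in> I \<Longrightarrow> Ck_on N U (f i)"
  shows "Ck_on N U (\<lambda>x. \<Sum>i\<in>I. f i x)"
  using assms(2,3) by induction (auto intro: Ck_on_const Ck_on_add assms(1))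

lemma has_partial_coord: "has_partial k (\<lambda>x. x $ j) (if j = k then 1 else 0) x"
  by (auto simp: axis_def intro!: derivative_eq_intros)

lemma Ck_on_coord: "open U \<Longrightarrow> Ck_on N U (\<lambda>x. x $ j)"
proof (cases N)
  case (Suc M)
  assume "open U"
  then show ?thesis unfolding Suc
    by (intro Ck_on_SucI[where f'="\<lambda>k x. if j = k then 1 else 0"] has_partial_coord)
       (auto intro!: continuous_intros Ck_on_const)
qed (auto intro!: continuous_intros)

text \<open>Stated for a finite sequence of successive derivatives, so that it applies both to reciprocals
  and to cut-offs of finite smoothness built from \<open>max 0\<close>.\<close>

lemma Ck_on_compose_real:
  assumes "open U" "\<And>i x. i < N \<Longrightarrow> x \<in> U \<Longrightarrow> (p i has_real_derivative p (Suc i) (g x)) (at (g x))"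
    "\<And>i. i \<le> N \<Longrightarrow> continuous_on (g ` U) (p i)" "Ck_on N U g"
  shows "Ck_on N U (\<lambda>x. p 0 (g x))"
  using assms(2,3,4)
proof (induction N arbitrary: p)
  case 0
  then show ?case by (auto intro: continuous_on_compose2)
next
  case (Suc N)
  have IH: "Ck_on N U (\<lambda>x. p (Suc 0) (g x))"
    by (rule Suc.IH[of "\<lambda>i. p (Suc i)"]) (use Suc.prems Ck_on_SucD in \<open>auto simp del: Ck_on.simps\<close>)
  show ?case
  proof (rule Ck_on_SucI[OF assms(1), where f'="\<lambda>k x. p (Suc 0) (g x) * partial k g x"])
    show "continuous_on U (\<lambda>x. p 0 (g x))"
      using Suc.prems(2)[of 0] Ck_on_continuous[OF Suc.prems(3)]
      by (auto intro: continuous_on_compose2)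
    show "has_partial k (\<lambda>x. p 0 (g x)) (p (Suc 0) (g x) * partial k g x) x" if "x \<in> U" for k x
      using DERIV_chain2[OF _ Ck_on_has_partial[OF Suc.prems(3) that, of k], of "p 0" "p (Suc 0) (g x)"]
        Suc.prems(1)[of 0 x] that by simp
    show "Ck_on N U (\<lambda>x. p (Suc 0) (g x) * partial k g x)" for k
      by (intro Ck_on_mult assms(1) IH Ck_on_partial Suc.prems(3))
  qed
qed

lemma pos_orthantD: "x \<in> pos_orthant \<Longrightarrow> 0 < x $ k"
  by (simp add: pos_orthant_def)

lemma open_pos_orthant: "open (pos_orthant :: (real^'n) set)"
proof -
  have "pos_orthant = (\<Inter>k. {x :: real^'n. 0 < x $ k})" by (auto simp: pos_orthant_def)
  also have "open \<dots>" by (intro open_INT ballI open_Collect_less continuous_intros) auto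
  finally show ?thesis .
qed

lemma Ck_on_inverse_coord: "Ck_on N pos_orthant (\<lambda>x::real^'n. inverse (x $ j))"
proof -
  \<comment> \<open>\<open>p i\<close> is the i-th derivative of 1/y, that is (-1)^i i! /
    y^(i+1).\<close>
  define p where "p = (\<lambda>i y. (-1) ^ i * fact i * inverse y ^ Suc i :: real)"
  have "(p i has_real_derivative p (Suc i) y) (at y)" if "y \<noteq> 0" for i y
    unfolding p_def using that
    by (auto intro!: derivative_eq_intros simp: field_simps power2_eq_square simp del: power_Suc)
      (simp add: field_simps)?
  moreover have "continuous_on ((\<lambda>x::real^'n. x $ j) ` pos_orthant) (p i)" for i
    unfolding p_def by (intro continuous_intros) (auto dest: pos_orthantD[of _ j])
  ultimately have "Ck_on N pos_orthant (\<lambda>x. p 0 (x $ j))"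
    by (intro Ck_on_compose_real[where p=p and g="\<lambda>x. x $ j"] open_pos_orthant Ck_on_coord)
       (auto dest: pos_orthantD[of _ j])
  then show ?thesis by (simp add: p_def)
qed

section \<open>Parabolic regularity\<close>

lemma time_deriv_cong_open:
  assumes "open J" "t \<in> J" "\<And>t. t \<in> J \<Longrightarrow> u x t = v x t"
  shows "time_deriv u x t = time_deriv v x t"
  unfolding time_deriv_def by (rule deriv_cong_ev) (use assms in \<open>auto simp: eventually_nhds\<close>)

lemma parabolic_Ck_on_cong:
  assumes "open U" "open J" "\<And>x t. x \<in> U \<Longrightarrow> t \<in> J \<Longrightarrow> u x t = v x t"
  shows "parabolic_Ck_on N U J u \<longleftrightarrow> parabolic_Ck_on N U J v"
  using assms(3)
\<comment> \<open>Order N refers back to order N - 1 through a space derivative and to order N - 2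
  through a time derivative, hence complete induction.\<close>
proof (induction N arbitrary: u v rule: less_induct)
  case (less N)
  have c: "continuous_on (U \<times> J) (\<lambda>(x, t). u x t) \<longleftrightarrow> continuous_on (U \<times> J) (\<lambda>(x, t). v x t)"
    by (rule continuous_on_cong) (use less.prems in auto)
  have p: "has_partial_on k U (\<lambda>y. u y t) \<longleftrightarrow> has_partial_on k U (\<lambda>y. v y t)" if "t \<in> J" for t k
    using less.prems that by (intro has_partial_on_cong assms(1)) auto
  have pe: "partial k (\<lambda>y. u y t) x = partial k (\<lambda>y. v y t) x" if "x \<in> U" "t \<in> J" for x t k
    using less.prems that by (intro partial_cong_open[OF assms(1)]) auto
  have d: "u x differentiable (at t) \<longleftrightarrow> v x differentiable (at t)" if "x \<in> U" "t \<in> J" for x t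
    using less.prems that assms(2)
    unfolding real_differentiable_def
    by (intro iff_exI DERIV_cong_ev) (auto simp: eventually_nhds)
  have pp: "parabolic_Ck_on M U J (\<lambda>x t. partial k (\<lambda>y. u y t) x) \<longleftrightarrow>
      parabolic_Ck_on M U J (\<lambda>x t. partial k (\<lambda>y. v y t) x)" if "M < N" for M k
    by (rule less.IH[OF that]) (rule pe)
  have tt: "parabolic_Ck_on M U J (time_deriv u) \<longleftrightarrow> parabolic_Ck_on M U J (time_deriv v)" if "M < N" for M
    by (rule less.IH[OF that]) (use less.prems assms(2) in \<open>auto intro: time_deriv_cong_open\<close>)
  consider "N = 0" | "N = Suc 0" | M where "N = Suc (Suc M)"
    by (metis not0_implies_Suc)
  then show ?case
  proof cases
    case 1 then show ?thesis using c by simp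
  next
    case 2 then show ?thesis using c p pp[of 0] unfolding 2 parabolic_Ck_on.simps(2) by auto
  next
    case 3
    have "M < N" "Suc M < N" using 3 by auto
    note pp[OF this(2)] tt[OF this(1)]
    then show ?thesis using c p d unfolding 3 parabolic_Ck_on.simps(3) by auto
  qed
qed

text \<open>If every first derivative of a member of V agrees on U \<times> J with a member of V,
  then no derivative ever leaves V up to equality on U \<times> J, and congruence removes that last
  proviso. Joint continuity of the members is all that then remains to be checked at each
  order.\<close>

lemma parabolic_Ck_on_closed_class:
  assumes "open U" "open J"
    and cont: "\<And>F. F \<in> V \<Longrightarrow> continuous_on (U \<times> J) (\<lambda>(x, t). F x t)"
    and px: "\<And>F k. F \<in> V \<Longrightarrow> \<exists>G\<in>V. \<forall>x\<in>U. \<forall>t\<in>J. has_partial k (\<lambda>y. F y t) (G x t) x"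
    and pt: "\<And>F. F \<in> V \<Longrightarrow> \<exists>G\<in>V. \<forall>x\<in>U. \<forall>t\<in>J. (F x has_real_derivative G x t) (at t)"
    and "F \<in> V"
  shows "parabolic_Ck_on N U J F"
  using \<open>F \<in> V\<close>
proof (induction N arbitrary: F rule: less_induct)
  case (less N)
  have p: "has_partial_on k U (\<lambda>y. F y t)" if "t \<in> J" for t k
  proof -
    obtain G where "\<forall>x\<in>U. \<forall>t\<in>J. has_partial k (\<lambda>y. F y t) (G x t) x"
      using px[OF less.prems] by blast
    then show ?thesis using that by (intro has_partial_onI[where d="\<lambda>x. G x t"]) auto
  qed
  have pp: "parabolic_Ck_on M U J (\<lambda>x t. partial k (\<lambda>y. F y t) x)" if "M < N" for M k
  proof -
    obtain G where G: "G \<in> V" "\<forall>x\<in>U. \<forall>t\<in>J. has_partial k (\<lambda>y. F y t) (G x t) x"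
      using px[OF less.prems] by blast
    then show ?thesis using less.IH[OF that G(1)]
      by (subst parabolic_Ck_on_cong[OF assms(1,2), where v=G]) (auto intro: partialI)
  qed
  have tt: "parabolic_Ck_on M U J (time_deriv F)" if "M < N" for M
  proof -
    obtain G where G: "G \<in> V" "\<forall>x\<in>U. \<forall>t\<in>J. (F x has_real_derivative G x t) (at t)"
      using pt[OF less.prems] by blast
    then show ?thesis using less.IH[OF that G(1)]
      by (subst parabolic_Ck_on_cong[OF assms(1,2), where v=G]) (auto intro: DERIV_imp_deriv simp: time_deriv_def)
  qed
  have d: "F x differentiable (at t)" if "x \<in> U" "t \<in> J" for x t
    using pt[OF less.prems] that real_differentiable_def by blast
  consider "N = 0" | "N = Suc 0" | M where "N = Suc (Suc M)"
    by (metis not0_implies_Suc)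
  then show ?case
  proof cases
    case 1 then show ?thesis using cont[OF less.prems] by simp
  next
    case 2 then show ?thesis using cont[OF less.prems] p pp[of 0] unfolding 2 parabolic_Ck_on.simps(2) by auto
  next
    case 3
    have "M < N" "Suc M < N" using 3 by auto
    note pp[OF this(2)] tt[OF this(1)]
    then show ?thesis using cont[OF less.prems] p d unfolding 3 parabolic_Ck_on.simps(3) by auto
  qed
qed

lemma parabolic_Ck_on_subset:
  assumes "V \<subseteq> U"
  shows "parabolic_Ck_on N U J u \<Longrightarrow> parabolic_Ck_on N V J u"
proof (induction N arbitrary: u rule: less_induct)
  case (less N)
  have *: "continuous_on (U \<times> J) f \<Longrightarrow> continuous_on (V \<times> J) f" for f :: "_ \<Rightarrow> real"
    by (rule continuous_on_subset) (use assms in auto)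
  have **: "has_partial_on k U f \<Longrightarrow> has_partial_on k V f" for f k
    using assms by (auto simp: has_partial_on_def)
  consider "N = 0" | "N = Suc 0" | M where "N = Suc (Suc M)"
    by (metis not0_implies_Suc)
  then show ?case
  proof cases
    case 1 then show ?thesis using less.prems * by simp
  next
    case 2
    then show ?thesis using less.prems * ** less.IH[of 0]
      unfolding 2 parabolic_Ck_on.simps(2) by blast
  next
    case 3
    have "M < N" "Suc M < N" using 3 by auto
    then show ?thesis using less.prems * ** less.IH assms
      unfolding 3 parabolic_Ck_on.simps(3) by blast
  qed
qed

text \<open>The mean value inequality on the interval of radius d turns the bound on the derivative
  into the same bound on the difference quotients, so dominated convergence applies along every
  sequence tending to \<open>h0\<close>.\<close>

lemma has_real_derivative_integral_dominated:
  fixes F F' :: "real \<Rightarrow> 'a \<Rightarrow> real"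
  assumes "d > 0"
    and int: "\<And>h. \<bar>h - h0\<bar> < d \<Longrightarrow> integrable M (F h)"
    and der: "\<And>h w. \<bar>h - h0\<bar> < d \<Longrightarrow> w \<in> space M \<Longrightarrow> ((\<lambda>h. F h w) has_real_derivative F' h w) (at h)"
    and bd: "\<And>h w. \<bar>h - h0\<bar> < d \<Longrightarrow> w \<in> space M \<Longrightarrow> \<bar>F' h w\<bar> \<le> B w"
    and B: "integrable M B"
    and m: "F' h0 \<in> borel_measurable M"
  shows "((\<lambda>h. \<integral>w. F h w \<partial>M) has_real_derivative (\<integral>w. F' h0 w \<partial>M)) (at h0)"
    and "integrable M (F' h0)"
proof -
  show i': "integrable M (F' h0)"
    by (rule Bochner_Integration.integrable_bound[OF B m])
      (intro AE_I2, use bd[of h0] assms(1) in \<open>fastforce intro: order_trans\<close>)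
  have "((\<lambda>h. ((\<integral>w. F h w \<partial>M) - (\<integral>w. F h0 w \<partial>M)) / (h - h0)) \<longlongrightarrow> (\<integral>w. F' h0 w \<partial>M)) (at h0)"
  proof (rule tendsto_at_iff_sequentially[THEN iffD2], intro allI impI)
    fix X assume X: "\<forall>i. X i \<in> UNIV - {h0}" "X \<longlonglongrightarrow> h0"
    \<comment> \<open>The sequence may start outside the interval on which the hypotheses hold; the
      argument runs on a tail, and \<open>LIMSEQ_offset\<close> undoes the shift at the end.\<close>
    obtain n0 where n0: "\<bar>X n - h0\<bar> < d" if "n \<ge> n0" for n
      using X(2) \<open>d > 0\<close> unfolding LIMSEQ_def dist_real_def by blast
    define Y where "Y = (\<lambda>i. X (i + n0))"
    have Y: "\<bar>Y i - h0\<bar> < d" "Y i \<noteq> h0" "Y \<longlonglongrightarrow> h0" for i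
      using n0 X(1) LIMSEQ_ignore_initial_segment[OF X(2)] by (auto simp: Y_def)
    have "(\<lambda>i. \<integral>w. (F (Y i) w - F h0 w) / (Y i - h0) \<partial>M) \<longlonglongrightarrow> (\<integral>w. F' h0 w \<partial>M)"
    proof (rule integral_dominated_convergence[where w=B])
      show "(\<lambda>w. (F (Y i) w - F h0 w) / (Y i - h0)) \<in> borel_measurable M" for i
        using int[OF Y(1)] int[of h0] \<open>d > 0\<close>
        by (intro borel_measurable_divide borel_measurable_diff borel_measurable_const) auto
      show "AE w in M. (\<lambda>i. (F (Y i) w - F h0 w) / (Y i - h0)) \<longlonglongrightarrow> F' h0 w"
      proof (rule AE_I2)
        fix w assume w: "w \<in> space M"
        have "((\<lambda>h. (F h w - F h0 w) / (h - h0)) \<longlongrightarrow> F' h0 w) (at h0)"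
          using der[OF _ w, of h0] \<open>d > 0\<close> by (simp add: has_field_derivative_iff)
        then show "(\<lambda>i. (F (Y i) w - F h0 w) / (Y i - h0)) \<longlonglongrightarrow> F' h0 w"
          unfolding tendsto_at_iff_sequentially comp_def using Y by auto
      qed
      show "AE w in M. norm ((F (Y i) w - F h0 w) / (Y i - h0)) \<le> B w" for i
      proof (rule AE_I2)
        fix w assume w: "w \<in> space M"
        have "norm (F (Y i) w - F h0 w) \<le> B w * norm (Y i - h0)"
        proof (rule field_differentiable_bound[where S="ball h0 d" and f'="\<lambda>h. F' h w"])
          show "norm (F' z w) \<le> B w" if "z \<in> ball h0 d" for z
            using bd[OF _ w, of z] that by (auto simp: dist_real_def abs_minus_commute)
          show "((\<lambda>h. F h w) has_real_derivative F' z w) (at z within ball h0 d)" if "z \<in> ball h0 d" for z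
            using der[OF _ w, of z] that
            by (auto simp: dist_real_def abs_minus_commute intro: has_field_derivative_at_within)
        qed (use Y(1)[of i] \<open>d > 0\<close> in \<open>auto simp: dist_real_def abs_minus_commute\<close>)
        then show "norm ((F (Y i) w - F h0 w) / (Y i - h0)) \<le> B w"
          using Y(2)[of i] by (simp add: norm_divide divide_simps)
      qed
    qed (use i' B in auto)
    moreover have "(\<integral>w. (F (Y i) w - F h0 w) / (Y i - h0) \<partial>M) =
        ((\<integral>w. F (Y i) w \<partial>M) - (\<integral>w. F h0 w \<partial>M)) / (Y i - h0)" for i
      using int[OF Y(1), of i] int[of h0] \<open>d > 0\<close>
      by (subst Bochner_Integration.integral_diff[symmetric]) auto
    ultimately have "(\<lambda>i. ((\<integral>w. F (X (i + n0)) w \<partial>M) - (\<integral>w. F h0 w \<partial>M)) / (X (i + n0) - h0))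
        \<longlonglongrightarrow> (\<integral>w. F' h0 w \<partial>M)"
      by (simp only: Y_def)
    then show "((\<lambda>h. ((\<integral>w. F h w \<partial>M) - (\<integral>w. F h0 w \<partial>M)) / (h - h0)) \<circ> X) \<longlonglongrightarrow> (\<integral>w. F' h0 w \<partial>M)"
      unfolding comp_def by (rule LIMSEQ_offset)
  qed
  then show "((\<lambda>h. \<integral>w. F h w \<partial>M) has_real_derivative (\<integral>w. F' h0 w \<partial>M)) (at h0)"
    by (simp add: has_field_derivative_iff)
qed

section \<open>Gaussian integrals with parameters\<close>

text \<open>An abstraction of the exponent of the heat kernel: \<open>Q\<close> stands for the
  square of a norm and \<open>b\<close> for the vector with components s_j sin \<theta>_j. The last
  assumption makes R a sum of two nonnegative terms, |x - b|^2 and Q - |b|^2. Any measure space may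
  carry the parameters, so the angles can be integrated with or without the space variable.\<close>

locale gauss_family =
  fixes M :: "'a measure" and Q :: "'a \<Rightarrow> real" and b :: "'a \<Rightarrow> real^'n"
  assumes Q_measurable [measurable]: "Q \<in> borel_measurable M"
    and b_measurable [measurable]: "b \<in> borel_measurable M"
    and norm_b_le: "(norm (b w))\<^sup>2 \<le> Q w"
begin

lemma b_nth_measurable [measurable]: "(\<lambda>w. b w $ k) \<in> borel_measurable M"
  by (rule measurable_compose[OF b_measurable]) (intro borel_measurable_continuous_onI continuous_intros)

definition R :: "real^'n \<Rightarrow> 'a \<Rightarrow> real" where
  "R x w = Q w + (norm x)\<^sup>2 - 2 * (x \<bullet> b w)"

text \<open>All e > 0 are demanded because Q enters the exponent with a factor of order 1/t, for
  arbitrary t, and because every extra factor Q uses up half of the available exponent.\<close>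

definition adm :: "('a \<Rightarrow> real) \<Rightarrow> bool" where
  "adm g \<longleftrightarrow> g \<in> borel_measurable M \<and> (\<forall>e>0. integrable M (\<lambda>w. g w * exp (- e * Q w)))"

definition Phi :: "('a \<Rightarrow> real) \<Rightarrow> real^'n \<Rightarrow> real \<Rightarrow> real" where
  "Phi g x t = (\<integral>w. g w * exp (- R x w / (4 * t)) \<partial>M)"

lemma adm_integrable: "adm g \<Longrightarrow> 0 < e \<Longrightarrow> integrable M (\<lambda>w. g w * exp (- e * Q w))"
  by (simp add: adm_def)

lemma R_measurable [measurable]: "R x \<in> borel_measurable M"
  unfolding R_def by measurable

lemma adm_measurable: "adm g \<Longrightarrow> g \<in> borel_measurable M"
  by (simp add: adm_def)

lemma Q_nonneg: "0 \<le> Q w"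
  using norm_b_le[of w] zero_le_power2[of "norm (b w)"] by linarith

lemma abs_b_le: "\<bar>b w $ k\<bar> \<le> 1 + Q w"
proof -
  have "\<bar>b w $ k\<bar> \<le> norm (b w)" by (rule component_le_norm_cart)
  also have "\<dots> \<le> 1 + (norm (b w))\<^sup>2"
    using zero_le_power2[of "norm (b w) - 1/2"] by (simp add: power2_eq_square algebra_simps)
  finally show ?thesis using norm_b_le[of w] by linarith
qed

lemma R_eq: "R x w = (norm (x - b w))\<^sup>2 + (Q w - (norm (b w))\<^sup>2)"
  by (simp add: R_def power2_norm_eq_inner inner_diff inner_commute algebra_simps)

lemma R_nonneg: "0 \<le> R x w"
  using norm_b_le[of w] unfolding R_eq by (smt (verit) zero_le_power2)

text \<open>The square of 2|x| - |b| is nonnegative. The constants are chosen so that half of Q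
  survives in the lower bound \<open>R_ge\<close>.\<close>

lemma inner_b_le: "2 * \<bar>x \<bullet> b w\<bar> \<le> 2 * (norm x)\<^sup>2 + Q w / 2"
proof -
  have "2 * \<bar>x \<bullet> b w\<bar> \<le> 2 * (norm x * norm (b w))"
    using Cauchy_Schwarz_ineq2[of x "b w"] by simp
  also have "\<dots> \<le> 2 * (norm x)\<^sup>2 + (norm (b w))\<^sup>2 / 2"
    using zero_le_power2[of "2 * norm x - norm (b w)"] by (simp add: power2_eq_square algebra_simps)
  finally show ?thesis using norm_b_le[of w] by linarith
qed

lemma R_ge: "Q w / 2 - (norm x)\<^sup>2 \<le> R x w"
  using inner_b_le[of x w] unfolding R_def by linarith

lemma R_le: "R x w \<le> 2 * Q w + 3 * (norm x)\<^sup>2"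
  using inner_b_le[of x w] Q_nonneg[of w] unfolding R_def by linarith

text \<open>The common majorant of all dominated-convergence arguments for this family: it is
  uniform in x in a ball and in t in a compact interval. The rate 1/(8 T) is the surviving Q/2
  divided by 4 T.\<close>

lemma exp_R_le:
  assumes "0 < t0" "t0 \<le> t" "t \<le> T" "norm x \<le> B"
  shows "exp (- R x w / (4 * t)) \<le> exp (B\<^sup>2 / (4 * t0)) * exp (- (1 / (8 * T)) * Q w)"
proof -
  have B: "(norm x)\<^sup>2 \<le> B\<^sup>2" using assms by (intro power_mono) auto
  have "- R x w / (4 * t) \<le> ((norm x)\<^sup>2 - Q w / 2) / (4 * t)"
    using R_ge[of w x] assms by (intro divide_right_mono) auto
  also have "\<dots> = (norm x)\<^sup>2 / (4 * t) - Q w / (8 * t)"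
    using assms by (simp add: field_simps)
  also have "\<dots> \<le> B\<^sup>2 / (4 * t0) - Q w / (8 * T)"
    using assms B Q_nonneg[of w] by (intro diff_mono frac_le) auto
  finally show ?thesis by (simp add: exp_add[symmetric])
qed

text \<open>A factor 1 + Q is paid for with half of the exponential, since 1 + Q \<le> (1 + 2/e) exp
  (e Q / 2). Applied repeatedly, this admits any polynomial in Q and in the components of b.\<close>

lemma adm_bound:
  assumes g: "adm g" and h: "h \<in> borel_measurable M" and le: "\<And>w. \<bar>h w\<bar> \<le> C * (1 + Q w) * \<bar>g w\<bar>"
  shows "adm h"
  unfolding adm_def
proof (intro conjI allI impI h)
  fix e :: real assume e: "e > 0"
  have "integrable M (\<lambda>w. \<bar>C\<bar> * (1 + 2 / e) * (g w * exp (- (e / 2) * Q w)))"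
    by (intro integrable_mult_right adm_integrable g) (use e in simp)
  then show "integrable M (\<lambda>w. h w * exp (- e * Q w))"
  proof (rule Bochner_Integration.integrable_bound)
    show "(\<lambda>w. h w * exp (- e * Q w)) \<in> borel_measurable M" using h by measurable
    show "AE w in M. norm (h w * exp (- e * Q w)) \<le> norm (\<bar>C\<bar> * (1 + 2 / e) * (g w * exp (- (e / 2) * Q w)))"
    proof (rule AE_I2)
      fix w
      have "e / 2 * Q w \<le> exp (e / 2 * Q w)"
        using exp_ge_add_one_self[of "e / 2 * Q w"] by linarith
      then have "Q w \<le> 2 / e * exp (e / 2 * Q w)" using e by (simp add: field_simps)
      moreover have "1 \<le> exp (e / 2 * Q w)" using e Q_nonneg[of w] by simp
      ultimately have "1 + Q w \<le> exp (e / 2 * Q w) + 2 / e * exp (e / 2 * Q w)" by (rule add_mono[rotated])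
      then have q: "1 + Q w \<le> (1 + 2 / e) * exp (e / 2 * Q w)" by (simp only: distrib_right mult_1)
      have "\<bar>h w\<bar> \<le> \<bar>C\<bar> * (1 + Q w) * \<bar>g w\<bar>"
        using le[of w] mult_right_mono[OF abs_ge_self[of C], of "(1 + Q w) * \<bar>g w\<bar>"] Q_nonneg[of w]
        by (simp only: mult.assoc) (meson abs_ge_zero add_nonneg_nonneg mult_nonneg_nonneg order_trans zero_le_one)
      also have "\<dots> \<le> \<bar>C\<bar> * ((1 + 2 / e) * exp (e / 2 * Q w)) * \<bar>g w\<bar>"
        by (intro mult_left_mono mult_right_mono q) auto
      finally have "\<bar>h w\<bar> * exp (- e * Q w) \<le> \<bar>C\<bar> * ((1 + 2 / e) * exp (e / 2 * Q w)) * \<bar>g w\<bar> * exp (- e * Q w)"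
        by (intro mult_right_mono) auto
      also have "\<dots> = \<bar>C\<bar> * (1 + 2 / e) * \<bar>g w\<bar> * exp (e / 2 * Q w + - e * Q w)"
        by (simp only: exp_add) (simp add: mult_ac)
      also have "e / 2 * Q w + - e * Q w = - (e / 2) * Q w" by (simp add: field_simps)
      finally show "norm (h w * exp (- e * Q w)) \<le> norm (\<bar>C\<bar> * (1 + 2 / e) * (g w * exp (- (e / 2) * Q w)))"
        using e by (simp add: abs_mult mult_ac)
    qed
  qed
qed

lemma adm_mult:
  assumes "adm g" "p \<in> borel_measurable M" "\<And>w. \<bar>p w\<bar> \<le> C * (1 + Q w)"
  shows "adm (\<lambda>w. p w * g w)"
proof (rule adm_bound[OF assms(1), of _ C])
  show "(\<lambda>w. p w * g w) \<in> borel_measurable M"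
    using assms(2) adm_measurable[OF assms(1)] by measurable
  show "\<bar>p w * g w\<bar> \<le> C * (1 + Q w) * \<bar>g w\<bar>" for w
    using assms(3)[of w] by (simp add: abs_mult mult_right_mono)
qed

lemma adm_abs: "adm g \<Longrightarrow> adm (\<lambda>w. \<bar>g w\<bar>)"
  by (rule adm_bound[of g _ 1])
     (auto simp: algebra_simps intro!: mult_nonneg_nonneg Q_nonneg borel_measurable_abs dest: adm_measurable)

lemma adm_cmult: "adm g \<Longrightarrow> adm (\<lambda>w. c * g w)"
  by (rule adm_mult[where C="\<bar>c\<bar>"]) (use Q_nonneg in \<open>auto simp: algebra_simps\<close>)

lemma adm_Q: "adm g \<Longrightarrow> adm (\<lambda>w. Q w * g w)"
  by (rule adm_mult[where C=1]) (use Q_nonneg in auto)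

lemma adm_b: "adm g \<Longrightarrow> adm (\<lambda>w. b w $ k * g w)"
  by (rule adm_mult[where C=1]) (use abs_b_le in auto)

lemma adm_defect: "adm g \<Longrightarrow> adm (\<lambda>w. (Q w - (norm (b w))\<^sup>2) * g w)"
proof (rule adm_mult[where C=1])
  show "\<bar>Q w - (norm (b w))\<^sup>2\<bar> \<le> 1 * (1 + Q w)" for w
    using norm_b_le[of w] by (smt (verit) zero_le_power2)
qed (simp, measurable)

lemma adm_R: "adm g \<Longrightarrow> adm (\<lambda>w. R x w * g w)"
proof (rule adm_mult[where C="2 + 3 * (norm x)\<^sup>2"])
  fix w
  have "2 * Q w + 3 * (norm x)\<^sup>2 \<le> (2 + 3 * (norm x)\<^sup>2) * (1 + Q w)"
    using Q_nonneg[of w] by (simp add: algebra_simps)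
  then show "\<bar>R x w\<bar> \<le> (2 + 3 * (norm x)\<^sup>2) * (1 + Q w)"
    using R_le[of x w] R_nonneg[of x w] by linarith
qed auto

lemma adm_add: "adm f \<Longrightarrow> adm g \<Longrightarrow> adm (\<lambda>w. f w + g w)"
  unfolding adm_def by (auto simp: distrib_right)

lemma adm_zero: "adm (\<lambda>w. 0)"
  by (simp add: adm_def)

lemma integrable_adm:
  assumes "adm g" "0 < t"
  shows "integrable M (\<lambda>w. g w * exp (- R x w / (4 * t)))"
proof (rule Bochner_Integration.integrable_bound)
  show "integrable M (\<lambda>w. exp ((norm x)\<^sup>2 / (4 * t)) * (g w * exp (- (1 / (8 * t)) * Q w)))"
    by (intro integrable_mult_right adm_integrable assms) (use assms in simp)
  show "(\<lambda>w. g w * exp (- R x w / (4 * t))) \<in> borel_measurable M"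
    using adm_measurable[OF assms(1)] by measurable
  show "AE w in M. norm (g w * exp (- R x w / (4 * t)))
      \<le> norm (exp ((norm x)\<^sup>2 / (4 * t)) * (g w * exp (- (1 / (8 * t)) * Q w)))"
  proof (rule AE_I2)
    fix w
    show "norm (g w * exp (- R x w / (4 * t)))
      \<le> norm (exp ((norm x)\<^sup>2 / (4 * t)) * (g w * exp (- (1 / (8 * t)) * Q w)))"
      using mult_left_mono[OF exp_R_le[OF assms(2) order_refl order_refl order_refl, of x w], of "\<bar>g w\<bar>"]
      by (simp add: abs_mult mult_ac)
  qed
qed

lemma Phi_add: "adm f \<Longrightarrow> adm g \<Longrightarrow> 0 < t \<Longrightarrow> Phi (\<lambda>w. f w + g w) x t = Phi f x t + Phi g x t"
  unfolding Phi_def distrib_right by (intro Bochner_Integration.integral_add integrable_adm)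

lemma Phi_cmult: "Phi (\<lambda>w. c * g w) x t = c * Phi g x t"
  unfolding Phi_def mult.assoc by simp

lemma Phi_sum:
  assumes "finite I" "\<And>i. i \<in> I \<Longrightarrow> adm (g i)" "0 < t"
  shows "adm (\<lambda>w. \<Sum>i\<in>I. g i w)" "Phi (\<lambda>w. \<Sum>i\<in>I. g i w) x t = (\<Sum>i\<in>I. Phi (g i) x t)"
proof -
  have "adm (\<lambda>w. \<Sum>i\<in>I. g i w) \<and> Phi (\<lambda>w. \<Sum>i\<in>I. g i w) x t = (\<Sum>i\<in>I. Phi (g i) x t)"
    using assms(1,2)
  proof induction
    case empty
    then show ?case by (simp add: adm_zero Phi_def)
  next
    case (insert i I)
    then show ?case using assms(3) by (simp add: Phi_add adm_add)
  qed
  then show "adm (\<lambda>w. \<Sum>i\<in>I. g i w)" "Phi (\<lambda>w. \<Sum>i\<in>I. g i w) x t = (\<Sum>i\<in>I. Phi (g i) x t)"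
    by auto
qed

lemma continuous_on_Phi:
  assumes "adm g"
  shows "continuous_on (UNIV \<times> {0<..}) (\<lambda>(x, t). Phi g x t)"
proof (rule continuous_on_sequentiallyI)
  fix X :: "nat \<Rightarrow> (real^'n) \<times> real" and a
  assume X: "\<forall>n. X n \<in> UNIV \<times> {0<..}" and a: "a \<in> UNIV \<times> {0<..}" and lim: "X \<longlonglongrightarrow> a"
  obtain x t where [simp]: "a = (x, t)" by (cases a)
  define y s where "y = (\<lambda>n. fst (X n))" and "s = (\<lambda>n. snd (X n))"
  have y: "y \<longlonglongrightarrow> x" and s: "s \<longlonglongrightarrow> t" and t: "t > 0" and s0: "\<And>n. s n > 0"
    using tendsto_fst[OF lim] tendsto_snd[OF lim] X a by (auto simp: y_def s_def mem_Times_iff)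
  have iv: "(\<lambda>n. inverse (s n)) \<longlonglongrightarrow> inverse t" using s t by (intro tendsto_inverse) auto
  \<comment> \<open>Bounds along the sequence for x, for t and for 1/t; the last one keeps the times
    above 1/K, as \<open>exp_R_le\<close> requires.\<close>
  obtain B where B: "\<And>n. norm (y n) \<le> B" using convergent_imp_Bseq[of y] y by (auto simp: convergent_def Bseq_def)
  obtain T where T: "\<And>n. norm (s n) \<le> T" "0 < T" using convergent_imp_Bseq[of s] s by (auto simp: convergent_def Bseq_def)
  obtain K where K: "\<And>n. norm (inverse (s n)) \<le> K" "0 < K"
    using convergent_imp_Bseq[of "\<lambda>n. inverse (s n)"] iv by (auto simp: convergent_def Bseq_def)
  have sK: "inverse K \<le> s n" for n
    using K(1)[of n] K(2) s0[of n] by (simp add: field_simps)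
  have "(\<lambda>n. \<integral>w. g w * exp (- R (y n) w / (4 * s n)) \<partial>M) \<longlonglongrightarrow> (\<integral>w. g w * exp (- R x w / (4 * t)) \<partial>M)"
  proof (rule integral_dominated_convergence
      [where w="\<lambda>w. exp (B\<^sup>2 / (4 * inverse K)) * (\<bar>g w\<bar> * exp (- (1 / (8 * T)) * Q w))"])
    show "integrable M (\<lambda>w. exp (B\<^sup>2 / (4 * inverse K)) * (\<bar>g w\<bar> * exp (- (1 / (8 * T)) * Q w)))"
      using T by (intro integrable_mult_right adm_integrable adm_abs assms) auto
    show "AE w in M. (\<lambda>n. g w * exp (- R (y n) w / (4 * s n))) \<longlonglongrightarrow> g w * exp (- R x w / (4 * t))"
      unfolding R_def using y s t by (intro AE_I2 tendsto_intros) auto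
    show "AE w in M. norm (g w * exp (- R (y n) w / (4 * s n)))
        \<le> exp (B\<^sup>2 / (4 * inverse K)) * (\<bar>g w\<bar> * exp (- (1 / (8 * T)) * Q w))" for n
    proof (rule AE_I2)
      fix w
      have "exp (- R (y n) w / (4 * s n)) \<le> exp (B\<^sup>2 / (4 * inverse K)) * exp (- (1 / (8 * T)) * Q w)"
        using sK[of n] T(1)[of n] B[of n] K(2) by (intro exp_R_le) auto
      from mult_left_mono[OF this, of "\<bar>g w\<bar>"]
      show "norm (g w * exp (- R (y n) w / (4 * s n)))
        \<le> exp (B\<^sup>2 / (4 * inverse K)) * (\<bar>g w\<bar> * exp (- (1 / (8 * T)) * Q w))"
        by (simp add: abs_mult mult_ac)
    qed
    show "(\<lambda>w. g w * exp (- R x w / (4 * t))) \<in> borel_measurable M"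
      "(\<lambda>w. g w * exp (- R (y n) w / (4 * s n))) \<in> borel_measurable M" for n
      using adm_measurable[OF assms] by measurable
  qed
  then show "(\<lambda>n. case X n of (x, t) \<Rightarrow> Phi g x t) \<longlonglongrightarrow> (case a of (x, t) \<Rightarrow> Phi g x t)"
    by (simp add: Phi_def y_def s_def split_beta)
qed

lemma R_line: "R (x + h *\<^sub>R axis k 1) w = R x w + 2 * h * (x $ k - b w $ k) + h\<^sup>2"
  unfolding R_def power2_norm_eq_inner
  by (simp add: inner_add_left inner_add_right inner_axis inner_axis' power2_eq_square algebra_simps)

lemma Phi_has_partial:
  assumes "adm g" "0 < t"
  shows "has_partial k (\<lambda>y. Phi g y t) ((Phi (\<lambda>w. b w $ k * g w) x t - x $ k * Phi g x t) / (2 * t)) x"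
proof -
  define F where "F = (\<lambda>h w. g w * exp (- (R x w + 2 * h * (x $ k - b w $ k) + h\<^sup>2) / (4 * t)))"
  define F' where "F' = (\<lambda>h w. (b w $ k - x $ k - h) / (2 * t) * F h w)"
  \<comment> \<open>For |h| < 1 the shifted point has norm at most \<open>norm x + 1\<close>; the
    factor 1/(2 t) comes from differentiating the exponent.\<close>
  define C where "C = exp ((norm x + 1)\<^sup>2 / (4 * t)) / (2 * t)"
  have F: "F h w = g w * exp (- R (x + h *\<^sub>R axis k 1) w / (4 * t))" for h w
    unfolding F_def R_line ..
  have "((\<lambda>h. \<integral>w. F h w \<partial>M) has_real_derivative (\<integral>w. F' 0 w \<partial>M)) (at 0)"
  proof (rule has_real_derivative_integral_dominated
      [where d=1 and B="\<lambda>w. C * ((2 + \<bar>x $ k\<bar> + Q w) * \<bar>g w\<bar> * exp (- (1 / (8 * t)) * Q w))"])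
    show "integrable M (F h)" for h
      unfolding F using assms by (rule integrable_adm)
    show "((\<lambda>h. F h w) has_real_derivative F' h w) (at h)" for h w
      unfolding F'_def F_def using assms(2)
      by (auto intro!: derivative_eq_intros simp: field_simps)
    have "adm (\<lambda>w. (2 + \<bar>x $ k\<bar> + Q w) * \<bar>g w\<bar>)"
    proof (rule adm_mult[OF adm_abs[OF assms(1)], where C="2 + \<bar>x $ k\<bar>"])
      show "\<bar>2 + \<bar>x $ k\<bar> + Q w\<bar> \<le> (2 + \<bar>x $ k\<bar>) * (1 + Q w)" for w
        using Q_nonneg[of w] by (simp add: algebra_simps)
    qed simp
    then show "integrable M (\<lambda>w. C * ((2 + \<bar>x $ k\<bar> + Q w) * \<bar>g w\<bar> * exp (- (1 / (8 * t)) * Q w)))"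
      using assms(2) by (intro integrable_mult_right adm_integrable) auto
    show "\<bar>F' h w\<bar> \<le> C * ((2 + \<bar>x $ k\<bar> + Q w) * \<bar>g w\<bar> * exp (- (1 / (8 * t)) * Q w))"
      if "\<bar>h - 0\<bar> < 1" for h w
    proof -
      have n: "norm (x + h *\<^sub>R axis k 1) \<le> norm x + 1"
        using norm_triangle_ineq[of x "h *\<^sub>R axis k 1"] that by simp
      have "\<bar>F' h w\<bar> = \<bar>b w $ k - x $ k - h\<bar> / (2 * t) * \<bar>g w\<bar> * exp (- R (x + h *\<^sub>R axis k 1) w / (4 * t))"
        using assms(2) by (simp add: F'_def F abs_mult)
      also have "\<dots> \<le> (2 + \<bar>x $ k\<bar> + Q w) / (2 * t) * \<bar>g w\<bar> *
          (exp ((norm x + 1)\<^sup>2 / (4 * t)) * exp (- (1 / (8 * t)) * Q w))"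
        using abs_b_le[of w k] that Q_nonneg[of w] assms(2)
        by (intro mult_mono divide_right_mono exp_R_le n) auto
      finally show ?thesis by (simp add: C_def mult_ac)
    qed
    show "F' 0 \<in> borel_measurable M"
      unfolding F'_def F using adm_measurable[OF assms(1)] by measurable
  qed simp
  moreover have "(\<integral>w. F' 0 w \<partial>M) = (Phi (\<lambda>w. b w $ k * g w) x t - x $ k * Phi g x t) / (2 * t)"
  proof -
    have "F' 0 = (\<lambda>w. (1 / (2 * t)) * (b w $ k * g w * exp (- R x w / (4 * t)) - x $ k * (g w * exp (- R x w / (4 * t)))))"
      by (auto simp: F'_def F_def field_simps)
    then show ?thesis
      using integrable_adm[OF adm_b[OF assms(1)] assms(2), of k x] integrable_adm[OF assms, of x]
      by (simp add: Phi_def)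
  qed
  ultimately show ?thesis unfolding Phi_def F by simp
qed

lemma Phi_has_time_derivative:
  assumes "adm g" "0 < t"
  shows "((\<lambda>t. Phi g x t) has_real_derivative Phi (\<lambda>w. R x w * g w) x t / (4 * t\<^sup>2)) (at t)"
proof -
  define F where "F = (\<lambda>t w. g w * exp (- R x w / (4 * t)))"
  define F' where "F' = (\<lambda>t w. R x w * g w * exp (- R x w / (4 * t)) / (4 * t\<^sup>2))"
  \<comment> \<open>For |h - t| < t/2 the time h lies between t/2 and 2 t, and the majorant is taken
    for this interval.\<close>
  define C where "C = exp ((norm x)\<^sup>2 / (4 * (t / 2))) / (4 * (t / 2)\<^sup>2)"
  have "((\<lambda>h. \<integral>w. F h w \<partial>M) has_real_derivative (\<integral>w. F' t w \<partial>M)) (at t)"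
  proof (rule has_real_derivative_integral_dominated
      [where d="t / 2" and B="\<lambda>w. C * (\<bar>R x w * g w\<bar> * exp (- (1 / (8 * (2 * t))) * Q w))"])
    show "integrable M (F h)" if "\<bar>h - t\<bar> < t / 2" for h
      unfolding F_def using assms that by (intro integrable_adm) linarith+
    show "((\<lambda>h. F h w) has_real_derivative F' h w) (at h)" if "\<bar>h - t\<bar> < t / 2" for h w
      unfolding F'_def F_def using assms(2) that
      by (auto intro!: derivative_eq_intros simp: field_simps power2_eq_square)
    show "integrable M (\<lambda>w. C * (\<bar>R x w * g w\<bar> * exp (- (1 / (8 * (2 * t))) * Q w)))"
      by (intro integrable_mult_right adm_integrable adm_abs adm_R assms) (use assms in simp)
    show "\<bar>F' h w\<bar> \<le> C * (\<bar>R x w * g w\<bar> * exp (- (1 / (8 * (2 * t))) * Q w))"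
      if "\<bar>h - t\<bar> < t / 2" for h w
    proof -
      have "\<bar>F' h w\<bar> = \<bar>R x w * g w\<bar> * (exp (- R x w / (4 * h)) / (4 * h\<^sup>2))"
        by (simp add: F'_def abs_mult)
      also have "\<dots> \<le> \<bar>R x w * g w\<bar> *
          (exp ((norm x)\<^sup>2 / (4 * (t / 2))) * exp (- (1 / (8 * (2 * t))) * Q w) / (4 * (t / 2)\<^sup>2))"
        using that assms(2)
        by (intro mult_left_mono frac_le exp_R_le power_mono) (auto simp: abs_if split: if_splits)
      finally show ?thesis by (simp add: C_def mult_ac)
    qed
    show "F' t \<in> borel_measurable M"
      unfolding F'_def using adm_measurable[OF assms(1)] by measurable
  qed (use assms(2) in simp)
  then show ?thesis unfolding Phi_def F_def F'_def by simp
qed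

text \<open>A class of functions closed under all first-order partial derivatives, whose members are
  therefore smooth.\<close>

inductive_set V :: "(real^'n \<Rightarrow> real \<Rightarrow> real) set" where
  V_Phi: "adm g \<Longrightarrow> Phi g \<in> V"
| V_add: "F \<in> V \<Longrightarrow> G \<in> V \<Longrightarrow> (\<lambda>x t. F x t + G x t) \<in> V"
| V_cmult: "F \<in> V \<Longrightarrow> (\<lambda>x t. c * F x t) \<in> V"
| V_coord: "F \<in> V \<Longrightarrow> (\<lambda>x t. x $ k * F x t) \<in> V"
| V_powr: "F \<in> V \<Longrightarrow> (\<lambda>x t. t powr a * F x t) \<in> V"

lemma V_sum: "finite I \<Longrightarrow> (\<And>i. i \<in> I \<Longrightarrow> F i \<in> V) \<Longrightarrow> (\<lambda>x t. \<Sum>i\<in>I. F i x t) \<in> V"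
proof (induction rule: finite_induct)
  case empty
  show ?case using V_Phi[OF adm_zero] by (simp add: Phi_def[abs_def])
next
  case (insert i I)
  then show ?case using V_add[of "F i"] by simp
qed

lemma V_continuous: "F \<in> V \<Longrightarrow> continuous_on (UNIV \<times> {0<..}) (\<lambda>(x, t). F x t)"
proof (induction rule: V.induct)
  case (V_Phi g)
  then show ?case by (rule continuous_on_Phi)
qed (auto simp: split_beta intro!: continuous_intros)

lemma V_partial: "F \<in> V \<Longrightarrow> \<exists>G\<in>V. \<forall>x\<in>UNIV. \<forall>t\<in>{0<..}. has_partial k (\<lambda>y. F y t) (G x t) x"
proof (induction rule: V.induct)
  case (V_Phi g)
  define G where "G = (\<lambda>x t. t powr (-1) * (1 / 2 * (Phi (\<lambda>w. b w $ k * g w) x t + (-1) * (x $ k * Phi g x t))))"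
  have "G \<in> V" unfolding G_def by (intro V.intros adm_b V_Phi)
  moreover have "G x t = (Phi (\<lambda>w. b w $ k * g w) x t - x $ k * Phi g x t) / (2 * t)" if "t > 0" for x t
    using that by (simp add: G_def powr_minus divide_simps)
  ultimately show ?case using Phi_has_partial[OF V_Phi] by (intro bexI[of _ G]) auto
next
  case (V_add F1 F2)
  then obtain G1 G2 where G: "G1 \<in> V" "G2 \<in> V"
    "\<And>x t. t > 0 \<Longrightarrow> has_partial k (\<lambda>y. F1 y t) (G1 x t) x" "\<And>x t. t > 0 \<Longrightarrow> has_partial k (\<lambda>y. F2 y t) (G2 x t) x"
    by auto
  have "(\<lambda>x t. G1 x t + G2 x t) \<in> V" by (intro V.V_add G)
  with G(3,4) show ?case by (intro bexI[of _ "\<lambda>x t. G1 x t + G2 x t"]) (auto intro!: DERIV_add)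
next
  case (V_cmult F c)
  then obtain G where G: "G \<in> V" "\<And>x t. t > 0 \<Longrightarrow> has_partial k (\<lambda>y. F y t) (G x t) x" by auto
  have "(\<lambda>x t. c * G x t) \<in> V" by (intro V.V_cmult G)
  with G(2) show ?case by (intro bexI[of _ "\<lambda>x t. c * G x t"]) (auto intro!: DERIV_cmult)
next
  case (V_coord F j)
  then obtain G where G: "G \<in> V" "\<And>x t. t > 0 \<Longrightarrow> has_partial k (\<lambda>y. F y t) (G x t) x" by auto
  define G' where "G' = (\<lambda>x t. (if j = k then 1 else 0) * F x t + x $ j * G x t)"
  have "G' \<in> V" unfolding G'_def by (intro V.intros V_coord G)
  then show ?case using has_partial_mult[OF has_partial_coord G(2)]
    by (intro bexI[of _ G']) (auto simp: G'_def simp del: vector_add_component)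
next
  case (V_powr F a)
  then obtain G where G: "G \<in> V" "\<And>x t. t > 0 \<Longrightarrow> has_partial k (\<lambda>y. F y t) (G x t) x" by auto
  have "(\<lambda>x t. t powr a * G x t) \<in> V" by (intro V.V_powr G)
  with G(2) show ?case by (intro bexI[of _ "\<lambda>x t. t powr a * G x t"]) (auto intro!: DERIV_cmult)
qed

lemma V_time: "F \<in> V \<Longrightarrow> \<exists>G\<in>V. \<forall>x\<in>UNIV. \<forall>t\<in>{0<..}. (F x has_real_derivative G x t) (at t)"
proof (induction rule: V.induct)
  case (V_Phi g)
  \<comment> \<open>The weight inside a \<open>Phi\<close> may not depend on x. Therefore R is
    expanded into Q, the squares of the x_k and the products x_k b_k, and the coordinates of x are
    pulled out as factors, which the class permits.\<close>
  define G where "G = (\<lambda>x t. t powr (-2) * (1 / 4 * (Phi (\<lambda>w. Q w * g w) x t +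
      (\<Sum>k\<in>UNIV. x $ k * (x $ k * Phi g x t) + (-2) * (x $ k * Phi (\<lambda>w. b w $ k * g w) x t)))))"
  have "G \<in> V" unfolding G_def by (intro V.intros V_sum adm_b adm_Q V_Phi) auto
  moreover have "G x t = Phi (\<lambda>w. R x w * g w) x t / (4 * t\<^sup>2)" if "t > 0" for x t
  proof -
    have "(\<lambda>w. R x w * g w) = (\<lambda>w. Q w * g w + (\<Sum>k\<in>UNIV. x $ k * (x $ k * g w) + (-2 * x $ k) * (b w $ k * g w)))"
      by (simp add: R_def fun_eq_iff power2_norm_eq_inner inner_vec_def ring_distribs sum.distrib
          sum_distrib_left sum_distrib_right sum_negf sum_subtractf mult_ac)
    then have "Phi (\<lambda>w. R x w * g w) x t = Phi (\<lambda>w. Q w * g w) x t +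
      (\<Sum>k\<in>UNIV. x $ k * (x $ k * Phi g x t) + (-2 * x $ k) * Phi (\<lambda>w. b w $ k * g w) x t)"
      using that V_Phi by (simp only: Phi_add Phi_sum Phi_cmult adm_Q adm_b adm_cmult adm_add finite)
    then show ?thesis using that
      by (simp add: G_def powr_minus powr_numeral divide_simps mult.assoc)
  qed
  ultimately show ?case using Phi_has_time_derivative[OF V_Phi] by (intro bexI[of _ G]) auto
next
  case (V_add F1 F2)
  then obtain G1 G2 where G: "G1 \<in> V" "G2 \<in> V"
    "\<And>x t. t > 0 \<Longrightarrow> (F1 x has_real_derivative G1 x t) (at t)" "\<And>x t. t > 0 \<Longrightarrow> (F2 x has_real_derivative G2 x t) (at t)"
    by auto
  have "(\<lambda>x t. G1 x t + G2 x t) \<in> V" by (intro V.V_add G)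
  with G(3,4) show ?case by (intro bexI[of _ "\<lambda>x t. G1 x t + G2 x t"]) (auto intro!: DERIV_add)
next
  case (V_cmult F c)
  then obtain G where G: "G \<in> V" "\<And>x t. t > 0 \<Longrightarrow> (F x has_real_derivative G x t) (at t)" by auto
  have "(\<lambda>x t. c * G x t) \<in> V" by (intro V.V_cmult G)
  with G(2) show ?case by (intro bexI[of _ "\<lambda>x t. c * G x t"]) (auto intro!: DERIV_cmult)
next
  case (V_coord F j)
  then obtain G where G: "G \<in> V" "\<And>x t. t > 0 \<Longrightarrow> (F x has_real_derivative G x t) (at t)" by auto
  have "(\<lambda>x t. x $ j * G x t) \<in> V" by (intro V.V_coord G)
  with G(2) show ?case by (intro bexI[of _ "\<lambda>x t. x $ j * G x t"]) (auto intro!: DERIV_cmult)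
next
  case (V_powr F a)
  then obtain G where G: "G \<in> V" "\<And>x t. t > 0 \<Longrightarrow> (F x has_real_derivative G x t) (at t)" by auto
  define G' where "G' = (\<lambda>x t. a * (t powr (a - 1) * F x t) + t powr a * G x t)"
  have "G' \<in> V" unfolding G'_def by (intro V.intros V_powr G)
  then show ?case using G(2)
    by (intro bexI[of _ G']) (auto simp: G'_def intro!: derivative_eq_intros)
qed

lemma V_parabolic: "F \<in> V \<Longrightarrow> parabolic_Ck_on N UNIV {0<..} F"
  by (rule parabolic_Ck_on_closed_class[where V=V, OF open_UNIV open_greaterThan V_continuous V_partial V_time])

text \<open>The exponent N is forced: each direction contributes -(\<gamma>_k + 1)/t times
  \<open>Phi g\<close> to the Laplacian, and only t powr (- N) has a time derivative cancelling
  their sum. The quadratic terms on both sides combine to |x - b|^2 and cancel as well. What remains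
  is the defect Q - |b|^2 and a first-order term in b, which vanish together only after integration
  over the angles.\<close>

lemma bessel_heat_op_Phi:
  fixes \<gamma> :: "real^'n"
  assumes g: "adm g" and t: "0 < t" and x: "\<And>k. x $ k \<noteq> 0"
  defines "N \<equiv> real CARD('n) + (\<Sum>k\<in>UNIV. \<gamma> $ k)"
  shows "bessel_heat_op \<gamma> (\<lambda>x t. t powr (- N) * Phi g x t) x t =
    t powr (- N) * (Phi (\<lambda>w. (Q w - (norm (b w))\<^sup>2) * g w) x t / (4 * t\<^sup>2)
      - (\<Sum>k\<in>UNIV. (2 * \<gamma> $ k + 1) / (2 * t * x $ k) * Phi (\<lambda>w. b w $ k * g w) x t))"
proof -
  define c where "c = t powr (- N)"
  define P Pk Pkk where "P = Phi g x t" and "Pk = (\<lambda>k. Phi (\<lambda>w. b w $ k * g w) x t)"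
    and "Pkk = (\<lambda>k. Phi (\<lambda>w. b w $ k * (b w $ k * g w)) x t)"
  have Pk: "Phi (\<lambda>w. b w $ k * g w) x t = Pk k" for k by (simp add: Pk_def)
  have p1: "partial k (\<lambda>y. c * Phi g y t) y = c * ((Phi (\<lambda>w. b w $ k * g w) y t - y $ k * Phi g y t) / (2 * t))"
    for y k
    by (intro partialI DERIV_cmult Phi_has_partial g t)
  have p1': "partial k (\<lambda>y. c * Phi g y t)
      = (\<lambda>y. c * ((Phi (\<lambda>w. b w $ k * g w) y t - y $ k * Phi g y t) / (2 * t)))" for k
    using p1 by auto
  have p2: "partial k (partial k (\<lambda>y. c * Phi g y t)) x =
      c * (((Pkk k - x $ k * Pk k) / (2 * t) - (1 * P + x $ k * ((Pk k - x $ k * P) / (2 * t)))) / (2 * t))" for k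
    unfolding p1' Pkk_def Pk_def P_def
    by (intro partialI DERIV_cmult DERIV_cdivide DERIV_diff Phi_has_partial g t adm_b has_partial_mult)
       (use has_partial_coord[of x k k] in simp)
  have tt: "time_deriv (\<lambda>x t. t powr (- N) * Phi g x t) x t =
      - N * t powr (- N - 1) * P + c * (Phi (\<lambda>w. R x w * g w) x t / (4 * t\<^sup>2))"
    unfolding time_deriv_def P_def c_def
    by (rule DERIV_imp_deriv) (use t in \<open>auto intro!: derivative_eq_intros Phi_has_time_derivative g\<close>)
  have q: "Phi (\<lambda>w. R x w * g w) x t = Phi (\<lambda>w. (Q w - (norm (b w))\<^sup>2) * g w) x t +
      (\<Sum>k\<in>UNIV. Pkk k + (- 2 * x $ k) * Pk k + (x $ k)\<^sup>2 * P)"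
  proof -
    have "(\<lambda>w. R x w * g w) = (\<lambda>w. (Q w - (norm (b w))\<^sup>2) * g w +
        (\<Sum>k\<in>UNIV. b w $ k * (b w $ k * g w) + (- 2 * x $ k) * (b w $ k * g w) + (x $ k)\<^sup>2 * g w))"
      unfolding R_def power2_norm_eq_inner inner_vec_def
      by (simp add: fun_eq_iff ring_distribs sum.distrib
          sum_distrib_left sum_distrib_right sum_negf sum_subtractf mult_ac power2_eq_square)
    moreover have "adm (\<lambda>w. (Q w - (norm (b w))\<^sup>2) * g w)"
      by (rule adm_defect[OF g])
    ultimately show ?thesis unfolding Pkk_def Pk_def P_def
      using t g by (simp only: Phi_add Phi_sum Phi_cmult adm_b adm_cmult adm_add finite)
  qed
  have bo: "bessel_op \<gamma> k (\<lambda>y. c * Phi g y t) x = c * ((Pkk k + (- 2 * x $ k) * Pk k + (x $ k)\<^sup>2 * P) / (4 * t\<^sup>2)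
      + (2 * \<gamma> $ k + 1) / (2 * t * x $ k) * Pk k - (\<gamma> $ k + 1) / t * P)" for k
    unfolding bessel_op_def p2 unfolding p1 Pk P_def[symmetric] using t x[of k]
    by (simp add: power2_eq_square divide_simps) (simp add: algebra_simps)
  have N: "(\<Sum>k\<in>UNIV. (\<gamma> $ k + 1) / t * P) = N / t * P"
    by (simp add: N_def sum_divide_distrib[symmetric] sum_distrib_right[symmetric] sum.distrib add.commute)
  define S1 S2 where "S1 = (\<Sum>k\<in>UNIV. Pkk k + (- 2 * x $ k) * Pk k + (x $ k)\<^sup>2 * P)"
    and "S2 = (\<Sum>k\<in>UNIV. (2 * \<gamma> $ k + 1) / (2 * t * x $ k) * Pk k)"
  have "bessel_laplacian \<gamma> (\<lambda>y. c * Phi g y t) x = c * (S1 / (4 * t\<^sup>2) + S2 - N / t * P)"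
    unfolding bessel_laplacian_def bo N[symmetric] S1_def S2_def
    by (simp only: sum_distrib_left[symmetric] sum.distrib sum_subtractf sum_divide_distrib[symmetric])
  moreover have "t powr (- N - 1) = c / t" using t by (simp add: c_def powr_diff)
  ultimately show ?thesis
    unfolding bessel_heat_op_def tt q Pk S1_def[symmetric] S2_def[symmetric] c_def[symmetric] using t
    by (simp add: add_divide_distrib algebra_simps)
qed

end

section \<open>Poisson's integral for the modified Bessel function\<close>

text \<open>Bridge from the Beta and Gamma integrals, which are given as gauge integrals, to
  nonnegative Lebesgue integrals. Nonnegativity upgrades the gauge integral to an absolutely
  convergent one, to which the change of variables applies.\<close>

lemma nn_integral_substitution_has_integral:
  fixes f g g' :: "real \<Rightarrow> real"
  assumes S: "S \<in> sets lebesgue"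
    and der: "\<And>x. x \<in> S \<Longrightarrow> (g has_field_derivative g' x) (at x within S)"
    and inj: "inj_on g S"
    and nn: "\<And>y. y \<in> g ` S \<Longrightarrow> 0 \<le> f y"
    and I: "(f has_integral I) (g ` S)"
  shows "(\<integral>\<^sup>+x. ennreal (indicator S x * (\<bar>g' x\<bar> * f (g x))) \<partial>lborel) = ennreal I"
proof -
  have "f absolutely_integrable_on g ` S \<and> integral (g ` S) f = I"
    using I nn by (auto intro: nonnegative_absolutely_integrable_1 has_integral_integrable integral_unique)
  then have "(\<lambda>x. \<bar>g' x\<bar> * f (g x)) absolutely_integrable_on S \<and> integral S (\<lambda>x. \<bar>g' x\<bar> * f (g x)) = I"
    using has_absolute_integral_change_of_variables_1'[OF S der inj, of f I] by simp
  then have "((\<lambda>x. \<bar>g' x\<bar> * f (g x)) has_integral I) S"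
    using set_lebesgue_integral_eq_integral(1) by (auto simp: has_integral_iff)
  then show ?thesis
    by (intro nn_integral_has_integral_lebesgue) (use nn in auto)
qed

text \<open>Substitution r = sin^2 x in the Beta integral, so that 1 - r = cos^2 x and dr = 2 sin x
  cos x dx.\<close>

lemma nn_integral_sin_cos_powr:
  assumes "\<gamma> > - 1 / 2"
  shows "(\<integral>\<^sup>+x. ennreal (indicator {0<..<pi/2} x * (2 * sin x ^ (2 * k) * cos x powr (2 * \<gamma>))) \<partial>lborel)
    = ennreal (Beta (real k + 1 / 2) (\<gamma> + 1 / 2))"
proof -
  define f where "f = (\<lambda>r::real. r powr (real k + 1 / 2 - 1) * (1 - r) powr (\<gamma> + 1 / 2 - 1))"
  have sc: "0 < sin x" "0 < cos x" if "x \<in> {0<..<pi/2}" for x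
    using that by (auto intro: sin_gt_zero cos_gt_zero)
  have im: "(\<lambda>x. (sin x)\<^sup>2) ` {0<..<pi/2} = {0<..<1}"
  proof (intro equalityI subsetI)
    fix y :: real assume "y \<in> (\<lambda>x. (sin x)\<^sup>2) ` {0<..<pi/2}"
    then obtain x where x: "x \<in> {0<..<pi/2}" "y = (sin x)\<^sup>2" by blast
    have *: "0 < (sin x)\<^sup>2" "0 < (cos x)\<^sup>2" using sc[OF x(1)] by simp_all
    then have "(sin x)\<^sup>2 < 1" using sin_cos_squared_add[of x] by linarith
    with * show "y \<in> {0<..<1}" using x(2) by simp
  next
    fix y :: real assume y: "y \<in> {0<..<1}"
    then have *: "0 < sqrt y" "sqrt y < 1" by (auto simp: real_sqrt_lt_1_iff)
    have "arcsin (sqrt y) \<in> {0<..<pi/2}"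
      using arcsin_less_arcsin[of 0 "sqrt y"] arcsin_less_arcsin[of "sqrt y" 1] * by auto
    moreover have "sin (arcsin (sqrt y)) = sqrt y" using * by (intro sin_arcsin) linarith+
    then have "y = (sin (arcsin (sqrt y)))\<^sup>2" using y by simp
    ultimately show "y \<in> (\<lambda>x. (sin x)\<^sup>2) ` {0<..<pi/2}" by blast
  qed
  have "(\<integral>\<^sup>+x. ennreal (indicator {0<..<pi/2} x * (\<bar>2 * sin x * cos x\<bar> * f ((sin x)\<^sup>2))) \<partial>lborel)
      = ennreal (Beta (real k + 1 / 2) (\<gamma> + 1 / 2))"
  proof (rule nn_integral_substitution_has_integral
      [where f=f and g="\<lambda>x. (sin x)\<^sup>2" and g'="\<lambda>x. 2 * sin x * cos x"])
    show "((\<lambda>x. (sin x)\<^sup>2) has_field_derivative 2 * sin x * cos x) (at x within {0<..<pi/2})" for x :: real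
      by (auto intro!: derivative_eq_intros)
    show "inj_on (\<lambda>x::real. (sin x)\<^sup>2) {0<..<pi/2}"
    proof (rule inj_onI)
      fix x y :: real assume xy: "x \<in> {0<..<pi/2}" "y \<in> {0<..<pi/2}" "(sin x)\<^sup>2 = (sin y)\<^sup>2"
      then have "sin x = sin y" using sc[of x] sc[of y] by (simp add: power2_eq_iff)
      then have "arcsin (sin x) = arcsin (sin y)" by simp
      then show "x = y" using xy by (simp add: arcsin_sin)
    qed
    show "(f has_integral Beta (real k + 1 / 2) (\<gamma> + 1 / 2)) ((\<lambda>x. (sin x)\<^sup>2) ` {0<..<pi/2})"
      unfolding im f_def using has_integral_Beta_real[of "real k + 1 / 2" "\<gamma> + 1 / 2"] assms
      by (simp add: has_integral_Icc_iff_Ioo)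
  qed (auto simp: f_def)
  moreover have "indicator {0<..<pi/2} x * (\<bar>2 * sin x * cos x\<bar> * f ((sin x)\<^sup>2)) =
      indicator {0<..<pi/2} x * (2 * sin x ^ (2 * k) * cos x powr (2 * \<gamma>))" for x
  proof (cases "x \<in> {0<..<pi/2}")
    case True
    note sc = sc[OF True]
    have c: "1 - (sin x)\<^sup>2 = (cos x)\<^sup>2" by (simp add: cos_squared_eq)
    have "(sin x)\<^sup>2 = sin x powr 2" "(cos x)\<^sup>2 = cos x powr 2" using sc by (auto simp: powr_numeral)
    then have "f ((sin x)\<^sup>2) = sin x powr (2 * (real k + 1 / 2 - 1)) * cos x powr (2 * (\<gamma> + 1 / 2 - 1))"
      unfolding f_def c by (simp only: powr_powr)
    also have "\<dots> = sin x powr (real (2 * k)) / sin x * (cos x powr (2 * \<gamma>) / cos x)"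
      using sc powr_diff[of "sin x" "real (2 * k)" 1] powr_diff[of "cos x" "2 * \<gamma>" 1]
      by (simp add: algebra_simps)
    also have "sin x powr (real (2 * k)) = sin x ^ (2 * k)" using sc by (intro powr_realpow)
    finally show ?thesis using sc by simp
  qed simp
  ultimately show ?thesis by simp
qed

section \<open>The power series of the modified Bessel function and Poisson's density\<close>

lemma Gamma_plus1_pos: "0 < x \<Longrightarrow> Gamma (x + 1) = x * Gamma (x::real)"
  using Gamma_plus1[of x] nonpos_Ints_nonpos[of x] by fastforce

text \<open>The half-integer values exchange the (2k)! of the hyperbolic cosine series for the 4^k
  k! of the Bessel series.\<close>

lemma Gamma_nat_plus_half: "Gamma (real k + 1 / 2) = sqrt pi * fact (2 * k) / (4 ^ k * fact k)"
proof (induction k)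
  case (Suc k)
  have G: "Gamma (real (Suc k) + 1 / 2) = (real k + 1 / 2) * Gamma (real k + 1 / 2)"
    using Gamma_plus1_pos[of "real k + 1 / 2"] by (simp add: add_ac)
  show ?case unfolding G Suc.IH by (simp add: divide_simps) (simp add: algebra_simps)
qed (simp add: Gamma_one_half_real)

text \<open>This is I_\<gamma>(z) divided by (z/2)^\<gamma>. Without the real power it is an even
  entire function, meaningful for z of either sign and at z = 0.\<close>

definition bessel_series :: "real \<Rightarrow> real \<Rightarrow> real" where
  "bessel_series \<gamma> z = (\<Sum>k. (z / 2) ^ (2 * k) / (fact k * Gamma (\<gamma> + real k + 1)))"

lemma summable_bessel_series:
  assumes "\<gamma> > - 1"
  shows "summable (\<lambda>k. (z / 2) ^ (2 * k) / (fact k * Gamma (\<gamma> + real k + 1)))"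
proof -
  \<comment> \<open>The ratio of consecutive terms is (z/2)^2 / ((n + 1)(\<gamma> + n + 1)). The
    last factor is at least 1 once n \<ge> 1, and this choice makes the rest at most 1/2.\<close>
  obtain n0 :: nat where n0: "real n0 \<ge> 2 * (z / 2)\<^sup>2 + 1" using real_arch_simple by blast
  show ?thesis
  proof (rule summable_ratio_test[where c="1/2" and N="n0 + 1"])
    fix n assume n: "n0 + 1 \<le> n"
    have pos: "\<gamma> + real n + 1 > 0" "real n > 0" "\<gamma> + real n + 1 \<ge> 1" using n assms by linarith+
    have G: "Gamma (\<gamma> + real (Suc n) + 1) = (\<gamma> + real n + 1) * Gamma (\<gamma> + real n + 1)"
      using Gamma_plus1_pos[OF pos(1)] by (simp add: add_ac)
    have "(z / 2)\<^sup>2 \<le> 1 / 2 * real (Suc n)" using n0 n by simp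
    also have "\<dots> \<le> 1 / 2 * (real (Suc n) * (\<gamma> + real n + 1))"
    proof -
      have "1 / 2 * real (Suc n) * 1 \<le> 1 / 2 * real (Suc n) * (\<gamma> + real n + 1)"
        by (intro mult_left_mono pos) auto
      then show ?thesis by (simp only: mult_1_right mult.assoc)
    qed
    finally have q: "(z / 2)\<^sup>2 / (real (Suc n) * (\<gamma> + real n + 1)) \<le> 1 / 2"
      using pos by (subst pos_divide_le_eq) auto
    have "(z / 2) ^ (2 * Suc n) / (fact (Suc n) * Gamma (\<gamma> + real (Suc n) + 1)) =
        (z / 2)\<^sup>2 / (real (Suc n) * (\<gamma> + real n + 1)) * ((z / 2) ^ (2 * n) / (fact n * Gamma (\<gamma> + real n + 1)))"
      unfolding G by (simp add: power2_eq_square field_simps)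
    then show "norm ((z / 2) ^ (2 * Suc n) / (fact (Suc n) * Gamma (\<gamma> + real (Suc n) + 1)))
        \<le> 1 / 2 * norm ((z / 2) ^ (2 * n) / (fact n * Gamma (\<gamma> + real n + 1)))"
      using mult_right_mono[OF q, of "norm ((z / 2) ^ (2 * n) / (fact n * Gamma (\<gamma> + real n + 1)))"] pos
      by (simp only: norm_mult) (simp add: abs_mult)
  qed simp
qed

lemma bessel_series_term_nonneg: "\<gamma> > - 1 \<Longrightarrow> 0 \<le> (z / 2) ^ (2 * k) / (fact k * Gamma (\<gamma> + real k + 1))"
  by (intro divide_nonneg_nonneg mult_nonneg_nonneg zero_le_even_power less_imp_le Gamma_real_pos) auto

lemma bessel_series_even: "bessel_series \<gamma> (- z) = bessel_series \<gamma> z"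
  by (simp add: bessel_series_def power_mult)

text \<open>Normalised so that the average of exp (z sin \<theta>) is exactly
  \<open>bessel_series\<close>; the total mass is thus 1 / Gamma(\<gamma> + 1) rather than
  1.\<close>

definition poisson_density :: "real \<Rightarrow> real \<Rightarrow> real" where
  "poisson_density \<gamma> \<theta> =
     indicator {-pi/2<..<pi/2} \<theta> * cos \<theta> powr (2 * \<gamma>) / (sqrt pi * Gamma (\<gamma> + 1 / 2))"

definition poisson_measure :: "real \<Rightarrow> real measure" where
  "poisson_measure \<gamma> = density lborel (\<lambda>\<theta>. ennreal (poisson_density \<gamma> \<theta>))"

lemma poisson_density_measurable [measurable]: "poisson_density \<gamma> \<in> borel_measurable borel"
  unfolding poisson_density_def by measurable

lemma sets_poisson_measure [measurable_cong, simp]: "sets (poisson_measure \<gamma>) = sets borel"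
  by (simp add: poisson_measure_def)

lemma space_poisson_measure [simp]: "space (poisson_measure \<gamma>) = UNIV"
  by (simp add: poisson_measure_def)

lemma poisson_density_nonneg: "\<gamma> > - 1 / 2 \<Longrightarrow> 0 \<le> poisson_density \<gamma> \<theta>"
  unfolding poisson_density_def
  by (intro divide_nonneg_nonneg mult_nonneg_nonneg less_imp_le[OF Gamma_real_pos]) auto

lemma cosh_even_sums: "(\<lambda>k. y ^ (2 * k) / fact (2 * k)) sums cosh (y::real)"
proof -
  have "(\<lambda>k. if even (2 * k) then y ^ (2 * k) /\<^sub>R fact (2 * k) else 0) sums cosh y"
    using cosh_converges[of y]
    by (subst sums_mono_reindex[of "\<lambda>k. 2 * k" "\<lambda>n. if even n then y ^ n /\<^sub>R fact n else 0"])
       (auto simp: strict_mono_def image_iff elim!: evenE)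
  then show ?thesis by (simp add: divide_inverse mult.commute)
qed

text \<open>Folding \<theta> and -\<theta> together replaces the exponential by cosh (z sin
  \<theta>), whose series has only nonnegative terms. Sum and integral may then be exchanged by
  monotone convergence, and each term is a Beta integral.\<close>

lemma nn_integral_poisson_exp:
  assumes "\<gamma> > - 1 / 2"
  shows "(\<integral>\<^sup>+\<theta>. ennreal (exp (z * sin \<theta>)) \<partial>poisson_measure \<gamma>) = ennreal (bessel_series \<gamma> z)"
proof -
  define c where "c = sqrt pi * Gamma (\<gamma> + 1 / 2)"
  have c: "c > 0" using assms by (auto simp: c_def intro!: mult_pos_pos Gamma_real_pos)
  have pd: "poisson_density \<gamma> x = indicator {-pi/2<..<pi/2} x * cos x powr (2 * \<gamma>) / c" for x
    by (simp add: poisson_density_def c_def)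
  define F where "F = (\<lambda>x. poisson_density \<gamma> x * exp (z * sin x))"
  define I where "I = (indicator {0<..<pi/2} :: real \<Rightarrow> real)"
  have [measurable]: "F \<in> borel_measurable borel" "I \<in> borel_measurable borel"
    unfolding F_def I_def by measurable
  have F0: "0 \<le> F x" for x unfolding F_def using poisson_density_nonneg[OF assms] by simp
  have "(\<integral>\<^sup>+\<theta>. ennreal (exp (z * sin \<theta>)) \<partial>poisson_measure \<gamma>) = (\<integral>\<^sup>+x. ennreal (F x) \<partial>lborel)"
    unfolding poisson_measure_def F_def using poisson_density_nonneg[OF assms]
    by (subst nn_integral_density) (auto simp: ennreal_mult')
  also have "\<dots> = (\<integral>\<^sup>+x. ennreal (I x * F x) + ennreal (I (- x) * F x) \<partial>lborel)"
  \<comment> \<open>The two open half-intervals miss the point 0, so the splitting holds only almost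
    everywhere.\<close>
  proof (rule nn_integral_cong_AE)
    have "AE x in lborel. x \<noteq> (0::real)" by (rule AE_lborel_singleton)
    then show "AE x in lborel. ennreal (F x) = ennreal (I x * F x) + ennreal (I (- x) * F x)"
      by eventually_elim (auto simp: F_def I_def poisson_density_def indicator_def)
  qed
  also have "\<dots> = (\<integral>\<^sup>+x. ennreal (I x * F x) \<partial>lborel) + (\<integral>\<^sup>+x. ennreal (I (- x) * F x) \<partial>lborel)"
    by (rule nn_integral_add) measurable
  also have "(\<integral>\<^sup>+x. ennreal (I (- x) * F x) \<partial>lborel) = (\<integral>\<^sup>+x. ennreal (I x * F (- x)) \<partial>lborel)"
    by (subst nn_integral_real_affine[where c="-1" and t=0]) auto
  also have "(\<integral>\<^sup>+x. ennreal (I x * F x) \<partial>lborel) + (\<integral>\<^sup>+x. ennreal (I x * F (- x)) \<partial>lborel) =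
      (\<integral>\<^sup>+x. ennreal (I x * F x) + ennreal (I x * F (- x)) \<partial>lborel)"
    by (rule nn_integral_add[symmetric]) measurable
  also have "\<dots> = (\<integral>\<^sup>+x. (\<Sum>k. ennreal (z ^ (2 * k) / (fact (2 * k) * c)) *
      ennreal (I x * (2 * sin x ^ (2 * k) * cos x powr (2 * \<gamma>)))) \<partial>lborel)"
  proof (rule nn_integral_cong)
    fix x :: real
    have "(\<lambda>k. (I x * 2 * cos x powr (2 * \<gamma>) / c) * ((z * sin x) ^ (2 * k) / fact (2 * k)))
        sums ((I x * 2 * cos x powr (2 * \<gamma>) / c) * cosh (z * sin x))"
      by (intro sums_mult cosh_even_sums)
    moreover have "(I x * 2 * cos x powr (2 * \<gamma>) / c) * cosh (z * sin x) = I x * F x + I x * F (- x)"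
      unfolding F_def pd using c by (auto simp: I_def indicator_def cosh_field_def field_simps)
    moreover have "(I x * 2 * cos x powr (2 * \<gamma>) / c) * ((z * sin x) ^ (2 * k) / fact (2 * k)) =
        z ^ (2 * k) / (fact (2 * k) * c) * (I x * (2 * sin x ^ (2 * k) * cos x powr (2 * \<gamma>)))" for k
      by (simp add: power_mult_distrib mult_ac)
    ultimately have s: "(\<lambda>k. z ^ (2 * k) / (fact (2 * k) * c) * (I x * (2 * sin x ^ (2 * k) * cos x powr (2 * \<gamma>))))
        sums (I x * F x + I x * F (- x))" by simp
    have nn: "0 \<le> z ^ (2 * k) / (fact (2 * k) * c) * (I x * (2 * sin x ^ (2 * k) * cos x powr (2 * \<gamma>)))" for k
      using c by (intro mult_nonneg_nonneg divide_nonneg_nonneg) (auto simp: I_def)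
    have "(\<Sum>k. ennreal (z ^ (2 * k) / (fact (2 * k) * c)) *
      ennreal (I x * (2 * sin x ^ (2 * k) * cos x powr (2 * \<gamma>)))) = ennreal (I x * F x + I x * F (- x))"
      using suminf_ennreal2[OF nn sums_summable[OF s]] sums_unique[OF s] c
      by (subst ennreal_mult''[symmetric]) (auto simp: I_def)
    then show "ennreal (I x * F x) + ennreal (I x * F (- x)) = (\<Sum>k. ennreal (z ^ (2 * k) / (fact (2 * k) * c)) *
      ennreal (I x * (2 * sin x ^ (2 * k) * cos x powr (2 * \<gamma>))))"
      using F0 by (simp add: I_def ennreal_plus)
  qed
  also have "\<dots> = (\<Sum>k. ennreal (z ^ (2 * k) / (fact (2 * k) * c)) *
      (\<integral>\<^sup>+x. ennreal (I x * (2 * sin x ^ (2 * k) * cos x powr (2 * \<gamma>))) \<partial>lborel))"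
    by (subst nn_integral_suminf) (auto simp: nn_integral_cmult)
  also have "\<dots> = (\<Sum>k. ennreal ((z / 2) ^ (2 * k) / (fact k * Gamma (\<gamma> + real k + 1))))"
  proof (rule suminf_cong)
    fix k
    have "Beta (real k + 1 / 2) (\<gamma> + 1 / 2) \<ge> 0"
      unfolding Beta_def using assms by (intro divide_nonneg_nonneg mult_nonneg_nonneg less_imp_le Gamma_real_pos) auto
    moreover have "z ^ (2 * k) / (fact (2 * k) * c) * Beta (real k + 1 / 2) (\<gamma> + 1 / 2) =
        (z / 2) ^ (2 * k) / (fact k * Gamma (\<gamma> + real k + 1))"
    proof -
      have "Gamma (\<gamma> + 1 / 2) > 0" "Gamma (\<gamma> + real k + 1) > 0" using assms by (auto intro!: Gamma_real_pos)
      moreover have "real k + 1 / 2 + (\<gamma> + 1 / 2) = \<gamma> + real k + 1" by simp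
      \<comment> \<open>The cancellation in plain variables: Z = z^(2k), f = (2k)!, p = sqrt pi, A =
        Gamma(\<gamma> + 1/2), q = 4^k, g = k! and B = Gamma(\<gamma> + k + 1).\<close>
      moreover have "Z / (f * (p * A)) * (p * f / (q * g) * A / B) = Z / q / (g * B)"
        if "f > 0" "p > 0" "A > 0" for Z f p A q g B :: real
        using that by simp
      moreover have "(z / 2) ^ (2 * k) = z ^ (2 * k) / 4 ^ k"
        by (simp add: power_divide power_mult)
      moreover have "sqrt pi > 0" "(fact (2 * k) :: real) > 0" by simp_all
      ultimately show ?thesis
        unfolding Beta_def c_def Gamma_nat_plus_half by metis
    qed
    ultimately show "ennreal (z ^ (2 * k) / (fact (2 * k) * c)) *
      (\<integral>\<^sup>+x. ennreal (I x * (2 * sin x ^ (2 * k) * cos x powr (2 * \<gamma>))) \<partial>lborel) =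
      ennreal ((z / 2) ^ (2 * k) / (fact k * Gamma (\<gamma> + real k + 1)))"
      unfolding I_def nn_integral_sin_cos_powr[OF assms] by (subst ennreal_mult''[symmetric]) auto
  qed
  also have "\<dots> = ennreal (bessel_series \<gamma> z)"
    unfolding bessel_series_def using assms
    by (intro suminf_ennreal2 bessel_series_term_nonneg summable_bessel_series) auto
  finally show ?thesis .
qed

lemma bessel_series_nonneg: "\<gamma> > - 1 \<Longrightarrow> 0 \<le> bessel_series \<gamma> z"
  unfolding bessel_series_def by (intro suminf_nonneg summable_bessel_series bessel_series_term_nonneg)

lemma bessel_series_ge: "\<gamma> > - 1 \<Longrightarrow> 1 / Gamma (\<gamma> + 1) \<le> bessel_series \<gamma> z"
  unfolding bessel_series_def
  using sum_le_suminf[OF summable_bessel_series, of \<gamma> "{0}" z] bessel_series_term_nonneg[of \<gamma> z]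
  by auto

lemma poisson_exp:
  assumes "\<gamma> > - 1 / 2"
  shows "integrable (poisson_measure \<gamma>) (\<lambda>\<theta>. exp (z * sin \<theta>))"
    and "(\<integral>\<theta>. exp (z * sin \<theta>) \<partial>poisson_measure \<gamma>) = bessel_series \<gamma> z"
proof -
  have "has_bochner_integral (poisson_measure \<gamma>) (\<lambda>\<theta>. exp (z * sin \<theta>)) (bessel_series \<gamma> z)"
    using assms nn_integral_poisson_exp[OF assms, of z]
    by (intro has_bochner_integral_nn_integral bessel_series_nonneg) (auto simp: poisson_measure_def)
  then show "integrable (poisson_measure \<gamma>) (\<lambda>\<theta>. exp (z * sin \<theta>))"
    "(\<integral>\<theta>. exp (z * sin \<theta>) \<partial>poisson_measure \<gamma>) = bessel_series \<gamma> z"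
    by (auto simp: has_bochner_integral_iff)
qed

lemma finite_measure_poisson: "\<gamma> > - 1 / 2 \<Longrightarrow> finite_measure (poisson_measure \<gamma>)"
  using nn_integral_poisson_exp[of \<gamma> 0] by (intro finite_measureI) auto

lemma poisson_bounded_integrable:
  assumes "\<gamma> > - 1 / 2" and [measurable]: "f \<in> borel_measurable borel" and "\<And>x. \<bar>f x\<bar> \<le> (C::real)"
  shows "integrable (poisson_measure \<gamma>) f"
proof -
  interpret finite_measure "poisson_measure \<gamma>" using assms(1) by (rule finite_measure_poisson)
  show ?thesis using assms(3) by (intro integrable_const_bound[where B=C] AE_I2) auto
qed

text \<open>The integrand is the total derivative of
  \<open>cos \<theta> powr (2 * \<gamma> + 1) * exp (z * sin \<theta>)\<close>.\<close>

lemma poisson_by_parts: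
  assumes "\<gamma> > - 1 / 2"
  shows "(\<integral>\<theta>. (z * (cos \<theta>)\<^sup>2 - (2 * \<gamma> + 1) * sin \<theta>) * exp (z * sin \<theta>) \<partial>poisson_measure \<gamma>) = 0"
proof -
  define h where "h = (\<lambda>x. (z * (cos x)\<^sup>2 - (2 * \<gamma> + 1) * sin x) * exp (z * sin x))"
  have [measurable]: "h \<in> borel_measurable borel" unfolding h_def by measurable
  have "\<bar>h x\<bar> \<le> (\<bar>z\<bar> + \<bar>2 * \<gamma> + 1\<bar>) * exp \<bar>z\<bar>" for x
  proof -
    have "\<bar>z * (cos x)\<^sup>2 - (2 * \<gamma> + 1) * sin x\<bar> \<le> \<bar>z\<bar> * 1 + \<bar>2 * \<gamma> + 1\<bar> * 1"
    proof (rule order_trans[OF abs_triangle_ineq4], unfold abs_mult, rule add_mono)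
      show "\<bar>z\<bar> * \<bar>(cos x)\<^sup>2\<bar> \<le> \<bar>z\<bar> * 1"
        by (rule mult_left_mono) (simp_all add: abs_square_le_1)
      show "\<bar>2 * \<gamma> + 1\<bar> * \<bar>sin x\<bar> \<le> \<bar>2 * \<gamma> + 1\<bar> * 1"
        by (rule mult_left_mono) simp_all
    qed
    moreover have "z * sin x \<le> \<bar>z\<bar> * 1"
    proof (rule order_trans[OF abs_ge_self], unfold abs_mult)
      show "\<bar>z\<bar> * \<bar>sin x\<bar> \<le> \<bar>z\<bar> * 1" by (rule mult_left_mono) simp_all
    qed
    ultimately show ?thesis unfolding h_def abs_mult by (intro mult_mono) simp_all
  qed
  then have i: "integrable (poisson_measure \<gamma>) h" by (intro poisson_bounded_integrable[OF assms]) auto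
  have "integrable lborel (\<lambda>x. poisson_density \<gamma> x * h x)"
    using i poisson_density_nonneg[OF assms] by (simp add: poisson_measure_def integrable_density)
  \<comment> \<open>The same integral is evaluated twice, as a Lebesgue integral and by the
    fundamental theorem of calculus; uniqueness of the gauge integral compares the results.\<close>
  then have "((\<lambda>x. poisson_density \<gamma> x * h x) has_integral (\<integral>x. poisson_density \<gamma> x * h x \<partial>lborel)) UNIV"
    by (rule has_integral_integral_lborel)
  moreover have "((\<lambda>x. poisson_density \<gamma> x * h x) has_integral 0) UNIV"
  proof -
    define c where "c = sqrt pi * Gamma (\<gamma> + 1 / 2)"
    have "0 < Gamma (\<gamma> + 1 / 2)" using assms by (intro Gamma_real_pos) auto
    then have c: "c \<noteq> 0" by (simp add: c_def)
    define G where "G = (\<lambda>x. cos x powr (2 * \<gamma> + 1) * exp (z * sin x) / c)"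
    define G' where "G' = (\<lambda>x. cos x powr (2 * \<gamma>) * h x / c)"
    have cpos: "cos x > 0" if "x \<in> {-pi/2<..<pi/2}" for x
      using that by (intro cos_gt_zero_pi) auto
    have "(G' has_integral (G (pi/2) - G (-pi/2))) {-pi/2..pi/2}"
    proof (rule fundamental_theorem_of_calculus_interior)
      \<comment> \<open>Continuity up to the ends, where the cosine is zero, rests on the positive
        exponent 2 \<gamma> + 1.\<close>
      show "continuous_on {-pi/2..pi/2} G"
        unfolding G_def using assms c
        by (intro continuous_on_divide continuous_on_mult continuous_on_powr' continuous_on_const
              continuous_on_cos continuous_on_exp continuous_on_sin continuous_on_id ballI conjI impI cos_ge_zero)
           auto
      show "(G has_vector_derivative G' x) (at x)" if "x \<in> {-pi/2<..<pi/2}" for x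
      proof -
        have "cos x powr (2 * \<gamma> + 1) = cos x powr (2 * \<gamma>) * cos x" "cos x powr (2 * \<gamma> + 1 - 1) = cos x powr (2 * \<gamma>)"
          using cpos[OF that] by (auto simp: powr_add)
        then show ?thesis
          unfolding has_real_derivative_iff_has_vector_derivative[symmetric] G_def G'_def h_def
          using cpos[OF that]
          by (auto intro!: derivative_eq_intros simp: divide_inverse power2_eq_square algebra_simps)
      qed
    qed auto
    moreover have "G (pi/2) = 0" "G (-pi/2) = 0" using assms by (auto simp: G_def)
    ultimately have "(G' has_integral 0) {-pi/2<..<pi/2}" by (simp add: has_integral_Icc_iff_Ioo)
    then have "((\<lambda>x. if x \<in> {-pi/2<..<pi/2} then G' x else 0) has_integral 0) UNIV"
      by (simp only: has_integral_restrict_UNIV)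
    moreover have "(if x \<in> {-pi/2<..<pi/2} then G' x else 0) = poisson_density \<gamma> x * h x" for x
      by (simp add: G'_def poisson_density_def c_def)
    ultimately show ?thesis by simp
  qed
  ultimately have "(\<integral>x. poisson_density \<gamma> x * h x \<partial>lborel) = 0" by (rule has_integral_unique)
  then show ?thesis
    unfolding h_def[symmetric] poisson_measure_def using poisson_density_nonneg[OF assms]
    by (subst integral_density) auto
qed

section \<open>Gaussian moments and Weber's integral\<close>

lemma nn_integral_gauss_moment:
  assumes "a > 0" "t > 0"
  shows "(\<integral>\<^sup>+s. ennreal (indicator {0<..} s * (s powr (2 * a - 1) * exp (- s\<^sup>2 / (4 * t)))) \<partial>lborel)
    = ennreal ((4 * t) powr a * Gamma a / 2)"
proof -
  \<comment> \<open>The Gamma integrand after the substitution r = s^2 / (4 t); the constant (4 t)^a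
    / 2 collects the powers of 4 t that it produces.\<close>
  define f where "f = (\<lambda>r::real. (4 * t) powr a / 2 * (r powr (a - 1) / exp r))"
  have im: "(\<lambda>s. s\<^sup>2 / (4 * t)) ` {0<..} = {0<..}"
  proof (intro equalityI subsetI)
    fix y :: real assume "y \<in> {0<..}"
    then show "y \<in> (\<lambda>s. s\<^sup>2 / (4 * t)) ` {0<..}"
      using assms by (intro image_eqI[of _ _ "sqrt (4 * t * y)"]) auto
  qed (use assms in auto)
  have "(\<integral>\<^sup>+s. ennreal (indicator {0<..} s * (\<bar>2 * s / (4 * t)\<bar> * f (s\<^sup>2 / (4 * t)))) \<partial>lborel)
      = ennreal ((4 * t) powr a / 2 * Gamma a)"
  proof (rule nn_integral_substitution_has_integral
      [where f=f and g="\<lambda>s. s\<^sup>2 / (4 * t)" and g'="\<lambda>s. 2 * s / (4 * t)"])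
    show "((\<lambda>s. s\<^sup>2 / (4 * t)) has_field_derivative 2 * s / (4 * t)) (at s within {0<..})" for s :: real
      using assms by (auto intro!: derivative_eq_intros)
    show "inj_on (\<lambda>s. s\<^sup>2 / (4 * t)) {0<..}"
      using assms by (intro inj_onI) (auto simp: power2_eq_iff)
    have "((\<lambda>r. r powr (a - 1) / exp r) has_integral Gamma a) {0<..}"
      using Gamma_integral_real[OF assms(1)]
      by (subst has_integral_spike_set_eq[of _ "{0..}"]) (auto intro: negligible_subset[of "{0}"])
    then show "(f has_integral (4 * t) powr a / 2 * Gamma a) ((\<lambda>s. s\<^sup>2 / (4 * t)) ` {0<..})"
      unfolding im f_def by (rule has_integral_mult_right)
  qed (auto simp: f_def)
  moreover have "indicator {0<..} s * (\<bar>2 * s / (4 * t)\<bar> * f (s\<^sup>2 / (4 * t)))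
      = indicator {0<..} s * (s powr (2 * a - 1) * exp (- s\<^sup>2 / (4 * t)))" for s
  proof (cases "s > 0")
    case True
    have "s\<^sup>2 = s powr 2" using True by simp
    then have "(s\<^sup>2 / (4 * t)) powr (a - 1) = (s powr 2) powr (a - 1) / (4 * t) powr (a - 1)"
      using powr_divide[of "s powr 2" "4 * t" "a - 1"] True assms by simp
    also have "(s powr 2) powr (a - 1) = s powr (2 * (a - 1))" by (rule powr_powr)
    also have "s powr (2 * (a - 1)) / (4 * t) powr (a - 1) = s powr (2 * a - 1) / s / ((4 * t) powr a / (4 * t))"
      using True assms powr_diff[of s "2 * a - 1" 1] powr_diff[of "4 * t" a 1]
      by (simp add: algebra_simps)
    finally show ?thesis using True assms
      by (simp add: f_def exp_minus field_simps)
  qed simp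
  ultimately show ?thesis by (simp add: mult.commute)
qed

text \<open>The Bessel series is integrated term by term. The k-th moment contributes Gamma(\<gamma>
  + k + 1), which cancels the Gamma factor of the series and leaves the exponential series of x^2 /
  (4 t).\<close>

lemma nn_integral_bessel_gauss:
  assumes "\<gamma> > - 1" "t > 0"
  shows "(\<integral>\<^sup>+s. ennreal (indicator {0<..} s * (s powr (2 * \<gamma> + 1) * exp (- s\<^sup>2 / (4 * t)) * bessel_series \<gamma> (x * s / (2 * t)))) \<partial>lborel)
    = ennreal ((4 * t) powr (\<gamma> + 1) / 2 * exp (x\<^sup>2 / (4 * t)))"
proof -
  define a where "a = (\<lambda>k. (x / (4 * t)) ^ (2 * k) / (fact k * Gamma (\<gamma> + real k + 1)))"
  have a0: "0 \<le> a k" for k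
    using bessel_series_term_nonneg[OF assms(1), of "2 * (x / (4 * t))" k] by (simp add: a_def)
  have "(\<integral>\<^sup>+s. ennreal (indicator {0<..} s * (s powr (2 * \<gamma> + 1) * exp (- s\<^sup>2 / (4 * t)) * bessel_series \<gamma> (x * s / (2 * t)))) \<partial>lborel)
      = (\<integral>\<^sup>+s. (\<Sum>k. ennreal (a k) * ennreal (indicator {0<..} s * (s powr (2 * (\<gamma> + real k + 1) - 1) * exp (- s\<^sup>2 / (4 * t))))) \<partial>lborel)"
  proof (rule nn_integral_cong)
    fix s :: real
    define C where "C = indicator {0<..} s * (s powr (2 * \<gamma> + 1) * exp (- s\<^sup>2 / (4 * t)))"
    have s: "(\<lambda>k. C * ((x * s / (2 * t) / 2) ^ (2 * k) / (fact k * Gamma (\<gamma> + real k + 1))))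
        sums (C * bessel_series \<gamma> (x * s / (2 * t)))"
      unfolding bessel_series_def by (intro sums_mult summable_sums summable_bessel_series assms)
    have nn: "0 \<le> C * ((x * s / (2 * t) / 2) ^ (2 * k) / (fact k * Gamma (\<gamma> + real k + 1)))" for k
      by (intro mult_nonneg_nonneg bessel_series_term_nonneg assms) (auto simp: C_def)
    have "ennreal (C * bessel_series \<gamma> (x * s / (2 * t))) =
        (\<Sum>k. ennreal (C * ((x * s / (2 * t) / 2) ^ (2 * k) / (fact k * Gamma (\<gamma> + real k + 1)))))"
      using suminf_ennreal2[OF nn sums_summable[OF s]] sums_unique[OF s] by simp
    also have "\<dots> = (\<Sum>k. ennreal (a k) * ennreal (indicator {0<..} s * (s powr (2 * (\<gamma> + real k + 1) - 1) * exp (- s\<^sup>2 / (4 * t)))))"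
    proof (rule suminf_cong)
      fix k
      have "C * ((x * s / (2 * t) / 2) ^ (2 * k) / (fact k * Gamma (\<gamma> + real k + 1))) =
        a k * (indicator {0<..} s * (s powr (2 * (\<gamma> + real k + 1) - 1) * exp (- s\<^sup>2 / (4 * t))))"
      proof (cases "s > 0")
        case True
        have "2 * (\<gamma> + real k + 1) - 1 = (2 * \<gamma> + 1) + real (2 * k)" by simp
        then have "s powr (2 * (\<gamma> + real k + 1) - 1) = s powr (2 * \<gamma> + 1) * s ^ (2 * k)"
          using True by (simp only: powr_add powr_realpow)
        then show ?thesis using True
          by (simp add: C_def a_def power_mult_distrib power_divide field_simps)
             (simp add: power_mult_distrib[symmetric] power_mult)?
      qed (simp add: C_def)
      then show "ennreal (C * ((x * s / (2 * t) / 2) ^ (2 * k) / (fact k * Gamma (\<gamma> + real k + 1)))) =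
        ennreal (a k) * ennreal (indicator {0<..} s * (s powr (2 * (\<gamma> + real k + 1) - 1) * exp (- s\<^sup>2 / (4 * t))))"
        using a0[of k] by (simp add: ennreal_mult')
    qed
    finally show "ennreal (indicator {0<..} s * (s powr (2 * \<gamma> + 1) * exp (- s\<^sup>2 / (4 * t)) * bessel_series \<gamma> (x * s / (2 * t)))) =
        (\<Sum>k. ennreal (a k) * ennreal (indicator {0<..} s * (s powr (2 * (\<gamma> + real k + 1) - 1) * exp (- s\<^sup>2 / (4 * t)))))"
      by (simp add: C_def mult.assoc)
  qed
  also have "\<dots> = (\<Sum>k. ennreal (a k) * ennreal ((4 * t) powr (\<gamma> + real k + 1) * Gamma (\<gamma> + real k + 1) / 2))"
  proof (subst nn_integral_suminf)
    have "(\<integral>\<^sup>+s. ennreal (a k) * ennreal (indicator {0<..} s * (s powr (2 * (\<gamma> + real k + 1) - 1) * exp (- s\<^sup>2 / (4 * t)))) \<partial>lborel)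
        = ennreal (a k) * ennreal ((4 * t) powr (\<gamma> + real k + 1) * Gamma (\<gamma> + real k + 1) / 2)" for k
      using assms by (subst nn_integral_cmult, measurable, subst nn_integral_gauss_moment) auto
    then show "(\<Sum>k. \<integral>\<^sup>+s. ennreal (a k) * ennreal (indicator {0<..} s * (s powr (2 * (\<gamma> + real k + 1) - 1) * exp (- s\<^sup>2 / (4 * t)))) \<partial>lborel)
        = (\<Sum>k. ennreal (a k) * ennreal ((4 * t) powr (\<gamma> + real k + 1) * Gamma (\<gamma> + real k + 1) / 2))"
      by simp
  qed measurable
  also have "\<dots> = (\<Sum>k. ennreal ((4 * t) powr (\<gamma> + 1) / 2 * ((x\<^sup>2 / (4 * t)) ^ k / fact k)))"
  proof (rule suminf_cong)
    fix k
    have "(4 * t) powr (\<gamma> + real k + 1) = (4 * t) powr (\<gamma> + 1) * (4 * t) ^ k"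
      using assms powr_add[of "4 * t" "\<gamma> + 1" "real k"] by (simp add: powr_realpow add_ac)
    moreover have "Gamma (\<gamma> + real k + 1) > 0" using assms by (auto intro!: Gamma_real_pos)
    moreover have "(x / (4 * t)) ^ (2 * k) * (4 * t) ^ k = (x\<^sup>2 / (4 * t)) ^ k"
      unfolding power_mult power_mult_distrib[symmetric] using assms
      by (simp add: power2_eq_square)
    moreover have "X / (F * G) * (P * T * G / 2) = P / 2 * (X * T / F)" if "G > 0" for X F G P T :: real
      using that by (simp add: mult_ac)
    ultimately have "a k * ((4 * t) powr (\<gamma> + real k + 1) * Gamma (\<gamma> + real k + 1) / 2)
      = (4 * t) powr (\<gamma> + 1) / 2 * ((x\<^sup>2 / (4 * t)) ^ k / fact k)"
      unfolding a_def by metis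
    then show "ennreal (a k) * ennreal ((4 * t) powr (\<gamma> + real k + 1) * Gamma (\<gamma> + real k + 1) / 2)
      = ennreal ((4 * t) powr (\<gamma> + 1) / 2 * ((x\<^sup>2 / (4 * t)) ^ k / fact k))"
      using a0[of k] by (simp only: ennreal_mult'[symmetric])
  qed
  also have "\<dots> = ennreal ((4 * t) powr (\<gamma> + 1) / 2 * exp (x\<^sup>2 / (4 * t)))"
  proof -
    have s: "(\<lambda>k. (4 * t) powr (\<gamma> + 1) / 2 * ((x\<^sup>2 / (4 * t)) ^ k / fact k)) sums ((4 * t) powr (\<gamma> + 1) / 2 * exp (x\<^sup>2 / (4 * t)))"
    proof (rule sums_mult)
      have "y ^ k /\<^sub>R fact k = y ^ k / fact k" for y :: real and k
        by (simp add: divide_inverse)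
      then show "(\<lambda>k. (x\<^sup>2 / (4 * t)) ^ k / fact k) sums exp (x\<^sup>2 / (4 * t))"
        using exp_converges[of "x\<^sup>2 / (4 * t)"] by presburger
    qed
    have nn: "0 \<le> (4 * t) powr (\<gamma> + 1) / 2 * ((x\<^sup>2 / (4 * t)) ^ k / fact k)" for k
      using assms(2) by simp
    show ?thesis
      using suminf_ennreal2[OF nn sums_summable[OF s]] sums_unique[OF s] by simp
  qed
  finally show ?thesis .
qed

section \<open>The Bessel heat extension\<close>

lemma vec_measurable:
  fixes f :: "'a \<Rightarrow> real^'n"
  assumes "\<And>j. (\<lambda>w. f w $ j) \<in> borel_measurable M"
  shows "f \<in> borel_measurable M"
  by (rule borel_measurable_euclidean_space[THEN iffD2]) (auto simp: Basis_vec_def inner_axis assms)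

lemma vec_nth_measurable [measurable (raw)]:
  fixes f :: "'a \<Rightarrow> real^'n"
  assumes "f \<in> borel_measurable M"
  shows "(\<lambda>w. f w $ j) \<in> borel_measurable M"
  by (rule measurable_compose[OF assms]) (intro borel_measurable_continuous_onI continuous_intros)

definition scaled_sin :: "real^'n \<Rightarrow> ('n \<Rightarrow> real) \<Rightarrow> real^'n" where
  "scaled_sin s \<theta> = (\<chi> j. s $ j * sin (\<theta> j))"

lemma norm_scaled_sin_le: "(norm (scaled_sin s \<theta>))\<^sup>2 \<le> (norm s)\<^sup>2"
proof (intro power_mono norm_le_componentwise_cart)
  show "norm (scaled_sin s \<theta> $ i) \<le> norm (s $ i)" for i
    using mult_left_mono[OF abs_sin_le_one[of "\<theta> i"] abs_ge_zero[of "s $ i"]]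
    by (simp add: scaled_sin_def abs_mult)
qed simp

text \<open>The defect Q - |b|^2 of the Gaussian family becomes a sum of squared cosines, exactly
  the terms that appear in the angular integration by parts.\<close>

lemma sq_norm_scaled_sin: "(norm s)\<^sup>2 - (norm (scaled_sin s \<theta>))\<^sup>2 = (\<Sum>j\<in>UNIV. (s $ j)\<^sup>2 * (cos (\<theta> j))\<^sup>2)"
proof -
  have c: "cos y * cos y = 1 - sin y * sin y" for y :: real
    by (metis cos_squared_eq power2_eq_square)
  show ?thesis
    unfolding power2_norm_eq_inner
    by (simp add: c inner_vec_def scaled_sin_def sum_subtractf[symmetric] power2_eq_square algebra_simps)
qed

text \<open>The bound is what makes cos^(2\<gamma>) integrable at both ends of the interval, so that
  Poisson's integral is available in every coordinate.\<close>

locale bessel_heat =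
  fixes \<gamma> :: "real^'n"
  assumes gamma_gt: "\<And>j. - 1 / 2 < \<gamma> $ j"
begin

definition Theta :: "('n \<Rightarrow> real) measure" where
  "Theta = Pi\<^sub>M UNIV (\<lambda>j. poisson_measure (\<gamma> $ j))"

definition kernel_exponent :: "real^'n \<Rightarrow> real^'n \<Rightarrow> ('n \<Rightarrow> real) \<Rightarrow> real" where
  "kernel_exponent x s \<theta> = (norm s)\<^sup>2 + (norm x)\<^sup>2 - 2 * (x \<bullet> scaled_sin s \<theta>)"

lemma sets_Theta [measurable_cong]: "sets Theta = sets (Pi\<^sub>M UNIV (\<lambda>j. borel))"
  unfolding Theta_def by (intro sets_PiM_cong) auto

sublocale product_sigma_finite "\<lambda>j. poisson_measure (\<gamma> $ j)"
  by (intro product_sigma_finite.intro finite_measure.axioms(1) finite_measure_poisson gamma_gt)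

sublocale Theta: finite_measure Theta
proof
  have "emeasure Theta (space Theta) = (\<Prod>j\<in>UNIV. emeasure (poisson_measure (\<gamma> $ j)) UNIV)"
    unfolding Theta_def space_PiM by (subst emeasure_PiM) (auto simp: sets.top[of "poisson_measure _", simplified])
  also have "\<dots> = (\<Prod>j\<in>UNIV. ennreal (measure (poisson_measure (\<gamma> $ j)) UNIV))"
    by (intro prod.cong refl finite_measure.emeasure_eq_measure finite_measure_poisson gamma_gt)
  also have "\<dots> = ennreal (\<Prod>j\<in>UNIV. measure (poisson_measure (\<gamma> $ j)) UNIV)"
    by (rule prod_ennreal) simp
  finally show "emeasure Theta (space Theta) \<noteq> \<infinity>" by auto
qed

lemma component_measurable [measurable (raw)]:
  assumes "f \<in> measurable M Theta"
  shows "(\<lambda>w. f w j) \<in> borel_measurable M"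
proof (rule measurable_compose[OF assms])
  show "(\<lambda>\<theta>. \<theta> j) \<in> borel_measurable Theta"
    by (subst measurable_cong_sets[OF sets_Theta refl]) (rule measurable_component_singleton, simp)
qed

lemma scaled_sin_measurable [measurable]:
  "(\<lambda>w. scaled_sin (fst w) (snd w)) \<in> borel_measurable (lborel \<Otimes>\<^sub>M Theta)"
  "scaled_sin s \<in> borel_measurable Theta"
  unfolding scaled_sin_def[abs_def] by (rule vec_measurable, simp, measurable)+

sublocale pair_sigma_finite "lborel :: (real^'n) measure" Theta
  by (intro pair_sigma_finite.intro lborel.sigma_finite_measure_axioms Theta.sigma_finite_measure_axioms)

text \<open>One exponent, read in two ways. In \<open>S\<close> the source point s is integrated
  together with the angles and x is the variable of differentiation. In \<open>K\<close> the point x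
  is a fixed parameter, only the angles are integrated, and the variable of the family is s.\<close>

sublocale S: gauss_family "lborel \<Otimes>\<^sub>M Theta" "\<lambda>w. (norm (fst w))\<^sup>2" "\<lambda>w. scaled_sin (fst w) (snd w)"
  by unfold_locales (auto simp: norm_scaled_sin_le)

sublocale K: gauss_family Theta "\<lambda>\<theta>. (norm x)\<^sup>2" "scaled_sin x" for x
  by unfold_locales (auto simp: norm_scaled_sin_le)

lemma inner_scaled_sin: "x \<bullet> scaled_sin s \<theta> = (\<Sum>j\<in>UNIV. x $ j * s $ j * sin (\<theta> j))"
  by (simp add: scaled_sin_def inner_vec_def mult.assoc)

lemma S_R: "S.R x w = kernel_exponent x (fst w) (snd w)"
  by (simp add: S.R_def kernel_exponent_def)

lemma K_R: "K.R x s \<theta> = kernel_exponent x s \<theta>"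
  by (simp add: K.R_def kernel_exponent_def inner_scaled_sin mult_ac)

lemma exp_kernel:
  assumes "t \<noteq> 0"
  shows "exp (- kernel_exponent x s \<theta> / (4 * t)) = exp (- ((norm x)\<^sup>2 + (norm s)\<^sup>2) / (4 * t)) *
    (\<Prod>j\<in>UNIV. exp (x $ j * s $ j / (2 * t) * sin (\<theta> j)))"
  unfolding exp_sum[OF finite, symmetric] exp_add[symmetric] kernel_exponent_def inner_scaled_sin
  using assms by (simp add: sum_divide_distrib[symmetric] field_simps sum_distrib_left)

abbreviation bessel_gauss :: "real^'n \<Rightarrow> real^'n \<Rightarrow> real \<Rightarrow> real" where
  "bessel_gauss x s t \<equiv> exp (- ((norm x)\<^sup>2 + (norm s)\<^sup>2) / (4 * t)) *
    (\<Prod>j\<in>UNIV. bessel_series (\<gamma> $ j) (x $ j * s $ j / (2 * t)))"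

lemma integral_exp_kernel:
  assumes "t \<noteq> 0"
  shows "(\<integral>\<theta>. exp (- kernel_exponent x s \<theta> / (4 * t)) \<partial>Theta) =
    bessel_gauss x s t"
  unfolding exp_kernel[OF assms] Theta_def
  by (subst integral_mult_right_zero, subst product_integral_prod) (simp_all only: poisson_exp gamma_gt finite)

text \<open>The exponential factorises over the coordinates and so does the product measure. The
  k-th factor is the integral of the exact derivative \<open>poisson_by_parts\<close> with z = x_k
  s_k / (2 t), which is zero.\<close>

lemma integral_by_parts_kernel:
  assumes "t \<noteq> 0"
  shows "(\<integral>\<theta>. (x $ k * s $ k / (2 * t) * (cos (\<theta> k))\<^sup>2 - (2 * \<gamma> $ k + 1) * sin (\<theta> k)) *
    exp (- kernel_exponent x s \<theta> / (4 * t)) \<partial>Theta) = 0"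
proof -
  define z where "z = (\<lambda>j. x $ j * s $ j / (2 * t))"
  define f where "f = (\<lambda>j \<theta>. (if j = k then z k * (cos \<theta>)\<^sup>2 - (2 * \<gamma> $ k + 1) * sin \<theta> else 1) * exp (z j * sin \<theta>))"
  have [measurable]: "f j \<in> borel_measurable borel" for j unfolding f_def by measurable
  have "\<bar>f j \<theta>\<bar> \<le> (\<bar>z k\<bar> + \<bar>2 * \<gamma> $ k + 1\<bar> + 1) * exp \<bar>z j\<bar>" for j \<theta>
  proof -
    have "\<bar>z k * (cos \<theta>)\<^sup>2\<bar> \<le> \<bar>z k\<bar> * 1" "\<bar>(2 * \<gamma> $ k + 1) * sin \<theta>\<bar> \<le> \<bar>2 * \<gamma> $ k + 1\<bar> * 1"
      "\<bar>z j * sin \<theta>\<bar> \<le> \<bar>z j\<bar> * 1"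
      unfolding abs_mult by (rule mult_left_mono; simp add: abs_square_le_1)+
    then have *: "\<bar>if j = k then z k * (cos \<theta>)\<^sup>2 - (2 * \<gamma> $ k + 1) * sin \<theta> else 1\<bar> \<le> \<bar>z k\<bar> + \<bar>2 * \<gamma> $ k + 1\<bar> + 1"
      "z j * sin \<theta> \<le> \<bar>z j\<bar>"
      by auto
    show ?thesis unfolding f_def abs_mult using * by (intro mult_mono) simp_all
  qed
  then have i: "integrable (poisson_measure (\<gamma> $ j)) (f j)" for j
    by (intro poisson_bounded_integrable gamma_gt) auto
  have "(\<integral>\<theta>. (\<Prod>j\<in>UNIV. f j (\<theta> j)) \<partial>Theta) = (\<Prod>j\<in>UNIV. \<integral>\<theta>. f j \<theta> \<partial>poisson_measure (\<gamma> $ j))"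
    unfolding Theta_def by (rule product_integral_prod) (auto simp: i)
  also have "\<dots> = 0"
    using poisson_by_parts[OF gamma_gt[of k], of "z k"] by (intro prod_zero bexI[of _ k]) (auto simp: f_def)
  finally have "(\<integral>\<theta>. (\<Prod>j\<in>UNIV. f j (\<theta> j)) \<partial>Theta) = 0" .
  moreover have "(z k * (cos (\<theta> k))\<^sup>2 - (2 * \<gamma> $ k + 1) * sin (\<theta> k)) *
    exp (- kernel_exponent x s \<theta> / (4 * t)) =
    exp (- ((norm x)\<^sup>2 + (norm s)\<^sup>2) / (4 * t)) * (\<Prod>j\<in>UNIV. f j (\<theta> j))" for \<theta>
    unfolding exp_kernel[OF assms] f_def prod.distrib
    by (simp add: z_def)
  ultimately show ?thesis by (simp add: z_def)
qed

text \<open>The density for which the operator is symmetric, since its logarithmic derivative in s_k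
  is (2 \<gamma>_k + 1)/s_k. The indicator lets all integrals run over the whole space.\<close>

definition weight :: "real^'n \<Rightarrow> real" where
  "weight s = indicator pos_orthant s * (\<Prod>j\<in>UNIV. (s $ j) powr (2 * \<gamma> $ j + 1))"

lemma weight_nonneg: "0 \<le> weight s"
  unfolding weight_def by (intro mult_nonneg_nonneg prod_nonneg) auto

lemma weight_measurable [measurable]: "weight \<in> borel_measurable borel"
proof -
  have [measurable]: "(\<lambda>s::real^'n. s $ j) \<in> borel_measurable borel" for j
    by (intro borel_measurable_continuous_onI continuous_intros)
  have [measurable]: "pos_orthant \<in> sets (borel :: (real^'n) measure)"
    by (intro borel_open open_pos_orthant)
  show ?thesis unfolding weight_def by measurable
qed

definition wadm :: "(real^'n \<Rightarrow> real) \<Rightarrow> bool" where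
  "wadm f \<longleftrightarrow> (\<lambda>s. f s * weight s) \<in> borel_measurable borel \<and>
     (\<forall>e>0. integrable lborel (\<lambda>s. f s * weight s * exp (- e * (norm s)\<^sup>2)))"

abbreviation wext :: "(real^'n \<Rightarrow> real) \<Rightarrow> (real^'n) \<times> ('n \<Rightarrow> real) \<Rightarrow> real" where
  "wext f \<equiv> (\<lambda>w. f (fst w) * weight (fst w))"

lemma integrable_fst_only:
  assumes "integrable lborel (g :: real^'n \<Rightarrow> real)"
  shows "integrable (lborel \<Otimes>\<^sub>M Theta) (\<lambda>w. g (fst w))"
proof (rule Fubini_integrable)
  show "(\<lambda>w. g (fst w)) \<in> borel_measurable (lborel \<Otimes>\<^sub>M Theta)" using assms by measurable
qed (use assms in auto)

lemma wext_adm: "wadm f \<Longrightarrow> S.adm (wext f)"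
proof -
  assume f: "wadm f"
  have [measurable]: "(\<lambda>s. f s * weight s) \<in> borel_measurable borel" using f by (simp add: wadm_def)
  have "integrable (lborel \<Otimes>\<^sub>M Theta) (\<lambda>w. f (fst w) * weight (fst w) * exp (- e * (norm (fst w))\<^sup>2))" if "e > 0" for e
    using f that by (intro integrable_fst_only[of "\<lambda>s. f s * weight s * exp (- e * (norm s)\<^sup>2)"]) (simp add: wadm_def)
  moreover have "wext f \<in> borel_measurable (lborel \<Otimes>\<^sub>M Theta)"
    by (rule measurable_compose[of fst _ lborel "\<lambda>s. f s * weight s"]) simp_all
  ultimately show ?thesis unfolding S.adm_def by blast
qed

definition mass_exponent :: real where
  "mass_exponent = real CARD('n) + (\<Sum>k\<in>UNIV. \<gamma> $ k)"

text \<open>The numerical part of (2 t)^(-n) times the product of the (4 t)^(-\<gamma>_j); the part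
  depending on t is t powr (- \<open>mass_exponent\<close>).\<close>

definition mass_const :: real where
  "mass_const = (1 / 2) ^ CARD('n) * (\<Prod>j\<in>UNIV. 4 powr (- \<gamma> $ j))"

definition heat_ext :: "(real^'n \<Rightarrow> real) \<Rightarrow> real^'n \<Rightarrow> real \<Rightarrow> real" where
  "heat_ext f x t = mass_const * (t powr (- mass_exponent) * S.Phi (wext f) x t)"

lemma mass_const_pos: "0 < mass_const"
  unfolding mass_const_def by (intro mult_pos_pos prod_pos) auto

lemma heat_ext_V: "wadm f \<Longrightarrow> heat_ext f \<in> S.V"
  unfolding heat_ext_def[abs_def] by (intro S.V.intros wext_adm)

lemma S_Phi_fubini:
  assumes "S.adm g" "0 < t"
  shows "S.Phi g x t = (\<integral>s. (\<integral>\<theta>. g (s, \<theta>) * exp (- kernel_exponent x s \<theta> / (4 * t)) \<partial>Theta) \<partial>lborel)"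
  using integral_fst'[OF S.integrable_adm[OF assms, of x]] unfolding S.Phi_def S_R by simp

lemma heat_ext_eq:
  assumes "wadm f" "0 < t"
  shows "heat_ext f x t = mass_const * t powr (- mass_exponent) *
    (\<integral>s. f s * weight s * bessel_gauss x s t \<partial>lborel)"
proof -
  have "t \<noteq> 0" using assms(2) by simp
  from integral_exp_kernel[OF this] show ?thesis
    unfolding heat_ext_def S_Phi_fubini[OF wext_adm[OF assms(1)] assms(2)]
    by (simp only: fst_conv integral_mult_right_zero mult.assoc)
qed

text \<open>For fixed s, the two remaining terms in direction k combine to the factor f(s) w(s) s_k
  / (2 t x_k) times the integrand of \<open>integral_by_parts_kernel\<close>, so Fubini with the
  angles integrated first gives zero direction by direction.\<close>

lemma bessel_heat_op_heat_ext:
  assumes f: "wadm f" and x: "x \<in> pos_orthant" and t: "0 < t"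
  shows "bessel_heat_op \<gamma> (\<lambda>x t. t powr (- mass_exponent) * S.Phi (wext f) x t) x t = 0"
proof -
  define g where "g = wext f"
  have g: "S.adm g" unfolding g_def using f by (rule wext_adm)
  have x0: "x $ k \<noteq> 0" for k using pos_orthantD[OF x, of k] by simp
  define A where "A = (\<lambda>k w. (fst w $ k)\<^sup>2 * (cos (snd w k))\<^sup>2 * g w)"
  define B where "B = (\<lambda>k w. scaled_sin (fst w) (snd w) $ k * g w)"
  have A: "S.adm (A k)" for k
    unfolding A_def
  proof (rule S.adm_mult[OF g, where C=1])
    fix w :: "(real^'n) \<times> ('n \<Rightarrow> real)"
    have "(fst w $ k)\<^sup>2 * (cos (snd w k))\<^sup>2 \<le> (norm (fst w))\<^sup>2 * 1"
      using power_mono[OF component_le_norm_cart[of "fst w" k] abs_ge_zero, of 2]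
      by (intro mult_mono) (auto simp: abs_square_le_1)
    then show "\<bar>(fst w $ k)\<^sup>2 * (cos (snd w k))\<^sup>2\<bar> \<le> 1 * (1 + (norm (fst w))\<^sup>2)" by simp
  qed measurable
  have B: "S.adm (B k)" for k
    using S.adm_b[OF g, of k] by (simp add: B_def)
  have e1: "(\<lambda>w. ((norm (fst w))\<^sup>2 - (norm (scaled_sin (fst w) (snd w)))\<^sup>2) * g w) = (\<lambda>w. \<Sum>k\<in>UNIV. A k w)"
    by (auto simp: fun_eq_iff sq_norm_scaled_sin A_def sum_distrib_right)
  have e2: "(\<lambda>w. scaled_sin (fst w) (snd w) $ k * g w) = B k" for k
    by (auto simp: B_def)
  have "S.Phi (A k) x t / (4 * t\<^sup>2) - (2 * \<gamma> $ k + 1) / (2 * t * x $ k) * S.Phi (B k) x t = 0" for k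
  proof -
    have "S.Phi (A k) x t / (4 * t\<^sup>2) - (2 * \<gamma> $ k + 1) / (2 * t * x $ k) * S.Phi (B k) x t =
        S.Phi (\<lambda>w. 1 / (4 * t\<^sup>2) * A k w + (- ((2 * \<gamma> $ k + 1) / (2 * t * x $ k))) * B k w) x t"
      unfolding S.Phi_add[OF S.adm_cmult[OF A] S.adm_cmult[OF B] t] S.Phi_cmult by simp
    also have "\<dots> = (\<integral>s. (\<integral>\<theta>. (1 / (4 * t\<^sup>2) * A k (s, \<theta>) + (- ((2 * \<gamma> $ k + 1) / (2 * t * x $ k))) * B k (s, \<theta>)) *
          exp (- kernel_exponent x s \<theta> / (4 * t)) \<partial>Theta) \<partial>lborel)"
      by (rule S_Phi_fubini[OF _ t]) (intro S.adm_add S.adm_cmult A B)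
    also have "\<dots> = (\<integral>s. (\<integral>\<theta>. (f s * weight s * s $ k / (2 * t * x $ k)) *
          ((x $ k * s $ k / (2 * t) * (cos (\<theta> k))\<^sup>2 - (2 * \<gamma> $ k + 1) * sin (\<theta> k)) *
          exp (- kernel_exponent x s \<theta> / (4 * t))) \<partial>Theta) \<partial>lborel)"
    proof -
      have "1 / (4 * t\<^sup>2) * A k (s, \<theta>) + (- ((2 * \<gamma> $ k + 1) / (2 * t * x $ k))) * B k (s, \<theta>) =
          (f s * weight s * s $ k / (2 * t * x $ k)) *
          (x $ k * s $ k / (2 * t) * (cos (\<theta> k))\<^sup>2 - (2 * \<gamma> $ k + 1) * sin (\<theta> k))" for s \<theta>
        using x0[of k] t by (simp add: A_def B_def g_def scaled_sin_def power2_eq_square field_simps)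
      then show ?thesis by (simp only: mult.assoc)
    qed
    also have "\<dots> = 0"
    proof -
      have "t \<noteq> 0" using t by simp
      then show ?thesis unfolding integral_mult_right_zero by (subst integral_by_parts_kernel) auto
    qed
    finally show ?thesis .
  qed
  then have "(\<Sum>k\<in>UNIV. S.Phi (A k) x t / (4 * t\<^sup>2) - (2 * \<gamma> $ k + 1) / (2 * t * x $ k) * S.Phi (B k) x t) = 0"
    by simp
  then have "S.Phi (\<lambda>w. \<Sum>k\<in>UNIV. A k w) x t / (4 * t\<^sup>2)
      - (\<Sum>k\<in>UNIV. (2 * \<gamma> $ k + 1) / (2 * t * x $ k) * S.Phi (B k) x t) = 0"
    using S.Phi_sum(2)[of UNIV A t x] A t by (simp add: sum_subtractf sum_divide_distrib)
  then show ?thesis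
    using S.bessel_heat_op_Phi[OF g t x0, of \<gamma>, unfolded e1 e2]
    unfolding g_def[symmetric] mass_exponent_def by simp
qed

text \<open>The heat kernel, up to a constant, regarded as a function of the source point s. Green's
  identity needs the heat equation in this variable.\<close>

definition kernel_fun :: "real^'n \<Rightarrow> real^'n \<Rightarrow> real \<Rightarrow> real" where
  "kernel_fun x s t = t powr (- mass_exponent) * K.Phi x (\<lambda>_. 1) s t"

lemma K_adm_const: "K.adm x (\<lambda>_. c)"
  unfolding K.adm_def by simp

lemma K_adm_bounded:
  assumes [measurable]: "h \<in> borel_measurable Theta" and "\<And>\<theta>. \<bar>h \<theta>\<bar> \<le> C"
  shows "K.adm x h"
  unfolding K.adm_def using assms(2)
  by (auto intro!: Theta.integrable_const_bound[where B=C])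

lemma kernel_fun_V: "kernel_fun x \<in> K.V x"
  unfolding kernel_fun_def[abs_def] by (intro K.V.intros K_adm_const)

lemma bessel_heat_op_kernel_fun:
  assumes s: "s \<in> pos_orthant" and t: "0 < t"
  shows "bessel_heat_op \<gamma> (kernel_fun x) s t = 0"
proof -
  have s0: "s $ k \<noteq> 0" for k using pos_orthantD[OF s, of k] by simp
  define A where "A = (\<lambda>k \<theta>. (x $ k)\<^sup>2 * (cos (\<theta> k :: real))\<^sup>2)"
  define B where "B = (\<lambda>k \<theta>. scaled_sin x \<theta> $ k)"
  have A: "K.adm x (A k)" for k
  proof (rule K_adm_bounded[where C="(x $ k)\<^sup>2"])
    show "A k \<in> borel_measurable Theta" unfolding A_def by measurable
    show "\<bar>A k \<theta>\<bar> \<le> (x $ k)\<^sup>2" for \<theta>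
      using mult_left_mono[of "(cos (\<theta> k))\<^sup>2" 1 "(x $ k)\<^sup>2"] by (simp add: A_def abs_square_le_1)
  qed
  have B: "K.adm x (B k)" for k
    using K.adm_b[OF K_adm_const[of _ 1]] by (simp add: B_def)
  have "K.Phi x (A k) s t / (4 * t\<^sup>2) - (2 * \<gamma> $ k + 1) / (2 * t * s $ k) * K.Phi x (B k) s t = 0" for k
  proof -
    have "K.Phi x (A k) s t / (4 * t\<^sup>2) - (2 * \<gamma> $ k + 1) / (2 * t * s $ k) * K.Phi x (B k) s t =
      K.Phi x (\<lambda>\<theta>. 1 / (4 * t\<^sup>2) * A k \<theta> + (- ((2 * \<gamma> $ k + 1) / (2 * t * s $ k))) * B k \<theta>) s t"
      unfolding K.Phi_add[OF K.adm_cmult[OF A] K.adm_cmult[OF B] t] K.Phi_cmult by simp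
    also have "(\<lambda>\<theta>. 1 / (4 * t\<^sup>2) * A k \<theta> + (- ((2 * \<gamma> $ k + 1) / (2 * t * s $ k))) * B k \<theta>) =
      (\<lambda>\<theta>. x $ k / (2 * t * s $ k) *
        (x $ k * s $ k / (2 * t) * (cos (\<theta> k))\<^sup>2 - (2 * \<gamma> $ k + 1) * sin (\<theta> k)))"
      using s0[of k] t by (auto simp: fun_eq_iff A_def B_def scaled_sin_def power2_eq_square field_simps)
    also have "K.Phi x \<dots> s t = 0"
      using t integral_by_parts_kernel[of t x k s]
      unfolding K.Phi_cmult by (simp add: K.Phi_def K_R)
    finally show ?thesis .
  qed
  then have "(\<Sum>k\<in>UNIV. K.Phi x (A k) s t / (4 * t\<^sup>2) -
      (2 * \<gamma> $ k + 1) / (2 * t * s $ k) * K.Phi x (B k) s t) = 0"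
    by simp
  moreover have "bessel_heat_op \<gamma> (\<lambda>x' t. t powr (- mass_exponent) * K.Phi x (\<lambda>_. 1) x' t) s t =
      t powr (- mass_exponent) * (K.Phi x (\<lambda>\<theta>. \<Sum>k\<in>UNIV. A k \<theta>) s t / (4 * t\<^sup>2)
      - (\<Sum>k\<in>UNIV. (2 * \<gamma> $ k + 1) / (2 * t * s $ k) * K.Phi x (B k) s t))"
    using K.bessel_heat_op_Phi[OF K_adm_const[of x 1] t s0, where \<gamma>=\<gamma>]
    by (simp add: sq_norm_scaled_sin mass_exponent_def A_def B_def)
  ultimately show ?thesis
    using K.Phi_sum(2)[of UNIV x A t s] A t
    by (simp add: kernel_fun_def[abs_def] sum_subtractf sum_divide_distrib)
qed

end

section \<open>Conservation of mass, time derivatives and initial values\<close>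

lemma power_le_fact_exp:
  assumes "0 \<le> (x::real)"
  shows "x ^ k \<le> fact k * exp x"
proof -
  have "(\<Sum>n\<in>{k}. inverse (fact n) * x ^ n) \<le> (\<Sum>n. inverse (fact n) * x ^ n)"
    using assms by (intro sum_le_suminf summable_exp) auto
  also have "\<dots> = exp x" by (simp add: exp_def)
  finally show ?thesis by (simp add: divide_simps mult.commute)
qed

text \<open>Induction on the polynomial: each factor y is absorbed by half of the exponent, and the
  other half is left for the induction hypothesis.\<close>

lemma poly_exp_bound:
  fixes p :: "real poly"
  shows "e > 0 \<Longrightarrow> \<exists>C\<ge>0. \<forall>y\<ge>0. \<bar>poly p y\<bar> \<le> C * exp (e * y)"
proof (induction p arbitrary: e)
  case 0
  then show ?case by (intro exI[of _ 0]) auto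
next
  case (pCons a p)
  from pCons.IH[of "e / 2"] pCons.prems obtain C where C: "C \<ge> 0" "\<And>y. y \<ge> 0 \<Longrightarrow> \<bar>poly p y\<bar> \<le> C * exp (e / 2 * y)"
    by auto
  have "\<bar>poly (pCons a p) y\<bar> \<le> (\<bar>a\<bar> + 2 / e * C) * exp (e * y)" if y: "y \<ge> 0" for y
  proof -
    have "e / 2 * y \<le> exp (e / 2 * y)" using exp_ge_add_one_self[of "e / 2 * y"] by linarith
    then have ye: "y \<le> 2 / e * exp (e / 2 * y)" using pCons.prems by (simp add: field_simps)
    have "\<bar>poly (pCons a p) y\<bar> \<le> \<bar>a\<bar> * 1 + y * \<bar>poly p y\<bar>"
      using y by (simp add: abs_mult order_trans[OF abs_triangle_ineq])
    also have "\<dots> \<le> \<bar>a\<bar> * exp (e * y) + (2 / e * exp (e / 2 * y)) * (C * exp (e / 2 * y))"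
      using y C pCons.prems ye by (intro add_mono mult_mono mult_left_mono) auto
    also have "(2 / e * exp (e / 2 * y)) * (C * exp (e / 2 * y)) = 2 / e * C * exp (e / 2 * y + e / 2 * y)"
      by (simp only: exp_add mult_ac)
    also have "e / 2 * y + e / 2 * y = e * y" by simp
    finally show ?thesis by (simp only: distrib_right)
  qed
  then show ?case using C(1) pCons.prems by (intro exI[of _ "\<bar>a\<bar> + 2 / e * C"]) auto
qed

text \<open>By power_le_fact_exp, exp (-c/t) is at most k! (t/c)^k; choosing k \<ge> a + 1 leaves
  one power of t to spare.\<close>

lemma powr_mult_exp_inverse_le:
  fixes a c :: real
  assumes "c > 0"
  shows "\<exists>C\<ge>0. \<forall>t\<in>{0<..1}. t powr (- a) * exp (- (c / t)) \<le> C * t"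
proof -
  obtain k :: nat where k: "a + 1 \<le> real k" using real_arch_simple by blast
  have "t powr (- a) * exp (- (c / t)) \<le> fact k / c ^ k * t" if t: "t \<in> {0<..1}" for t
  proof -
    have "(c / t) ^ k * exp (- (c / t)) \<le> fact k * exp (c / t) * exp (- (c / t))"
      using t assms by (intro mult_right_mono power_le_fact_exp) auto
    also have "\<dots> = fact k" by (simp add: exp_minus)
    finally have "exp (- (c / t)) \<le> fact k / c ^ k * t ^ k"
      using t assms by (simp add: power_divide field_simps)
    also have "t ^ k = t powr (real k)" using t by (simp add: powr_realpow)
    finally have "t powr (- a) * exp (- (c / t)) \<le> t powr (- a) * (fact k / c ^ k * t powr (real k))"
      by (intro mult_left_mono) auto
    also have "\<dots> = fact k / c ^ k * t powr (real k - a)"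
      using powr_add[of t "- a" "real k"] by (simp add: mult_ac)
    also have "t powr (real k - a) \<le> t powr 1"
      using t k by (intro powr_mono') auto
    then have "fact k / c ^ k * t powr (real k - a) \<le> fact k / c ^ k * t"
      using t assms by (intro mult_left_mono) auto
    finally show ?thesis .
  qed
  then show ?thesis using assms by (intro exI[of _ "fact k / c ^ k"]) auto
qed

lemma nn_integral_lborel_vec_prod:
  fixes h :: "'n::finite \<Rightarrow> real \<Rightarrow> ennreal"
  assumes "\<And>j. h j \<in> borel_measurable borel"
  shows "(\<integral>\<^sup>+s. (\<Prod>j\<in>UNIV. h j (s $ j)) \<partial>(lborel :: (real^'n) measure)) = (\<Prod>j\<in>UNIV. \<integral>\<^sup>+y. h j y \<partial>lborel)"
proof -
  \<comment> \<open>The product formula for Lebesgue measure runs over basis vectors;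
    \<open>idx\<close> returns the coordinate that belongs to a basis vector.\<close>
  define idx where "idx = inv (\<lambda>j::'n. axis j (1::real))"
  have inj: "inj (\<lambda>j::'n. axis j (1::real))" by (auto simp: inj_on_def axis_eq_axis)
  have idx: "idx (axis j 1) = j" for j unfolding idx_def by (rule inv_f_f[OF inj])
  have B: "(Basis :: (real^'n) set) = range (\<lambda>j. axis j 1)" by (auto simp: Basis_vec_def)
  have "(\<integral>\<^sup>+s. (\<Prod>b\<in>Basis. h (idx b) (s \<bullet> b)) \<partial>(lborel :: (real^'n) measure)) = (\<Prod>b\<in>Basis. \<integral>\<^sup>+y. h (idx b) y \<partial>lborel)"
    using assms by (intro nn_integral_lborel_prod) auto
  then show ?thesis
    unfolding B prod.reindex[OF inj] by (simp add: idx inner_axis)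
qed

section \<open>Conservation of mass\<close>

context bessel_heat begin

lemma gamma_gt': "- 1 < \<gamma> $ j"
  using gamma_gt[of j] by linarith

lemma bessel_series_measurable [measurable]: "bessel_series (\<gamma> $ j) \<in> borel_measurable borel"
  unfolding bessel_series_def[abs_def] by measurable

lemma mass_exponent_pos: "0 < mass_exponent"
proof -
  have "mass_exponent = (\<Sum>k\<in>UNIV. 1 + \<gamma> $ k)" by (simp add: mass_exponent_def sum.distrib)
  also have "\<dots> > 0"
  proof (rule sum_pos)
    show "0 < 1 + \<gamma> $ k" for k using gamma_gt'[of k] by linarith
  qed auto
  finally show ?thesis .
qed

text \<open>The integrand is a product of functions of single coordinates, each evaluated by
  \<open>nn_integral_bessel_gauss\<close>. The factors exp (x_j^2 / (4 t)) obtained there cancel the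
  Gaussian in x, so the value does not depend on x.\<close>

lemma integral_weight_kernel:
  assumes t: "0 < t"
  shows "has_bochner_integral lborel (\<lambda>s. weight s * bessel_gauss x s t)
      (\<Prod>j\<in>UNIV. (4 * t) powr (\<gamma> $ j + 1) / 2)"
proof (rule has_bochner_integral_nn_integral)
  define h where "h = (\<lambda>j s. indicator {0<..} s * (s powr (2 * \<gamma> $ j + 1) * exp (- s\<^sup>2 / (4 * t)) *
      bessel_series (\<gamma> $ j) (x $ j * s / (2 * t))))"
  have [measurable]: "h j \<in> borel_measurable borel" for j unfolding h_def by measurable
  have h0: "0 \<le> h j s" for j s
    unfolding h_def by (intro mult_nonneg_nonneg bessel_series_nonneg gamma_gt') auto
  have eq: "weight s * bessel_gauss x s t = exp (- (norm x)\<^sup>2 / (4 * t)) * (\<Prod>j\<in>UNIV. h j (s $ j))" for s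
  proof -
    have "indicator pos_orthant s = (\<Prod>j\<in>UNIV. indicator {0<..} (s $ j) :: real)"
      by (auto simp: indicator_def pos_orthant_def prod_zero_iff not_less)
    moreover have "exp (- ((norm x)\<^sup>2 + (norm s)\<^sup>2) / (4 * t)) = exp (- (norm x)\<^sup>2 / (4 * t)) * (\<Prod>j\<in>UNIV. exp (- (s $ j)\<^sup>2 / (4 * t)))"
      unfolding exp_sum[OF finite, symmetric] exp_add[symmetric] power2_norm_eq_inner[of s] inner_vec_def
      by (simp add: sum_divide_distrib[symmetric] sum_negf power2_eq_square add_divide_distrib diff_divide_distrib)
    ultimately show ?thesis by (simp add: weight_def h_def prod.distrib mult_ac)
  qed
  show "(\<lambda>s. weight s * bessel_gauss x s t) \<in> borel_measurable lborel"
    unfolding eq by measurable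
  show "AE s in lborel. 0 \<le> weight s * bessel_gauss x s t"
    unfolding eq by (intro AE_I2 mult_nonneg_nonneg prod_nonneg ballI h0) auto
  have "(\<integral>\<^sup>+s. ennreal (weight s * bessel_gauss x s t) \<partial>lborel) =
      (\<integral>\<^sup>+s. ennreal (exp (- (norm x)\<^sup>2 / (4 * t))) * (\<Prod>j\<in>UNIV. ennreal (h j (s $ j))) \<partial>lborel)"
    unfolding eq by (simp add: ennreal_mult' prod_ennreal h0)
  also have "\<dots> = ennreal (exp (- (norm x)\<^sup>2 / (4 * t))) * (\<Prod>j\<in>UNIV. \<integral>\<^sup>+y. ennreal (h j y) \<partial>lborel)"
    by (subst nn_integral_cmult, measurable, subst nn_integral_lborel_vec_prod[of "\<lambda>j y. ennreal (h j y)"], measurable)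
  also have "(\<Prod>j\<in>UNIV. \<integral>\<^sup>+y. ennreal (h j y) \<partial>lborel) =
      (\<Prod>j\<in>UNIV. ennreal ((4 * t) powr (\<gamma> $ j + 1) / 2 * exp ((x $ j)\<^sup>2 / (4 * t))))"
    unfolding h_def by (intro prod.cong refl nn_integral_bessel_gauss gamma_gt' t)
  also have "\<dots> = ennreal (\<Prod>j\<in>UNIV. (4 * t) powr (\<gamma> $ j + 1) / 2 * exp ((x $ j)\<^sup>2 / (4 * t)))"
    by (rule prod_ennreal) auto
  also have "(\<Prod>j\<in>UNIV. (4 * t) powr (\<gamma> $ j + 1) / 2 * exp ((x $ j)\<^sup>2 / (4 * t))) =
      (\<Prod>j\<in>UNIV. (4 * t) powr (\<gamma> $ j + 1) / 2) * exp ((norm x)\<^sup>2 / (4 * t))"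
    unfolding prod.distrib exp_sum[OF finite, symmetric] power2_norm_eq_inner inner_vec_def
    by (simp add: sum_divide_distrib power2_eq_square)
  also have "ennreal (exp (- (norm x)\<^sup>2 / (4 * t))) * ennreal ((\<Prod>j\<in>UNIV. (4 * t) powr (\<gamma> $ j + 1) / 2) * exp ((norm x)\<^sup>2 / (4 * t))) =
      ennreal (\<Prod>j\<in>UNIV. (4 * t) powr (\<gamma> $ j + 1) / 2)"
    by (subst ennreal_mult'[symmetric]) (auto simp: exp_minus field_simps)
  finally show "(\<integral>\<^sup>+s. ennreal (weight s * bessel_gauss x s t) \<partial>lborel) = ennreal (\<Prod>j\<in>UNIV. (4 * t) powr (\<gamma> $ j + 1) / 2)" .
qed (intro prod_nonneg, auto)

lemma wadm_one: "wadm (\<lambda>_. 1)"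
  unfolding wadm_def
proof (intro conjI allI impI)
  fix e :: real assume e: "e > 0"
  define c where "c = (\<Prod>j\<in>UNIV. bessel_series (\<gamma> $ j) 0)"
  have "bessel_series (\<gamma> $ j) 0 > 0" for j
    using bessel_series_ge[OF gamma_gt', of j 0] Gamma_real_pos[of "\<gamma> $ j + 1"] gamma_gt'[of j]
    by (smt (verit) divide_pos_pos)
  then have "c > 0" unfolding c_def by (intro prod_pos) auto
  \<comment> \<open>The preceding integral at x = 0 and t = 1/(4 e): there the Bessel factors are
    the constant c, and the Gaussian is exp (- e |s|^2).\<close>
  have "integrable lborel (\<lambda>s. weight s * (exp (- ((norm (0::real^'n))\<^sup>2 + (norm s)\<^sup>2) / (4 * (1 / (4 * e)))) *
      (\<Prod>j\<in>UNIV. bessel_series (\<gamma> $ j) ((0::real^'n) $ j * s $ j / (2 * (1 / (4 * e)))))))"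
    using e by (intro has_bochner_integral_iff[THEN iffD1, THEN conjunct1, OF integral_weight_kernel]) auto
  then have "integrable lborel (\<lambda>s. weight s * exp (- e * (norm s)\<^sup>2) * c)"
    using e by (simp add: c_def mult_ac)
  then show "integrable lborel (\<lambda>s. 1 * weight s * exp (- e * (norm s)\<^sup>2))"
    using \<open>c > 0\<close> by (simp add: integrable_mult_left_iff)
qed simp

lemma heat_ext_one:
  assumes t: "0 < t"
  shows "heat_ext (\<lambda>_. 1) x t = 1"
proof -
  have "heat_ext (\<lambda>_. 1) x t = mass_const * t powr (- mass_exponent) * (\<Prod>j\<in>UNIV. (4 * t) powr (\<gamma> $ j + 1) / 2)"
    unfolding heat_ext_eq[OF wadm_one t]
    using has_bochner_integral_integral_eq[OF integral_weight_kernel[OF t, of x]] by simp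
  also have "(\<Prod>j\<in>UNIV. (4 * t) powr (\<gamma> $ j + 1) / 2) = (\<Prod>j\<in>UNIV. 4 powr (\<gamma> $ j) * 2 * t powr (1 + \<gamma> $ j))"
    using t by (intro prod.cong refl) (simp add: powr_mult powr_add add_ac)
  also have "\<dots> = (\<Prod>j\<in>UNIV. 4 powr (\<gamma> $ j)) * 2 ^ CARD('n) * t powr mass_exponent"
    using t by (simp add: prod.distrib mass_exponent_def powr_sum[symmetric] sum.distrib)
  finally have "heat_ext (\<lambda>_. 1) x t = ((1 / 2) ^ CARD('n) * 2 ^ CARD('n)) *
      ((\<Prod>j\<in>UNIV. 4 powr (- \<gamma> $ j)) * (\<Prod>j\<in>UNIV. 4 powr (\<gamma> $ j))) * (t powr (- mass_exponent) * t powr mass_exponent)"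
    unfolding mass_const_def by (simp only: mult_ac)
  moreover have "(1 / 2) ^ CARD('n) * 2 ^ CARD('n) = (1::real)"
    by (simp add: power_mult_distrib[symmetric])
  moreover have "(\<Prod>j\<in>UNIV. 4 powr (- \<gamma> $ j)) * (\<Prod>j\<in>UNIV. 4 powr (\<gamma> $ j)) = 1"
    by (simp add: prod.distrib[symmetric] powr_add[symmetric])
  moreover have "t powr (- mass_exponent) * t powr mass_exponent = 1"
    using t by (simp add: powr_add[symmetric])
  ultimately show ?thesis by simp
qed

lemma wadm_add: "wadm f \<Longrightarrow> wadm g \<Longrightarrow> wadm (\<lambda>s. f s + g s)"
  unfolding wadm_def by (auto simp: distrib_right)

lemma wadm_cmult: "wadm f \<Longrightarrow> wadm (\<lambda>s. c * f s)"
  unfolding wadm_def mult.assoc by (auto intro: integrable_mult_right)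

lemma wadm_bound:
  assumes f: "wadm f" and m: "(\<lambda>s. g s * weight s) \<in> borel_measurable borel"
    and le: "\<And>s. s \<in> pos_orthant \<Longrightarrow> \<bar>g s\<bar> \<le> \<bar>f s\<bar>"
  shows "wadm g"
  unfolding wadm_def
proof (intro conjI allI impI m)
  fix e :: real assume "e > 0"
  then have "integrable lborel (\<lambda>s. f s * weight s * exp (- e * (norm s)\<^sup>2))" using f by (simp add: wadm_def)
  then show "integrable lborel (\<lambda>s. g s * weight s * exp (- e * (norm s)\<^sup>2))"
  proof (rule Bochner_Integration.integrable_bound)
    show "(\<lambda>s. g s * weight s * exp (- e * (norm s)\<^sup>2)) \<in> borel_measurable lborel" using m by measurable
    have "\<bar>g s\<bar> * weight s \<le> \<bar>f s\<bar> * weight s" for s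
      using le[of s] weight_nonneg[of s]
      by (cases "s \<in> pos_orthant") (auto intro: mult_right_mono simp: weight_def)
    then have "\<bar>g s\<bar> * weight s * exp (- e * (norm s)\<^sup>2) \<le> \<bar>f s\<bar> * weight s * exp (- e * (norm s)\<^sup>2)" for s
      by (rule mult_right_mono) simp
    then show "AE s in lborel. norm (g s * weight s * exp (- e * (norm s)\<^sup>2)) \<le> norm (f s * weight s * exp (- e * (norm s)\<^sup>2))"
      using weight_nonneg by (simp add: abs_mult)
  qed
qed

lemma wadm_abs: "wadm f \<Longrightarrow> wadm (\<lambda>s. \<bar>f s\<bar>)"
proof (rule wadm_bound)
  assume "wadm f"
  then have "(\<lambda>s. f s * weight s) \<in> borel_measurable borel" by (simp add: wadm_def)
  then have "(\<lambda>s. \<bar>f s * weight s\<bar>) \<in> borel_measurable borel" by (rule borel_measurable_abs)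
  then show "(\<lambda>s. \<bar>f s\<bar> * weight s) \<in> borel_measurable borel"
    by (simp add: abs_mult weight_nonneg)
qed auto

lemma wadm_indicator:
  assumes "wadm f" "A \<in> sets borel"
  shows "wadm (\<lambda>s. indicator A s * f s)"
proof (rule wadm_bound[OF assms(1)])
  have "(\<lambda>s. f s * weight s) \<in> borel_measurable borel" using assms(1) by (simp add: wadm_def)
  then show "(\<lambda>s. indicator A s * f s * weight s) \<in> borel_measurable borel"
    unfolding mult.assoc using assms(2) by measurable
qed (auto simp: indicator_def)

section \<open>Time derivatives of the kernel and of the extension\<close>

lemma wext_abs: "wext (\<lambda>s. \<bar>f s\<bar>) = (\<lambda>w. \<bar>wext f w\<bar>)"
  by (simp add: abs_mult weight_nonneg)

text \<open>With z = y/(4 t) one has dz/dt = -z/t, so differentiating t^(-N-r) p(z) exp(-z), with N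
  = \<open>mass_exponent\<close>, gives t^(-N-r-1) (z p - z p' - (N + r) p) exp(-z). The recursion
  records this polynomial.\<close>

primrec dpoly :: "nat \<Rightarrow> real poly" where
  "dpoly 0 = 1"
| "dpoly (Suc r) = [:0, 1:] * dpoly r - [:0, 1:] * pderiv (dpoly r) - smult (mass_exponent + real r) (dpoly r)"

definition kernel_deriv :: "nat \<Rightarrow> real \<Rightarrow> real \<Rightarrow> real" where
  "kernel_deriv r y t = t powr (- mass_exponent - real r) * (poly (dpoly r) (y / (4 * t)) * exp (- y / (4 * t)))"

lemma kernel_deriv_has_derivative:
  assumes "0 < t"
  shows "(kernel_deriv r y has_real_derivative kernel_deriv (Suc r) y t) (at t)"
proof -
  have e: "- mass_exponent - real (Suc r) = - mass_exponent - real r - 1" by simp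
  have p: "t powr (- mass_exponent - real r) = t powr (- mass_exponent - real r - 1) * t"
    using assms powr_diff[of t "- mass_exponent - real r" 1] by simp
  show ?thesis
    unfolding kernel_deriv_def[abs_def] e
    by (rule derivative_eq_intros refl | (use assms in simp; fail))+
       (use assms p in \<open>simp add: power2_eq_square divide_simps\<close>, simp add: algebra_simps)
qed

text \<open>Half of the exponent absorbs the polynomial, and the other half is the kernel at time 2
  t. The derivative is thus controlled by a positive kernel whose mass is known, at the price
  t^(-r).\<close>

lemma kernel_deriv_bound:
  "\<exists>C\<ge>0. \<forall>y\<ge>0. \<forall>t>0. \<bar>kernel_deriv r y t\<bar> \<le> C * t powr (- real r) * ((2 * t) powr (- mass_exponent) * exp (- y / (8 * t)))"
proof -
  obtain C where C: "C \<ge> 0" "\<And>y. y \<ge> 0 \<Longrightarrow> \<bar>poly (dpoly r) y\<bar> \<le> C * exp (1 / 2 * y)"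
    using poly_exp_bound[of "1/2" "dpoly r"] by auto
  have "\<bar>kernel_deriv r y t\<bar> \<le> (C * 2 powr mass_exponent) * t powr (- real r) * ((2 * t) powr (- mass_exponent) * exp (- y / (8 * t)))"
    if "y \<ge> 0" "t > 0" for y t
  proof -
    have "\<bar>kernel_deriv r y t\<bar> = t powr (- mass_exponent - real r) * (\<bar>poly (dpoly r) (y / (4 * t))\<bar> * exp (- y / (4 * t)))"
      by (simp add: kernel_deriv_def abs_mult)
    also have "\<dots> \<le> t powr (- mass_exponent - real r) * (C * exp (1 / 2 * (y / (4 * t))) * exp (- y / (4 * t)))"
      using that by (intro mult_left_mono mult_right_mono C) auto
    also have "C * exp (1 / 2 * (y / (4 * t))) * exp (- y / (4 * t)) = C * exp (1 / 2 * (y / (4 * t)) + - y / (4 * t))"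
      by (simp only: exp_add mult.assoc)
    also have "1 / 2 * (y / (4 * t)) + - y / (4 * t) = - y / (8 * t)" by (simp add: field_simps)
    also have "t powr (- mass_exponent - real r) = 2 powr mass_exponent * t powr (- real r) * (2 * t) powr (- mass_exponent)"
    proof -
      have "- mass_exponent - real r = - mass_exponent + - real r" by simp
      then have "t powr (- mass_exponent - real r) = t powr (- mass_exponent) * t powr (- real r)"
        by (simp only: powr_add)
      moreover have "(2 * t) powr (- mass_exponent) = 2 powr (- mass_exponent) * t powr (- mass_exponent)"
        by (rule powr_mult)
      moreover have "2 powr mass_exponent * 2 powr (- mass_exponent) = (1::real)"
        by (simp add: powr_add[symmetric])
      ultimately show ?thesis by (simp add: mult_ac)
    qed
    finally show ?thesis by (simp only: mult_ac)
  qed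
  then show ?thesis using C(1) by (intro exI[of _ "C * 2 powr mass_exponent"]) auto
qed

lemma kernel_deriv_measurable [measurable]: "(\<lambda>w. kernel_deriv r (S.R x w) t) \<in> borel_measurable (lborel \<Otimes>\<^sub>M Theta)"
proof -
  have [measurable]: "poly p \<in> borel_measurable borel" for p :: "real poly"
    by (intro borel_measurable_continuous_onI continuous_intros)
  show ?thesis unfolding kernel_deriv_def by measurable
qed

text \<open>The extension with its kernel replaced by the r-th time derivative of the kernel.
  Defined by an integral, it satisfies bounds and linearity directly;
  \<open>heat_td_has_derivative\<close> identifies it with the actual derivative.\<close>

definition heat_td :: "(real^'n \<Rightarrow> real) \<Rightarrow> nat \<Rightarrow> real^'n \<Rightarrow> real \<Rightarrow> real" where
  "heat_td f r x t = mass_const * (\<integral>w. wext f w * kernel_deriv r (S.R x w) t \<partial>(lborel \<Otimes>\<^sub>M Theta))"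

lemma heat_ext_conv_td: "heat_ext f x t = heat_td f 0 x t"
proof -
  have "(\<integral>w. wext f w * kernel_deriv 0 (S.R x w) t \<partial>(lborel \<Otimes>\<^sub>M Theta)) =
      (\<integral>w. t powr (- mass_exponent) * (wext f w * exp (- S.R x w / (4 * t))) \<partial>(lborel \<Otimes>\<^sub>M Theta))"
    by (simp add: kernel_deriv_def mult_ac)
  then show ?thesis unfolding heat_ext_def heat_td_def S.Phi_def integral_mult_right_zero by simp
qed

lemma heat_td_integrable:
  assumes "wadm f" "0 < t"
  shows "integrable (lborel \<Otimes>\<^sub>M Theta) (\<lambda>w. wext f w * kernel_deriv r (S.R x w) t)"
proof -
  obtain C where C: "C \<ge> 0" "\<And>y t. y \<ge> 0 \<Longrightarrow> t > 0 \<Longrightarrow>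
      \<bar>kernel_deriv r y t\<bar> \<le> C * t powr (- real r) * ((2 * t) powr (- mass_exponent) * exp (- y / (8 * t)))"
    using kernel_deriv_bound[of r] by blast
  define K where "K = C * t powr (- real r) * (2 * t) powr (- mass_exponent)"
  have "integrable (lborel \<Otimes>\<^sub>M Theta) (\<lambda>w. K * (wext f w * exp (- S.R x w / (4 * (2 * t)))))"
    using assms by (intro integrable_mult_right S.integrable_adm wext_adm) auto
  then show ?thesis
  proof (rule Bochner_Integration.integrable_bound)
    show "(\<lambda>w. wext f w * kernel_deriv r (S.R x w) t) \<in> borel_measurable (lborel \<Otimes>\<^sub>M Theta)"
      using S.adm_measurable[OF wext_adm[OF assms(1)]] by measurable
    have "\<bar>wext f w\<bar> * \<bar>kernel_deriv r (S.R x w) t\<bar> \<le> \<bar>wext f w\<bar> * (C * t powr (- real r) * ((2 * t) powr (- mass_exponent) * exp (- S.R x w / (8 * t))))" for w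
      using assms(2) by (intro mult_left_mono C S.R_nonneg) auto
    then show "AE w in lborel \<Otimes>\<^sub>M Theta. norm (wext f w * kernel_deriv r (S.R x w) t)
        \<le> norm (K * (wext f w * exp (- S.R x w / (4 * (2 * t)))))"
      using C(1) by (auto simp: K_def abs_mult mult_ac)
  qed
qed

lemma heat_td_has_derivative:
  assumes f: "wadm f" and t: "0 < t"
  shows "((\<lambda>t. heat_td f r x t) has_real_derivative heat_td f (Suc r) x t) (at t)"
proof -
  obtain C where C: "C \<ge> 0" "\<And>y t. y \<ge> 0 \<Longrightarrow> t > 0 \<Longrightarrow>
      \<bar>kernel_deriv (Suc r) y t\<bar> \<le> C * t powr (- real (Suc r)) * ((2 * t) powr (- mass_exponent) * exp (- y / (8 * t)))"
    using kernel_deriv_bound[of "Suc r"] by blast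
  define K where "K = C * (t / 2) powr (- real (Suc r)) * t powr (- mass_exponent)"
  have "((\<lambda>t. \<integral>w. wext f w * kernel_deriv r (S.R x w) t \<partial>(lborel \<Otimes>\<^sub>M Theta)) has_real_derivative
      (\<integral>w. wext f w * kernel_deriv (Suc r) (S.R x w) t \<partial>(lborel \<Otimes>\<^sub>M Theta))) (at t)"
  proof (rule has_real_derivative_integral_dominated
      [where d="t / 2" and F="\<lambda>t w. wext f w * kernel_deriv r (S.R x w) t" and B="\<lambda>w. K * (\<bar>wext f w\<bar> * exp (- S.R x w / (4 * (3 * t))))"
        and F'="\<lambda>t w. wext f w * kernel_deriv (Suc r) (S.R x w) t"])
    fix h assume h: "\<bar>h - t\<bar> < t / 2"
    \<comment> \<open>From h < 3 t / 2 follows 8 h \<le> 4 (3 t), which is why the majorant is the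
      Gaussian at time 3 t.\<close>
    then have h0: "h > 0" "t / 2 \<le> h" "8 * h \<le> 4 * (3 * t)" "t \<le> 2 * h" using t by linarith+
    show "integrable (lborel \<Otimes>\<^sub>M Theta) (\<lambda>w. wext f w * kernel_deriv r (S.R x w) h)"
      by (rule heat_td_integrable[OF f h0(1)])
    show "((\<lambda>h. wext f w * kernel_deriv r (S.R x w) h) has_real_derivative wext f w * kernel_deriv (Suc r) (S.R x w) h) (at h)" for w
      by (intro DERIV_cmult kernel_deriv_has_derivative h0)
    show "\<bar>wext f w * kernel_deriv (Suc r) (S.R x w) h\<bar> \<le> K * (\<bar>wext f w\<bar> * exp (- S.R x w / (4 * (3 * t))))" for w
    proof -
      have "S.R x w / (4 * (3 * t)) \<le> S.R x w / (8 * h)"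
        using h0 S.R_nonneg[of x w] t by (intro divide_left_mono) auto
      then have e: "exp (- S.R x w / (8 * h)) \<le> exp (- S.R x w / (4 * (3 * t)))" by simp
      have "\<bar>wext f w * kernel_deriv (Suc r) (S.R x w) h\<bar> \<le> \<bar>wext f w\<bar> *
          (C * h powr (- real (Suc r)) * ((2 * h) powr (- mass_exponent) * exp (- S.R x w / (8 * h))))"
        unfolding abs_mult using h0 by (intro mult_left_mono C S.R_nonneg) auto
      also have "\<dots> \<le> \<bar>wext f w\<bar> * (C * (t / 2) powr (- real (Suc r)) * (t powr (- mass_exponent) * exp (- S.R x w / (4 * (3 * t)))))"
        using h0 t C(1) mass_exponent_pos e
        by (intro mult_left_mono mult_mono powr_mono2') auto
      finally show ?thesis by (simp add: K_def mult_ac)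
    qed
  next
    have "integrable (lborel \<Otimes>\<^sub>M Theta) (\<lambda>w. \<bar>wext f w\<bar> * exp (- S.R x w / (4 * (3 * t))))"
      using t by (intro S.integrable_adm S.adm_abs wext_adm f) auto
    then show "integrable (lborel \<Otimes>\<^sub>M Theta) (\<lambda>w. K * (\<bar>wext f w\<bar> * exp (- S.R x w / (4 * (3 * t)))))"
      by (rule integrable_mult_right)
    show "(\<lambda>w. wext f w * kernel_deriv (Suc r) (S.R x w) t) \<in> borel_measurable (lborel \<Otimes>\<^sub>M Theta)"
      using S.adm_measurable[OF wext_adm[OF f]] by measurable
  qed (use t in auto)
  then show ?thesis unfolding heat_td_def by (rule DERIV_cmult)
qed

text \<open>The constant is chosen before f, x and t: the limit t to 0 is taken later with this
  constant fixed, also for data from which a constant has been subtracted.\<close>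

lemma heat_td_bound:
  "\<exists>C\<ge>0. \<forall>f x t. wadm f \<longrightarrow> 0 < t \<longrightarrow> \<bar>heat_td f r x t\<bar> \<le> C * t powr (- real r) * heat_ext (\<lambda>s. \<bar>f s\<bar>) x (2 * t)"
proof -
  obtain C where C: "C \<ge> 0" "\<And>y t. y \<ge> 0 \<Longrightarrow> t > 0 \<Longrightarrow>
      \<bar>kernel_deriv r y t\<bar> \<le> C * t powr (- real r) * ((2 * t) powr (- mass_exponent) * exp (- y / (8 * t)))"
    using kernel_deriv_bound[of r] by blast
  have "\<bar>heat_td f r x t\<bar> \<le> C * t powr (- real r) * heat_ext (\<lambda>s. \<bar>f s\<bar>) x (2 * t)" if f: "wadm f" and t: "0 < t" for f x t
  proof -
    have "\<bar>\<integral>w. wext f w * kernel_deriv r (S.R x w) t \<partial>(lborel \<Otimes>\<^sub>M Theta)\<bar> \<le>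
       (\<integral>w. C * t powr (- real r) * (2 * t) powr (- mass_exponent) * (\<bar>wext f w\<bar> * exp (- S.R x w / (4 * (2 * t)))) \<partial>(lborel \<Otimes>\<^sub>M Theta))"
    proof (rule order_trans[OF integral_abs_bound integral_mono[OF integrable_abs[OF heat_td_integrable[OF f t]]]])
      show "integrable (lborel \<Otimes>\<^sub>M Theta) (\<lambda>w. C * t powr (- real r) * (2 * t) powr (- mass_exponent) * (\<bar>wext f w\<bar> * exp (- S.R x w / (4 * (2 * t)))))"
        using t by (intro integrable_mult_right S.integrable_adm S.adm_abs wext_adm f) auto
      show "\<bar>wext f w * kernel_deriv r (S.R x w) t\<bar> \<le> C * t powr (- real r) * (2 * t) powr (- mass_exponent) * (\<bar>wext f w\<bar> * exp (- S.R x w / (4 * (2 * t))))" for w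
        using mult_left_mono[OF C(2)[OF S.R_nonneg[of x w] t], of "\<bar>wext f w\<bar>"] by (simp add: abs_mult mult_ac)
    qed
    then have "mass_const * \<bar>\<integral>w. wext f w * kernel_deriv r (S.R x w) t \<partial>(lborel \<Otimes>\<^sub>M Theta)\<bar> \<le>
       mass_const * (\<integral>w. C * t powr (- real r) * (2 * t) powr (- mass_exponent) * (\<bar>wext f w\<bar> * exp (- S.R x w / (4 * (2 * t)))) \<partial>(lborel \<Otimes>\<^sub>M Theta))"
      using mass_const_pos by (intro mult_left_mono) auto
    then show ?thesis
      unfolding heat_td_def heat_ext_def S.Phi_def wext_abs integral_mult_right_zero
      using mass_const_pos by (simp only: abs_mult abs_of_pos mult_ac)
  qed
  then show ?thesis using C(1) by blast
qed

lemma heat_td_add: "wadm f \<Longrightarrow> wadm g \<Longrightarrow> 0 < t \<Longrightarrow> heat_td (\<lambda>s. f s + g s) r x t = heat_td f r x t + heat_td g r x t"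
  unfolding heat_td_def distrib_right
  by (subst Bochner_Integration.integral_add) (auto intro: heat_td_integrable simp: distrib_left)

lemma heat_td_cmult: "heat_td (\<lambda>s. c * f s) r x t = c * heat_td f r x t"
proof -
  have "(\<lambda>w. wext (\<lambda>s. c * f s) w * kernel_deriv r (S.R x w) t) = (\<lambda>w. c * (wext f w * kernel_deriv r (S.R x w) t))"
    by (simp add: mult_ac)
  then show ?thesis unfolding heat_td_def by (simp only: integral_mult_right_zero mult_ac)
qed

lemma heat_td_one: "0 < t \<Longrightarrow> heat_td (\<lambda>_. 1) r x t = (if r = 0 then 1 else 0)"
proof (induction r arbitrary: t)
  case 0
  then show ?case using heat_ext_one[of t x] by (simp add: heat_ext_conv_td)
next
  case (Suc r)
  have "((\<lambda>t. if r = 0 then 1 else 0 :: real) has_real_derivative heat_td (\<lambda>_. 1) (Suc r) x t) (at t)"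
    using heat_td_has_derivative[OF wadm_one Suc.prems, of r x]
  proof (rule DERIV_cong_ev[OF refl _ refl, THEN iffD1, rotated])
    show "\<forall>\<^sub>F t in nhds t. heat_td (\<lambda>_. 1) r x t = (if r = 0 then 1 else 0)"
      using eventually_nhds_in_open[of "{0<..}" t] Suc by (auto elim: eventually_mono)
  qed
  then have "heat_td (\<lambda>_. 1) (Suc r) x t = 0" by (rule DERIV_unique) (auto intro!: derivative_eq_intros)
  then show ?case by simp
qed

lemma heat_ext_mono:
  assumes "wadm f" "wadm g" "0 < t" "\<And>s. s \<in> pos_orthant \<Longrightarrow> f s \<le> g s"
  shows "heat_ext f x t \<le> heat_ext g x t"
proof -
  have le: "f s * weight s \<le> g s * weight s" for s
    using assms(4)[of s] weight_nonneg[of s]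
    by (cases "s \<in> pos_orthant") (auto intro: mult_right_mono simp: weight_def)
  have "S.Phi (wext f) x t \<le> S.Phi (wext g) x t"
    unfolding S.Phi_def
    by (intro integral_mono S.integrable_adm wext_adm assms(1,2,3), rule mult_right_mono[OF le], simp)
  then show ?thesis unfolding heat_ext_def using mass_const_pos
    by (intro mult_left_mono) auto
qed

section \<open>Limits as (y, t) tends jointly to (x, 0)\<close>

abbreviation initially :: "real^'n \<Rightarrow> ((real^'n) \<times> real) filter" where
  "initially x \<equiv> at (x, 0) within pos_orthant \<times> {0<..}"

lemma eventually_initially:
  assumes "d > 0"
  shows "eventually (\<lambda>(y, t). y \<in> pos_orthant \<and> dist y x < d \<and> 0 < t \<and> t < d) (initially x)"
proof -
  have "eventually (\<lambda>z. z \<in> ball x d \<times> ball 0 d) (nhds (x, 0 :: real))"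
    using assms by (intro eventually_nhds_in_open open_Times) auto
  then show ?thesis unfolding eventually_at_filter
    by eventually_elim (auto simp: dist_commute)
qed

text \<open>On the orthant all products y_j s_j are positive, so replacing each sine by 1 only
  lowers the exponent, down to that of the ordinary Gaussian. This gives the off-diagonal
  decay.\<close>

lemma kernel_exponent_ge:
  assumes "y \<in> pos_orthant" "s \<in> pos_orthant"
  shows "(norm (y - s))\<^sup>2 \<le> kernel_exponent y s \<theta>"
proof -
  have "y \<bullet> s = (\<Sum>j\<in>UNIV. y $ j * s $ j)" by (simp add: inner_vec_def)
  moreover have "y $ j * s $ j * sin (\<theta> j) \<le> y $ j * s $ j" for j
    using pos_orthantD[OF assms(1), of j] pos_orthantD[OF assms(2), of j]
    by (intro mult_left_le) (auto simp: less_imp_le)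
  ultimately have "y \<bullet> scaled_sin s \<theta> \<le> y \<bullet> s"
    unfolding inner_scaled_sin by (simp only: sum_mono)
  then show ?thesis
    by (simp add: kernel_exponent_def power2_norm_eq_inner inner_diff inner_commute)
qed

text \<open>For y near x and s in the support, |y - s| \<ge> d/2. Half of the exponent then yields
  exp (- d^2 / (32 t)), which beats every power of t; the other half is kept, with t replaced by 1,
  for integrability in s.\<close>

lemma heat_ext_off_diagonal:
  assumes f: "wadm f" and d: "d > 0" and off: "\<And>s. s \<in> ball x d \<Longrightarrow> f s = 0"
  shows "((\<lambda>(y, t). t powr (- a) * heat_ext (\<lambda>s. \<bar>f s\<bar>) y t) \<longlongrightarrow> 0) (initially x)"
proof -
  define L where "L = (\<integral>w. \<bar>wext f w\<bar> * exp (- (1 / 16) * (norm (fst w))\<^sup>2) \<partial>(lborel \<Otimes>\<^sub>M Theta))"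
  define K where "K = exp ((norm x + d)\<^sup>2 / 8) * L"
  have intL: "integrable (lborel \<Otimes>\<^sub>M Theta) (\<lambda>w. \<bar>wext f w\<bar> * exp (- (1 / 16) * (norm (fst w))\<^sup>2))"
    by (intro S.adm_integrable S.adm_abs wext_adm f) auto
  have "L \<ge> 0" unfolding L_def by (intro Bochner_Integration.integral_nonneg) auto
  then have "K \<ge> 0" by (simp add: K_def)
  have Phi: "S.Phi (\<lambda>w. \<bar>wext f w\<bar>) y t \<le> K * exp (- (d\<^sup>2 / 32 / t))"
    if y: "y \<in> pos_orthant" "dist y x < d / 2" and t: "0 < t" "t < 1" for y t
  proof -
    have "S.Phi (\<lambda>w. \<bar>wext f w\<bar>) y t \<le>
      (\<integral>w. exp (- (d\<^sup>2 / 32 / t)) * exp ((norm x + d)\<^sup>2 / 8) * (\<bar>wext f w\<bar> * exp (- (1 / 16) * (norm (fst w))\<^sup>2)) \<partial>(lborel \<Otimes>\<^sub>M Theta))"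
      unfolding S.Phi_def
    proof (rule integral_mono)
      show "integrable (lborel \<Otimes>\<^sub>M Theta) (\<lambda>w. \<bar>wext f w\<bar> * exp (- S.R y w / (4 * t)))"
        using t by (intro S.integrable_adm S.adm_abs wext_adm f)
      show "integrable (lborel \<Otimes>\<^sub>M Theta) (\<lambda>w. exp (- (d\<^sup>2 / 32 / t)) * exp ((norm x + d)\<^sup>2 / 8) * (\<bar>wext f w\<bar> * exp (- (1 / 16) * (norm (fst w))\<^sup>2)))"
        by (intro integrable_mult_right intL)
      fix w :: "(real^'n) \<times> ('n \<Rightarrow> real)"
      show "\<bar>wext f w\<bar> * exp (- S.R y w / (4 * t)) \<le>
        exp (- (d\<^sup>2 / 32 / t)) * exp ((norm x + d)\<^sup>2 / 8) * (\<bar>wext f w\<bar> * exp (- (1 / 16) * (norm (fst w))\<^sup>2))"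
      proof (cases "wext f w = 0")
        case False
        define s where "s = fst w"
        have s: "s \<in> pos_orthant" "s \<notin> ball x d" using False off by (auto simp: s_def weight_def indicator_def split: if_splits)
        have "d / 2 \<le> norm (y - s)"
          using s(2) y(2) norm_triangle_ineq4[of "y - s" "y - x"] by (simp add: dist_norm norm_minus_commute)
        then have 1: "d\<^sup>2 / 4 \<le> (norm (y - s))\<^sup>2" using d power_mono[of "d / 2" "norm (y - s)" 2] by (simp add: power_divide)
        have ny: "norm y \<le> norm x + d" using y(2) d norm_triangle_ineq2[of y x] by (simp add: dist_norm)
        \<comment> \<open>Gives |s|^2 / 2 - |y|^2 \<le> |y - s|^2, so decay in |y - s| becomes decay
          in |s| at rate 1/16 after division by 8.\<close>
        have "0 \<le> (norm (2 *\<^sub>R y - s))\<^sup>2" by simp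
        then have "(norm s)\<^sup>2 / 2 - (norm y)\<^sup>2 \<le> (norm (y - s))\<^sup>2"
          by (simp add: power2_norm_eq_inner inner_diff inner_commute algebra_simps)
        moreover have "(norm y)\<^sup>2 \<le> (norm x + d)\<^sup>2" using ny by (intro power_mono) auto
        ultimately have 2: "(norm s)\<^sup>2 / 2 - (norm x + d)\<^sup>2 \<le> (norm (y - s))\<^sup>2" by linarith
        have "(norm (y - s))\<^sup>2 \<le> S.R y w"
          using kernel_exponent_ge[OF y(1) s(1)] by (simp add: S_R s_def)
        then have "(norm (y - s))\<^sup>2 / (4 * t) \<le> S.R y w / (4 * t)" using t by (intro divide_right_mono) auto
        moreover have "d\<^sup>2 / 32 / t \<le> (norm (y - s))\<^sup>2 / (8 * t)" using 1 t by (simp add: field_simps)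
        moreover have "(norm (y - s))\<^sup>2 / 8 \<le> (norm (y - s))\<^sup>2 / (8 * t)" using t by (simp add: divide_simps mult_left_le)
        moreover have "(norm (y - s))\<^sup>2 / (4 * t) = (norm (y - s))\<^sup>2 / (8 * t) + (norm (y - s))\<^sup>2 / (8 * t)"
          by (simp add: field_simps)
        ultimately have "- S.R y w / (4 * t) \<le> - (d\<^sup>2 / 32 / t) + ((norm x + d)\<^sup>2 / 8 + - (1 / 16) * (norm s)\<^sup>2)"
          using 2 by linarith
        then have "exp (- S.R y w / (4 * t)) \<le> exp (- (d\<^sup>2 / 32 / t)) * (exp ((norm x + d)\<^sup>2 / 8) * exp (- (1 / 16) * (norm s)\<^sup>2))"
          by (simp only: exp_add[symmetric] exp_le_cancel_iff)
        from mult_left_mono[OF this, of "\<bar>wext f w\<bar>"] show ?thesis by (simp add: s_def mult_ac)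
      next
        case True
        then have "\<bar>wext f w\<bar> = 0" by (simp only: abs_zero)
        then show ?thesis by (simp only: mult_zero_left mult_zero_right)
      qed
    qed
    also have "\<dots> = K * exp (- (d\<^sup>2 / 32 / t))"
      unfolding integral_mult_right_zero K_def L_def by (simp only: mult_ac)
    finally show ?thesis .
  qed
  obtain C where C: "C \<ge> 0" "\<And>t. t \<in> {0<..1} \<Longrightarrow> t powr (- (a + mass_exponent)) * exp (- (d\<^sup>2 / 32 / t)) \<le> C * t"
    using powr_mult_exp_inverse_le[of "d\<^sup>2 / 32" "a + mass_exponent"] d by auto
  have dd: "0 < min 1 (d / 2)" using d by simp
  show ?thesis
  proof (rule Lim_null_comparison)
    show "eventually (\<lambda>z. norm (case z of (y, t) \<Rightarrow> t powr (- a) * heat_ext (\<lambda>s. \<bar>f s\<bar>) y t) \<le> mass_const * K * (C * snd z)) (initially x)"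
      using eventually_initially[of "min 1 (d / 2)" x, OF dd]
    proof (eventually_elim, safe, goal_cases)
      case (1 y t)
      then have y: "y \<in> pos_orthant" "dist y x < d / 2" "0 < t" "t < 1" by auto
      have P0: "0 \<le> S.Phi (\<lambda>w. \<bar>wext f w\<bar>) y t" unfolding S.Phi_def by (intro Bochner_Integration.integral_nonneg) auto
      have "norm (t powr (- a) * heat_ext (\<lambda>s. \<bar>f s\<bar>) y t) = t powr (- a) * (mass_const * (t powr (- mass_exponent) * S.Phi (\<lambda>w. \<bar>wext f w\<bar>) y t))"
        using P0 mass_const_pos by (simp add: heat_ext_def abs_mult weight_nonneg)
      also have "\<dots> \<le> t powr (- a) * (mass_const * (t powr (- mass_exponent) * (K * exp (- (d\<^sup>2 / 32 / t)))))"
        using Phi[OF y] mass_const_pos by (intro mult_left_mono) auto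
      also have "\<dots> = mass_const * K * (t powr (- (a + mass_exponent)) * exp (- (d\<^sup>2 / 32 / t)))"
        using powr_add[of t "- a" "- mass_exponent"] by (simp add: mult_ac)
      also have "\<dots> \<le> mass_const * K * (C * t)"
        using C(2)[of t] y mass_const_pos \<open>K \<ge> 0\<close> by (intro mult_left_mono) auto
      finally show ?case by simp
    qed
    have "((\<lambda>z. mass_const * K * (C * snd z)) \<longlongrightarrow> mass_const * K * (C * snd (x, 0::real))) (initially x)"
      by (intro tendsto_intros)
    then show "((\<lambda>z. mass_const * K * (C * snd z)) \<longlongrightarrow> 0) (initially x)" by simp
  qed
qed

lemma filterlim_initially_double: "filterlim (\<lambda>(y, t). (y, 2 * t)) (initially x) (initially x)"
  unfolding filterlim_at
proof (intro conjI)
  show "eventually (\<lambda>z. (case z of (y, t) \<Rightarrow> (y, 2 * t)) \<in> pos_orthant \<times> {0<..} \<and> (case z of (y, t) \<Rightarrow> (y, 2 * t)) \<noteq> (x, 0)) (initially x)"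
    using eventually_initially[OF zero_less_one, of x] by eventually_elim auto
  have "((\<lambda>z. (fst z, 2 * snd z)) \<longlongrightarrow> (fst (x, 0::real), 2 * snd (x, 0::real))) (initially x)"
    by (intro tendsto_intros)
  then show "((\<lambda>(y, t). (y, 2 * t)) \<longlongrightarrow> (x, 0)) (initially x)" by (simp add: case_prod_unfold)
qed

lemma heat_td_off_diagonal:
  assumes f: "wadm f" and d: "d > 0" and off: "\<And>s. s \<in> ball x d \<Longrightarrow> f s = 0"
  shows "((\<lambda>(y, t). heat_td f r y t) \<longlongrightarrow> 0) (initially x)"
proof -
  obtain C where C: "C \<ge> 0" "\<And>f x t. wadm f \<Longrightarrow> 0 < t \<Longrightarrow> \<bar>heat_td f r x t\<bar> \<le> C * t powr (- real r) * heat_ext (\<lambda>s. \<bar>f s\<bar>) x (2 * t)"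
    using heat_td_bound[of r] by blast
  have "((\<lambda>(y, t). t powr (- real r) * heat_ext (\<lambda>s. \<bar>f s\<bar>) y t) \<longlongrightarrow> 0) (initially x)"
    by (rule heat_ext_off_diagonal[OF f d off])
  from filterlim_compose[OF this filterlim_initially_double]
  have lim: "((\<lambda>(y, t). (2 * t) powr (- real r) * heat_ext (\<lambda>s. \<bar>f s\<bar>) y (2 * t)) \<longlongrightarrow> 0) (initially x)"
    by (simp add: case_prod_unfold)
  show ?thesis
  proof (rule Lim_null_comparison)
    show "((\<lambda>z. C * 2 powr (real r) * (case z of (y, t) \<Rightarrow> (2 * t) powr (- real r) * heat_ext (\<lambda>s. \<bar>f s\<bar>) y (2 * t))) \<longlongrightarrow> 0) (initially x)"
      using tendsto_mult_right_zero[OF lim] by simp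
    show "eventually (\<lambda>z. norm (case z of (y, t) \<Rightarrow> heat_td f r y t) \<le> C * 2 powr (real r) * (case z of (y, t) \<Rightarrow> (2 * t) powr (- real r) * heat_ext (\<lambda>s. \<bar>f s\<bar>) y (2 * t))) (initially x)"
      using eventually_initially[OF zero_less_one, of x]
    proof (eventually_elim, safe, goal_cases)
      case (1 y t)
      then have "\<bar>heat_td f r y t\<bar> \<le> C * t powr (- real r) * heat_ext (\<lambda>s. \<bar>f s\<bar>) y (2 * t)" by (intro C f)
      moreover have "2 powr (real r) * (2 * t) powr (- real r) = t powr (- real r)"
      proof -
        have "(2 * t) powr (- real r) = 2 powr (- real r) * t powr (- real r)" by (rule powr_mult)
        then show ?thesis by (simp add: powr_add[symmetric] mult.assoc[symmetric])
      qed
      ultimately show ?case by (metis (no_types, lifting) mult.assoc prod.simps(2) real_norm_def)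
    qed
  qed
qed

text \<open>Near x the difference |f - L| is at most e/2, and the extension of a constant is that
  constant. Away from x it is handled by off-diagonal decay, which needs no bound on f.\<close>

lemma heat_ext_approx_identity:
  assumes f: "wadm f" and lim: "(f \<longlongrightarrow> L) (at x within pos_orthant)" and x: "f x = L"
  shows "((\<lambda>(y, t). heat_ext (\<lambda>s. \<bar>f s - L\<bar>) y t) \<longlongrightarrow> 0) (initially x)"
proof (rule tendstoI)
  fix e :: real assume e: "e > 0"
  obtain d where d: "d > 0" "\<And>s. s \<in> pos_orthant \<Longrightarrow> dist s x < d \<Longrightarrow> \<bar>f s - L\<bar> \<le> e / 2"
  proof -
    have "eventually (\<lambda>s. dist (f s) L < e / 2) (at x within pos_orthant)" using lim e by (intro tendstoD) auto
    then obtain d where d: "d > 0" "\<And>s. s \<in> pos_orthant \<Longrightarrow> s \<noteq> x \<Longrightarrow> dist s x < d \<Longrightarrow> dist (f s) L < e / 2"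
      unfolding eventually_at by blast
    \<comment> \<open>The limit says nothing about s = x itself; there the hypothesis f x = L is
      used.\<close>
    have "\<bar>f s - L\<bar> \<le> e / 2" if "s \<in> pos_orthant" "dist s x < d" for s
      using d(2)[OF that(1) _ that(2)] x e by (cases "s = x") (auto simp: dist_real_def)
    with d(1) show ?thesis by (rule that)
  qed
  have w: "wadm (\<lambda>s. \<bar>f s - L\<bar>)"
    using wadm_abs[OF wadm_add[OF f wadm_cmult[OF wadm_one, of "- L"]]] by simp
  define h where "h = (\<lambda>s. indicator (- ball x d) s * \<bar>f s - L\<bar>)"
  have h: "wadm h" unfolding h_def by (intro wadm_indicator w) auto
  have "((\<lambda>(y, t). t powr (- 0) * heat_ext (\<lambda>s. \<bar>h s\<bar>) y t) \<longlongrightarrow> 0) (initially x)"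
    by (rule heat_ext_off_diagonal[OF h d(1)]) (simp add: h_def)
  moreover have "(\<lambda>s. \<bar>h s\<bar>) = h" by (simp add: h_def fun_eq_iff)
  ultimately have "((\<lambda>(y, t). t powr (- 0) * heat_ext h y t) \<longlongrightarrow> 0) (initially x)" by simp
  then have ev: "eventually (\<lambda>z. dist (case z of (y, t) \<Rightarrow> t powr (- 0) * heat_ext h y t) 0 < e / 2) (initially x)"
    using e by (intro tendstoD) auto
  show "eventually (\<lambda>z. dist (case z of (y, t) \<Rightarrow> heat_ext (\<lambda>s. \<bar>f s - L\<bar>) y t) 0 < e) (initially x)"
    using ev eventually_initially[OF zero_less_one, of x]
  proof (eventually_elim, safe, goal_cases)
    case (1 y t)
    then have t: "0 < t" by auto
    have "heat_ext (\<lambda>s. \<bar>f s - L\<bar>) y t \<le> heat_ext (\<lambda>s. e / 2 * 1 + h s) y t"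
    proof (rule heat_ext_mono[OF w wadm_add[OF wadm_cmult[OF wadm_one] h] t])
      show "\<bar>f s - L\<bar> \<le> e / 2 * 1 + h s" if "s \<in> pos_orthant" for s
        using d(2)[OF that] e by (cases "s \<in> ball x d") (auto simp: h_def dist_commute)
    qed
    also have "\<dots> = e / 2 + heat_ext h y t"
      using t by (simp only: heat_ext_conv_td heat_td_add wadm_cmult wadm_one h heat_td_cmult heat_td_one) simp
    finally have "heat_ext (\<lambda>s. \<bar>f s - L\<bar>) y t < e" using 1 by (auto simp: dist_real_def)
    moreover have "heat_ext (\<lambda>s. \<bar>f s - L\<bar>) y t \<ge> heat_ext (\<lambda>s. 0 * 1) y t"
      by (rule heat_ext_mono[OF wadm_cmult[OF wadm_one] w t]) simp
    then have "heat_ext (\<lambda>s. \<bar>f s - L\<bar>) y t \<ge> 0"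
      by (simp add: heat_ext_def S.Phi_def)
    ultimately show ?case by (simp add: dist_real_def)
  qed
qed

text \<open>Subtracting the constant L changes only the case r = 0, because the derivatives of the
  extended constant vanish. For the difference, t^r exactly compensates the t^(-r) of
  \<open>heat_td_bound\<close>, and what is left is the extension of |f - L| at time 2 t.\<close>

lemma heat_td_approx_identity:
  assumes f: "wadm f" and lim: "(f \<longlongrightarrow> L) (at x within pos_orthant)" and x: "f x = L"
  shows "((\<lambda>(y, t). t ^ r * heat_td f r y t) \<longlongrightarrow> (if r = 0 then L else 0)) (initially x)"
proof -
  define h where "h = (\<lambda>s. f s + (- L) * 1)"
  have h: "wadm h" unfolding h_def by (intro wadm_add wadm_cmult f wadm_one)
  obtain C where C: "C \<ge> 0" "\<And>f x t. wadm f \<Longrightarrow> 0 < t \<Longrightarrow> \<bar>heat_td f r x t\<bar> \<le> C * t powr (- real r) * heat_ext (\<lambda>s. \<bar>f s\<bar>) x (2 * t)"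
    using heat_td_bound[of r] by blast
  have "((\<lambda>(y, t). heat_ext (\<lambda>s. \<bar>h s\<bar>) y t) \<longlongrightarrow> 0) (initially x)"
    using heat_ext_approx_identity[OF f lim x] by (simp add: h_def)
  from filterlim_compose[OF this filterlim_initially_double]
  have lim: "((\<lambda>(y, t). heat_ext (\<lambda>s. \<bar>h s\<bar>) y (2 * t)) \<longlongrightarrow> 0) (initially x)"
    by (simp add: case_prod_unfold)
  have "((\<lambda>(y, t). t ^ r * heat_td h r y t) \<longlongrightarrow> 0) (initially x)"
  proof (rule Lim_null_comparison)
    show "((\<lambda>z. C * (case z of (y, t) \<Rightarrow> heat_ext (\<lambda>s. \<bar>h s\<bar>) y (2 * t))) \<longlongrightarrow> 0) (initially x)"
      using tendsto_mult_right_zero[OF lim] by simp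
    show "eventually (\<lambda>z. norm (case z of (y, t) \<Rightarrow> t ^ r * heat_td h r y t) \<le> C * (case z of (y, t) \<Rightarrow> heat_ext (\<lambda>s. \<bar>h s\<bar>) y (2 * t))) (initially x)"
      using eventually_initially[OF zero_less_one, of x]
    proof (eventually_elim, safe, goal_cases)
      case (1 y t)
      then have "t ^ r * \<bar>heat_td h r y t\<bar> \<le> t ^ r * (C * t powr (- real r) * heat_ext (\<lambda>s. \<bar>h s\<bar>) y (2 * t))"
        by (intro mult_left_mono C h) auto
      moreover have *: "t ^ r * t powr (- real r) = 1" using 1 by (simp add: powr_minus powr_realpow)
      have "t ^ r * (C * t powr (- real r) * heat_ext (\<lambda>s. \<bar>h s\<bar>) y (2 * t)) = C * heat_ext (\<lambda>s. \<bar>h s\<bar>) y (2 * t)"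
      proof -
        have "t ^ r * (C * t powr (- real r) * heat_ext (\<lambda>s. \<bar>h s\<bar>) y (2 * t)) =
            (t ^ r * t powr (- real r)) * (C * heat_ext (\<lambda>s. \<bar>h s\<bar>) y (2 * t))" by (simp only: mult_ac)
        with * show ?thesis by simp
      qed
      ultimately show ?case using 1 by (simp add: abs_mult)
    qed
  qed
  then have "((\<lambda>z. (case z of (y, t) \<Rightarrow> t ^ r * heat_td h r y t) + (if r = 0 then L else 0)) \<longlongrightarrow> 0 + (if r = 0 then L else 0)) (initially x)"
    by (intro tendsto_intros)
  moreover have "eventually (\<lambda>z. (case z of (y, t) \<Rightarrow> t ^ r * heat_td h r y t) + (if r = 0 then L else 0) =
      (case z of (y, t) \<Rightarrow> t ^ r * heat_td f r y t)) (initially x)"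
    using eventually_initially[OF zero_less_one, of x]
  proof (eventually_elim, safe, goal_cases)
    case (1 y t)
    then have t: "0 < t" by auto
    have "heat_td h r y t = heat_td f r y t + (- L) * (if r = 0 then 1 else 0)"
      unfolding h_def using t by (simp only: heat_td_add f wadm_cmult wadm_one heat_td_cmult heat_td_one)
    then show ?case by simp
  qed
  ultimately show ?thesis by (simp add: Lim_transform_eventually)
qed

end

section \<open>The Laplace--Bessel operator, Green's identity and localisation\<close>

lemma bessel_op_cong:
  assumes "open U" "x \<in> U" "\<And>y. y \<in> U \<Longrightarrow> f y = g y"
  shows "bessel_op \<gamma> k f x = bessel_op \<gamma> k g x"
proof -
  have 1: "partial k f y = partial k g y" if "y \<in> U" for y
    using assms(3) by (rule partial_cong_open[OF assms(1) that])
  have "partial k (partial k f) x = partial k (partial k g) x"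
    using 1 by (rule partial_cong_open[OF assms(1,2)])
  then show ?thesis using 1[OF assms(2)] by (simp add: bessel_op_def)
qed

lemma bessel_laplacian_cong:
  assumes "open U" "x \<in> U" "\<And>y. y \<in> U \<Longrightarrow> f y = g y"
  shows "bessel_laplacian \<gamma> f x = bessel_laplacian \<gamma> g x"
  unfolding bessel_laplacian_def by (intro sum.cong refl bessel_op_cong[OF assms])

lemma bessel_laplacian_pow_cong:
  assumes "open U" "\<And>y. y \<in> U \<Longrightarrow> f y = g y" "x \<in> U"
  shows "(bessel_laplacian \<gamma> ^^ j) f x = (bessel_laplacian \<gamma> ^^ j) g x"
  using assms(3)
proof (induction j arbitrary: x)
  case (Suc j)
  then show ?case by (auto intro: bessel_laplacian_cong[OF assms(1)])
qed (use assms in simp)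

lemma Ck_on_bessel_op:
  assumes "Ck_on (Suc (Suc N)) pos_orthant f"
  shows "Ck_on N pos_orthant (bessel_op \<gamma> k f)"
proof -
  have "Ck_on N pos_orthant (\<lambda>x. partial k (partial k f) x + (2 * \<gamma> $ k + 1) * inverse (x $ k) * partial k f x)"
    by (intro Ck_on_add Ck_on_mult open_pos_orthant Ck_on_const Ck_on_inverse_coord Ck_on_partial assms Ck_on_SucD)
  then show ?thesis by (simp add: bessel_op_def[abs_def] divide_inverse)
qed

lemma Ck_on_bessel_laplacian:
  assumes "Ck_on (Suc (Suc N)) pos_orthant f"
  shows "Ck_on N pos_orthant (bessel_laplacian \<gamma> f)"
  unfolding bessel_laplacian_def[abs_def] by (intro Ck_on_sum open_pos_orthant Ck_on_bessel_op assms) auto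

lemma Ck_on_bessel_laplacian_pow:
  "Ck_on (2 * j + N) pos_orthant f \<Longrightarrow> Ck_on N pos_orthant ((bessel_laplacian \<gamma> ^^ j) f)"
proof (induction j arbitrary: N)
  case (Suc j)
  have "Ck_on (Suc (Suc N)) pos_orthant ((bessel_laplacian \<gamma> ^^ j) f)"
    using Suc.prems by (intro Suc.IH) (simp del: Ck_on.simps)
  then show ?case by (simp del: Ck_on.simps add: Ck_on_bessel_laplacian)
qed simp

lemma bessel_laplacian_linear:
  assumes "finite I" "\<And>i. i \<in> I \<Longrightarrow> Ck_on 2 pos_orthant (f i)" "x \<in> pos_orthant"
  shows "bessel_laplacian \<gamma> (\<lambda>x. \<Sum>i\<in>I. c i * f i x) x = (\<Sum>i\<in>I. c i * bessel_laplacian \<gamma> (f i) x)"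
proof -
  have C2: "Ck_on (Suc (Suc 0)) pos_orthant (f i)" if "i \<in> I" for i
    using assms(2)[OF that] by (simp only: numeral_2_eq_2)
  have 1: "partial k (\<lambda>x. \<Sum>i\<in>I. c i * f i x) y = (\<Sum>i\<in>I. c i * partial k (f i) y)" if "y \<in> pos_orthant" for k y
    by (intro partialI DERIV_sum DERIV_cmult Ck_on_has_partial[OF C2] that)
  have 2: "partial k (partial k (\<lambda>x. \<Sum>i\<in>I. c i * f i x)) x = (\<Sum>i\<in>I. c i * partial k (partial k (f i)) x)" for k
  proof -
    have "partial k (partial k (\<lambda>x. \<Sum>i\<in>I. c i * f i x)) x = partial k (\<lambda>y. \<Sum>i\<in>I. c i * partial k (f i) y) x"
      using 1 by (rule partial_cong_open[OF open_pos_orthant assms(3)])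
    also have "\<dots> = (\<Sum>i\<in>I. c i * partial k (partial k (f i)) x)"
      by (intro partialI DERIV_sum DERIV_cmult Ck_on_has_partial[OF Ck_on_partial[OF C2]] assms(3))
    finally show ?thesis .
  qed
  have "bessel_op \<gamma> k (\<lambda>x. \<Sum>i\<in>I. c i * f i x) x = (\<Sum>i\<in>I. c i * bessel_op \<gamma> k (f i) x)" for k
  proof -
    have "S + a * (\<Sum>i\<in>I. c i * p i) = (\<Sum>i\<in>I. c i * (q i + a * p i))" if "S = (\<Sum>i\<in>I. c i * q i)" for S a p q
      unfolding that by (simp add: sum_distrib_left sum.distrib algebra_simps)
    from this[OF refl] show ?thesis unfolding bessel_op_def 2 1[OF assms(3)] .
  qed
  then show ?thesis
    unfolding bessel_laplacian_def sum_distrib_left by (simp add: sum.swap[of _ UNIV I])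
qed

lemma bessel_laplacian_pow_linear:
  assumes "finite I" "\<And>i. i \<in> I \<Longrightarrow> Ck_on (2 * j) pos_orthant (f i)" "x \<in> pos_orthant"
  shows "(bessel_laplacian \<gamma> ^^ j) (\<lambda>x. \<Sum>i\<in>I. c i * f i x) x = (\<Sum>i\<in>I. c i * (bessel_laplacian \<gamma> ^^ j) (f i) x)"
  using assms(2,3)
proof (induction j arbitrary: x)
  case (Suc j)
  have "Ck_on (2 * j) pos_orthant (f i)" if "i \<in> I" for i
    by (rule Ck_on_mono[OF _ Suc.prems(1)[OF that]]) simp
  note IH = Suc.IH[OF this]
  have "(bessel_laplacian \<gamma> ^^ Suc j) (\<lambda>x. \<Sum>i\<in>I. c i * f i x) x =
      bessel_laplacian \<gamma> (\<lambda>x. \<Sum>i\<in>I. c i * (bessel_laplacian \<gamma> ^^ j) (f i) x) x"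
    by (simp, rule bessel_laplacian_cong[OF open_pos_orthant Suc.prems(2)], rule IH)
  also have "\<dots> = (\<Sum>i\<in>I. c i * bessel_laplacian \<gamma> ((bessel_laplacian \<gamma> ^^ j) (f i)) x)"
  proof (rule bessel_laplacian_linear[OF assms(1) _ Suc.prems(2)])
    show "Ck_on 2 pos_orthant ((bessel_laplacian \<gamma> ^^ j) (f i))" if "i \<in> I" for i
      using Suc.prems(1)[OF that] by (intro Ck_on_bessel_laplacian_pow) (simp add: add.commute)
  qed
  finally show ?case by simp
qed simp

section \<open>Compactly supported functions and cut-offs\<close>

lemma continuous_on_compact_support:
  assumes "compact K" "K \<subseteq> U" "open U" "\<And>x. x \<notin> K \<Longrightarrow> f x = 0" "continuous_on U (f :: real^'n \<Rightarrow> real)"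
  shows "continuous_on UNIV f"
proof -
  have "continuous_on (- K) f" using assms(4) by (subst continuous_on_cong[OF refl, of _ f "\<lambda>_. 0"]) auto
  moreover have "open (- K)" using assms(1) by (simp add: compact_imp_closed open_Compl)
  ultimately have "continuous_on (U \<union> - K) f" using assms(3,5) by (intro continuous_on_open_Un)
  then show ?thesis using assms(2) by (metis Compl_partition UNIV_I Un_mono continuous_on_subset subset_refl subset_UNIV)
qed

lemma integrable_compact_support:
  assumes "compact K" "K \<subseteq> U" "open U" "\<And>x. x \<notin> K \<Longrightarrow> f x = 0" "continuous_on U (f :: real^'n \<Rightarrow> real)"
  shows "integrable lborel f"
proof -
  have "integrable lborel (\<lambda>x. indicator K x *\<^sub>R f x)"
    using assms by (intro borel_integrable_compact) (auto intro: continuous_on_subset)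
  moreover have "(\<lambda>x. indicator K x *\<^sub>R f x) = f" using assms(4) by (auto simp: fun_eq_iff indicator_def of_bool_def)
  ultimately show ?thesis by simp
qed

text \<open>Translation invariance of Lebesgue measure, differentiated under the integral sign.\<close>

lemma integral_partial_compact_support:
  fixes f f' :: "real^'n \<Rightarrow> real"
  assumes K: "compact K" "K \<subseteq> U" and U: "open U"
    and f0: "\<And>x. x \<notin> K \<Longrightarrow> f x = 0" and f'0: "\<And>x. x \<notin> K \<Longrightarrow> f' x = 0"
    and der: "\<And>x. x \<in> U \<Longrightarrow> has_partial k f (f' x) x"
    and cf: "continuous_on U f" and cf': "continuous_on U f'"
  shows "(\<integral>x. f' x \<partial>lborel) = 0"
proof -
  have c: "continuous_on UNIV f" by (rule continuous_on_compact_support[OF K U f0 cf])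
  have c': "continuous_on UNIV f'" by (rule continuous_on_compact_support[OF K U f'0 cf'])
  have [measurable]: "f \<in> borel_measurable borel" "f' \<in> borel_measurable borel"
    using c c' by (auto intro: borel_measurable_continuous_onI)
  have int: "integrable lborel f" by (rule integrable_compact_support[OF K U f0 cf])
  have opK: "open (- K)" using K(1) by (simp add: compact_imp_closed open_Compl)
  have part: "has_partial k f (f' x) x" for x
  proof (cases "x \<in> K")
    case False
    then show ?thesis
      using f'0[OF False] f0 by (subst has_partial_cong_open[OF opK, of x f "\<lambda>_. 0"]) auto
  qed (use K der in auto)
  obtain r where r: "\<And>x. x \<in> K \<Longrightarrow> norm x \<le> r" using compact_imp_bounded[OF K(1)] bounded_iff by blast
  obtain C where C0: "0 < C" and C: "\<And>x. x \<in> K \<Longrightarrow> norm (f' x) \<le> C"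
    using compact_imp_bounded[OF compact_continuous_image[OF continuous_on_subset[OF c' subset_UNIV] K(1)]]
    by (auto simp: bounded_pos)
  have trans: "integrable lborel (\<lambda>x. f (x + h *\<^sub>R axis k 1)) \<and> (\<integral>x. f (x + h *\<^sub>R axis k 1) \<partial>lborel) = (\<integral>x. f x \<partial>lborel)" for h
  proof -
    have "(\<integral>x. f x \<partial>lborel) = (\<integral>x. f x \<partial>distr lborel borel ((+) (h *\<^sub>R axis k 1)))" "integrable (distr lborel borel ((+) (h *\<^sub>R axis k 1))) f"
      using int by (simp_all only: lborel_distr_plus)
    then show ?thesis by (simp add: integral_distr integrable_distr_eq add.commute)
  qed
  have "((\<lambda>h. \<integral>x. f (x + h *\<^sub>R axis k 1) \<partial>lborel) has_real_derivative (\<integral>x. f' (x + 0 *\<^sub>R axis k 1) \<partial>lborel)) (at 0)"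
  proof (rule has_real_derivative_integral_dominated[where d=1 and F="\<lambda>h x. f (x + h *\<^sub>R axis k 1)" and F'="\<lambda>h x. f' (x + h *\<^sub>R axis k 1)"
      and B="\<lambda>x. C * indicator (cball 0 (r + 1)) x"])
    show "integrable lborel (\<lambda>x. f (x + h *\<^sub>R axis k 1))" for h using trans by blast
    show "((\<lambda>h. f (x + h *\<^sub>R axis k 1)) has_real_derivative f' (x + h *\<^sub>R axis k 1)) (at h)" for h x
    proof -
      have "((\<lambda>u. f (x + (u + h) *\<^sub>R axis k 1)) has_real_derivative f' (x + h *\<^sub>R axis k 1)) (at 0)"
        using part[of "x + h *\<^sub>R axis k 1"] by (simp add: scaleR_add_left add_ac)
      then show ?thesis using DERIV_shift[of "\<lambda>u. f (x + u *\<^sub>R axis k 1)" _ 0 h] by simp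
    qed
    show "\<bar>f' (x + h *\<^sub>R axis k 1)\<bar> \<le> C * indicator (cball 0 (r + 1)) x" if "\<bar>h - 0\<bar> < 1" for h x
    proof (cases "x + h *\<^sub>R axis k 1 \<in> K")
      case True
      have "norm x \<le> norm (x + h *\<^sub>R axis k 1) + norm (h *\<^sub>R axis k (1::real))"
        by (metis add_diff_cancel_right' norm_triangle_ineq4)
      also have "\<dots> \<le> r + 1" using r[OF True] that by simp
      finally show ?thesis using C[OF True] by simp
    next
      case False
      then show ?thesis using f'0[OF False] C0 by simp
    qed
    show "integrable lborel (\<lambda>x. C * indicator (cball (0::real^'n) (r + 1)) x)"
    proof (intro integrable_mult_right integrable_real_indicator)
      show "emeasure lborel (cball (0::real^'n) (r + 1)) < \<infinity>"
        by (intro emeasure_bounded_finite bounded_cball)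
    qed simp
  qed simp_all
  then have "((\<lambda>h. \<integral>x. f x \<partial>lborel) has_real_derivative (\<integral>x. f' x \<partial>lborel)) (at (0::real))"
    using trans by simp
  then show ?thesis by (rule DERIV_unique) auto
qed

lemma has_derivative_max_power:
  assumes "2 \<le> M"
  shows "((\<lambda>y. max 0 y ^ M) has_real_derivative real M * max 0 y ^ (M - 1)) (at (y::real))"
proof -
  consider "y < 0" | "y > 0" | "y = 0" by linarith
  then show ?thesis
  proof cases
    case 1
    have "((\<lambda>y. max 0 y ^ M) has_real_derivative 0) (at y) \<longleftrightarrow> ((\<lambda>y. 0) has_real_derivative 0) (at y)"
      using eventually_nhds_in_open[of "{..<0}" y] 1 assms
      by (intro DERIV_cong_ev) (auto elim!: eventually_mono simp: max_def)
    then show ?thesis using 1 assms by (simp add: power_0_left)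
  next
    case 2
    have "((\<lambda>y. max 0 y ^ M) has_real_derivative real M * y ^ (M - 1)) (at y) \<longleftrightarrow> ((\<lambda>y. y ^ M) has_real_derivative real M * y ^ (M - 1)) (at y)"
      using eventually_nhds_in_open[of "{0<..}" y] 2
      by (intro DERIV_cong_ev) (auto elim!: eventually_mono simp: max_def)
    then show ?thesis using 2 by (auto intro!: derivative_eq_intros)
  next
    case 3
    have "((\<lambda>h. (max 0 h ^ M - max 0 0 ^ M) / (h - 0)) \<longlongrightarrow> 0) (at (0::real))"
    proof (rule Lim_null_comparison)
      show "\<forall>\<^sub>F h in at 0. norm ((max 0 h ^ M - max 0 0 ^ M) / (h - 0)) \<le> \<bar>h\<bar> ^ (M - 1)"
      proof (intro always_eventually allI)
        fix h :: real
        obtain n where n: "M = Suc (Suc n)" using assms by (metis add_2_eq_Suc le_Suc_ex)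
        show "norm ((max 0 h ^ M - max 0 0 ^ M) / (h - 0)) \<le> \<bar>h\<bar> ^ (M - 1)"
        proof (cases "h > 0")
          case False
          then have "max 0 h = 0" by simp
          with False show ?thesis by (simp add: n mult_nonpos_nonneg)
        qed (simp add: n)
      qed
      have "((\<lambda>h. \<bar>h\<bar> ^ (M - 1)) \<longlongrightarrow> \<bar>0::real\<bar> ^ (M - 1)) (at 0)" by (intro tendsto_intros)
      moreover have "\<bar>0::real\<bar> ^ (M - 1) = 0" using assms by (simp add: power_0_left)
      ultimately show "((\<lambda>h. \<bar>h\<bar> ^ (M - 1)) \<longlongrightarrow> 0) (at (0::real))" by (simp only:)
    qed
    then have "((\<lambda>y. max 0 y ^ M) has_real_derivative 0) (at (0::real))"
      by (simp only: has_field_derivative_iff)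
    moreover have "real M * max 0 (0::real) ^ (M - 1) = 0" using assms by (simp add: power_0_left)
    ultimately show ?thesis using 3 by (simp only:)
  qed
qed

text \<open>The positive part raised to the power N + 1 is N times continuously differentiable; in
  the proof \<open>p i\<close> carries the falling factorial that i differentiations
  produce.\<close>

lemma Ck_on_max_power:
  assumes "open U" "Ck_on N U g"
  shows "Ck_on N U (\<lambda>x. max 0 (g x) ^ (N + 1))"
proof -
  define p where "p = (\<lambda>i y. (\<Prod>l<i. real (N + 1 - l)) * max 0 (y::real) ^ (N + 1 - i))"
  have "Ck_on N U (\<lambda>x. p 0 (g x))"
  proof (rule Ck_on_compose_real[OF assms(1) _ _ assms(2)])
    fix i x assume "i < N"
    then have i: "N + 1 - Suc i = N + 1 - i - 1" "2 \<le> N + 1 - i" by auto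
    have "(p i has_real_derivative (\<Prod>l<i. real (N + 1 - l)) * (real (N + 1 - i) * max 0 (g x) ^ (N + 1 - i - 1))) (at (g x))"
      unfolding p_def by (intro DERIV_cmult has_derivative_max_power i)
    moreover have "p (Suc i) (g x) = (\<Prod>l<i. real (N + 1 - l)) * (real (N + 1 - i) * max 0 (g x) ^ (N + 1 - i - 1))"
      by (simp only: p_def prod.lessThan_Suc mult.assoc i(1))
    ultimately show "(p i has_real_derivative p (Suc i) (g x)) (at (g x))" by (simp only:)
  qed (auto simp: p_def intro!: continuous_intros)
  then show ?thesis by (simp add: p_def)
qed

text \<open>A cut-off of finite smoothness made from truncated powers. The bump \<psi> is supported
  in a ball around x but equals 1 only at its centre; the second truncation, 1 minus a power of the
  positive part of 1 - 2 \<psi>, is constant 1 wherever \<psi> \<ge> 1/2 and still 0 wherever \<psi>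
  = 0.\<close>

lemma exists_cutoff:
  assumes "open U" "x \<in> (U :: (real^'n) set)"
  shows "\<exists>\<eta> d K. d > 0 \<and> compact K \<and> K \<subseteq> U \<and> ball x d \<subseteq> U \<and> (\<forall>s\<in>ball x d. \<eta> s = 1) \<and>
    (\<forall>s. s \<notin> K \<longrightarrow> \<eta> s = 0) \<and> Ck_on N UNIV \<eta>"
proof -
  obtain e where e: "e > 0" "cball x e \<subseteq> U" using assms open_contains_cball by blast
  define q where "q = (\<lambda>s::real^'n. 1 + (\<Sum>j\<in>UNIV. (- 1 / e\<^sup>2) * ((s $ j + (- x $ j)) * (s $ j + (- x $ j)))))"
  define \<psi> where "\<psi> = (\<lambda>s. max 0 (q s) ^ (N + 1))"
  define \<eta> where "\<eta> = (\<lambda>s. 1 + (- 1) * max 0 (1 + (- 2) * \<psi> s) ^ (N + 1))"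
  have q: "q s = 1 - (norm (s - x))\<^sup>2 / e\<^sup>2" for s
    unfolding q_def power2_norm_eq_inner inner_vec_def
    by (simp add: sum_negf sum_divide_distrib)
  have "Ck_on N UNIV q" unfolding q_def
    by (intro Ck_on_add Ck_on_mult Ck_on_const Ck_on_coord Ck_on_sum) auto
  then have psi: "Ck_on N UNIV \<psi>" unfolding \<psi>_def by (intro Ck_on_max_power) auto
  then have chi: "Ck_on N UNIV \<eta>" unfolding \<eta>_def
    by (intro Ck_on_add Ck_on_mult Ck_on_const Ck_on_max_power) auto
  have out: "\<eta> s = 0" if "s \<notin> cball x e" for s
  proof -
    have "e \<le> norm (s - x)" using that by (simp add: dist_norm norm_minus_commute)
    then have "e\<^sup>2 \<le> (norm (s - x))\<^sup>2" using e by (intro power_mono) auto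
    then have "q s \<le> 0" using e by (simp add: q)
    then show ?thesis by (simp add: \<eta>_def \<psi>_def max_def)
  qed
  have "\<psi> x = 1" using e by (simp add: \<psi>_def q)
  moreover have "isCont \<psi> x" using Ck_on_continuous[OF psi] by (simp add: continuous_on_eq_continuous_at)
  then have "(\<psi> \<longlongrightarrow> \<psi> x) (nhds x)" by (simp add: isCont_def tendsto_at_iff_tendsto_nhds)
  ultimately have "eventually (\<lambda>s. 1 / 2 < \<psi> s) (nhds x)"
    by (intro order_tendstoD(1)[of \<psi> "\<psi> x"]) auto
  then obtain d where d: "d > 0" "\<And>s. dist s x < d \<Longrightarrow> 1 / 2 < \<psi> s" by (auto simp: eventually_nhds_metric)
  have "\<eta> s = 1" if "s \<in> ball x (min d e)" for s
    using d(2)[of s] that by (simp add: \<eta>_def dist_commute max_def)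
  moreover have "ball x (min d e) \<subseteq> U" using e(2) by auto
  ultimately show ?thesis using out chi e d(1) by (intro exI[of _ \<eta>] exI[of _ "min d e"] exI[of _ "cball x e"]) auto
qed

context gauss_family begin

lemma V_Ck_on: "F \<in> V \<Longrightarrow> 0 < t \<Longrightarrow> Ck_on N UNIV (\<lambda>x. F x t)"
proof (induction N arbitrary: F)
  case 0
  have "continuous_on UNIV (\<lambda>x. (\<lambda>(x, t). F x t) (x, t))"
    by (rule continuous_on_compose2[OF V_continuous[OF 0(1)]]) (use 0 in \<open>auto intro!: continuous_intros\<close>)
  then show ?case by simp
next
  case (Suc N)
  have "\<exists>G. G \<in> V \<and> (\<forall>x. has_partial k (\<lambda>y. F y t) (G x t) x)" for k
    using V_partial[OF Suc.prems(1), of k] Suc.prems(2) by blast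
  then obtain G where G: "\<And>k. G k \<in> V" "\<And>k x. has_partial k (\<lambda>y. F y t) (G k x t) x" by metis
  have "continuous_on UNIV (\<lambda>x. (\<lambda>(x, t). F x t) (x, t))"
    by (rule continuous_on_compose2[OF V_continuous[OF Suc.prems(1)]]) (use Suc.prems in \<open>auto intro!: continuous_intros\<close>)
  then show ?case by (intro Ck_on_SucI[where f'="\<lambda>k x. G k x t"] G Suc.IH Suc.prems) auto
qed

end

lemma Ck_on_subset: "V \<subseteq> U \<Longrightarrow> Ck_on N U f \<Longrightarrow> Ck_on N V f"
proof (induction N arbitrary: f)
  case (Suc N)
  then have "Ck_on N V (partial k f)" for k by (intro Suc.IH) simp_all
  then show ?case using Suc.prems by (auto simp: has_partial_on_def intro: continuous_on_subset)
qed (auto intro: continuous_on_subset)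

section \<open>Green's identity and the transfer of time derivatives to the data\<close>

context bessel_heat begin

lemma wadm_compact_support:
  assumes "compact K" "K \<subseteq> pos_orthant" "\<And>x. x \<notin> K \<Longrightarrow> f x = 0" "continuous_on pos_orthant f"
  shows "wadm f"
proof -
  have c: "continuous_on UNIV f"
    by (rule continuous_on_compact_support[OF assms(1,2) open_pos_orthant assms(3,4)])
  obtain C where C: "\<And>x. x \<in> K \<Longrightarrow> norm (f x) \<le> C"
    using compact_imp_bounded[OF compact_continuous_image[OF continuous_on_subset[OF c subset_UNIV] assms(1)]]
    by (auto simp: bounded_iff)
  show ?thesis
  proof (rule wadm_bound[OF wadm_cmult[OF wadm_one, of "\<bar>C\<bar>"]])
    show "(\<lambda>s. f s * weight s) \<in> borel_measurable borel"
      using c by (intro borel_measurable_times weight_measurable borel_measurable_continuous_onI)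
    show "\<bar>f s\<bar> \<le> \<bar>\<bar>C\<bar> * 1\<bar>" for s using C[of s] assms(3)[of s] by (cases "s \<in> K") auto
  qed
qed

definition powr_weight :: "real^'n \<Rightarrow> real" where
  "powr_weight s = (\<Prod>j\<in>UNIV. (s $ j) powr (2 * \<gamma> $ j + 1))"

lemma weight_eq: "s \<in> pos_orthant \<Longrightarrow> weight s = powr_weight s"
  by (simp add: weight_def powr_weight_def)

lemma continuous_on_powr_weight: "continuous_on pos_orthant powr_weight"
  unfolding powr_weight_def by (intro continuous_intros) (auto, metis less_irrefl pos_orthantD)

lemma has_partial_powr_weight:
  assumes "s \<in> pos_orthant"
  shows "has_partial k powr_weight ((2 * \<gamma> $ k + 1) / (s $ k) * powr_weight s) s"
proof -
  define P where "P = (\<Prod>j\<in>UNIV - {k}. (s $ j) powr (2 * \<gamma> $ j + 1))"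
  have s: "s $ k > 0" using assms by (rule pos_orthantD)
  have eq: "powr_weight (s + h *\<^sub>R axis k 1) = (s $ k + h) powr (2 * \<gamma> $ k + 1) * P" for h
  proof -
    have "powr_weight (s + h *\<^sub>R axis k 1) = ((s + h *\<^sub>R axis k 1) $ k) powr (2 * \<gamma> $ k + 1) *
       (\<Prod>j\<in>UNIV - {k}. ((s + h *\<^sub>R axis k 1) $ j) powr (2 * \<gamma> $ j + 1))"
      unfolding powr_weight_def by (rule prod.remove) auto
    also have "(\<Prod>j\<in>UNIV - {k}. ((s + h *\<^sub>R axis k 1) $ j) powr (2 * \<gamma> $ j + 1)) = P"
      unfolding P_def by (intro prod.cong) (auto simp: axis_def)
    finally show ?thesis by (simp add: axis_def)
  qed
  have "((\<lambda>h. (s $ k + h) powr (2 * \<gamma> $ k + 1) * P) has_real_derivative (2 * \<gamma> $ k + 1) * (s $ k) powr (2 * \<gamma> $ k) * P) (at 0)"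
    using s by (auto intro!: derivative_eq_intros)
  moreover have "(s $ k) powr (2 * \<gamma> $ k) = (s $ k) powr (2 * \<gamma> $ k + 1) / s $ k"
    using s powr_diff[of "s $ k" "2 * \<gamma> $ k + 1" 1] by simp
  ultimately show ?thesis
    unfolding eq using eq[of 0] by (simp add: add_divide_distrib algebra_simps)
qed

lemma kernel_fun_has_time_derivative:
  assumes "0 < t"
  shows "(kernel_fun x s has_real_derivative (\<integral>\<theta>. kernel_deriv 1 (kernel_exponent x s \<theta>) t \<partial>Theta)) (at t)"
proof -
  define I1 I2 where "I1 = K.Phi x (\<lambda>_. 1) s t" and "I2 = K.Phi x (\<lambda>\<theta>. K.R x s \<theta> * 1) s t"
  have d: "(kernel_fun x s has_real_derivative
      (- mass_exponent * t powr (- mass_exponent - 1) * I1 + t powr (- mass_exponent) * (I2 / (4 * t\<^sup>2)))) (at t)"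
    unfolding kernel_fun_def[abs_def] I1_def I2_def
    by (rule derivative_eq_intros K.Phi_has_time_derivative K_adm_const assms refl)+ (use assms in simp)
  have "kernel_deriv 1 (kernel_exponent x s \<theta>) t =
      - mass_exponent * t powr (- mass_exponent - 1) * (1 * exp (- K.R x s \<theta> / (4 * t))) +
      t powr (- mass_exponent - 1) / (4 * t) * (K.R x s \<theta> * 1 * exp (- K.R x s \<theta> / (4 * t)))" for \<theta>
    by (simp add: kernel_deriv_def K_R algebra_simps)
  then have "(\<integral>\<theta>. kernel_deriv 1 (kernel_exponent x s \<theta>) t \<partial>Theta) =
      - mass_exponent * t powr (- mass_exponent - 1) * I1 + t powr (- mass_exponent - 1) / (4 * t) * I2"
    unfolding I1_def I2_def K.Phi_def
    using K.integrable_adm[OF K_adm_const[of x 1] assms, of s] K.integrable_adm[OF K.adm_R[OF K_adm_const[of x 1]] assms, of s s]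
    by (simp only: integral_mult_right_zero Bochner_Integration.integral_add integrable_mult_right)
  moreover have "t powr (- mass_exponent - 1) = t powr (- mass_exponent) / t" using assms by (simp add: powr_diff)
  ultimately show ?thesis using d assms by (simp add: power2_eq_square mult_ac)
qed

text \<open>The heat equation of the kernel in the source variable: it trades the time derivative
  for the operator acting on s, which Green's identity can then move to the data.\<close>

lemma laplacian_kernel_fun:
  assumes "0 < t" "s \<in> pos_orthant"
  shows "bessel_laplacian \<gamma> (\<lambda>s. kernel_fun x s t) s = (\<integral>\<theta>. kernel_deriv 1 (kernel_exponent x s \<theta>) t \<partial>Theta)"
  using bessel_heat_op_kernel_fun[OF assms(2,1), of x] DERIV_imp_deriv[OF kernel_fun_has_time_derivative[OF assms(1), of x s]]
  by (simp add: bessel_heat_op_def time_deriv_def)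

lemma heat_td_fubini:
  assumes "wadm f" "0 < t"
  shows "heat_td f r x t = mass_const * (\<integral>s. f s * weight s * (\<integral>\<theta>. kernel_deriv r (kernel_exponent x s \<theta>) t \<partial>Theta) \<partial>lborel)"
  unfolding heat_td_def using integral_fst'[OF heat_td_integrable[OF assms, of r x]]
  by (simp add: S_R)

lemma kernel_fun_eq: "(\<integral>\<theta>. kernel_deriv 0 (kernel_exponent x s \<theta>) t \<partial>Theta) = kernel_fun x s t"
  by (simp add: kernel_deriv_def kernel_fun_def K.Phi_def K_R)

text \<open>With w the weight, the k-th derivative of w (h g_k - g h_k), where the index k on g and
  h denotes the partial derivative, is w (h B_k g - g B_k h), because w_k = (2 \<gamma>_k + 1) w /
  s_k. Its integral vanishes as h is supported in a compact subset of the open orthant; no condition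
  on g at the faces enters.\<close>

lemma green_identity:
  assumes K: "compact K" "K \<subseteq> pos_orthant" and h0: "\<And>s. s \<notin> K \<Longrightarrow> h s = 0"
    and h: "Ck_on 2 pos_orthant h" and g: "Ck_on 2 pos_orthant g"
  shows "(\<integral>s. h s * weight s * bessel_laplacian \<gamma> g s \<partial>lborel) = (\<integral>s. bessel_laplacian \<gamma> h s * weight s * g s \<partial>lborel)"
proof -
  note op = open_pos_orthant
  have h2: "Ck_on (Suc (Suc 0)) pos_orthant h" and g2: "Ck_on (Suc (Suc 0)) pos_orthant g"
    using h g by (simp_all only: numeral_2_eq_2)
  have opK: "open (- K)" using K(1) by (simp add: compact_imp_closed open_Compl)
  have ph0: "partial k h s = 0" if "s \<notin> K" for k s
    using partial_cong_open[OF opK, of s h "\<lambda>_. 0" k] that h0 by (simp add: partial_def)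
  have pph0: "partial k (partial k h) s = 0" if "s \<notin> K" for k s
    using partial_cong_open[OF opK, of s "partial k h" "\<lambda>_. 0" k] that ph0 by (simp add: partial_def)
  define \<psi> where "\<psi> = (\<lambda>k s. powr_weight s * (h s * partial k g s - g s * partial k h s))"
  define \<psi>' where "\<psi>' = (\<lambda>k s. powr_weight s * (h s * bessel_op \<gamma> k g s - g s * bessel_op \<gamma> k h s))"
  have L0: "bessel_op \<gamma> k h s = 0" if "s \<notin> K" for k s
    using that by (simp add: bessel_op_def ph0 pph0)
  note cont = Ck_on_continuous[OF h] Ck_on_continuous[OF g] continuous_on_powr_weight
    Ck_on_continuous[OF Ck_on_partial[OF h2]] Ck_on_continuous[OF Ck_on_partial[OF g2]]
    Ck_on_continuous[OF Ck_on_bessel_op[OF h2, of \<gamma>]] Ck_on_continuous[OF Ck_on_bessel_op[OF g2, of \<gamma>]]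
    Ck_on_continuous[OF Ck_on_bessel_laplacian[OF h2, of \<gamma>]] Ck_on_continuous[OF Ck_on_bessel_laplacian[OF g2, of \<gamma>]]
  have z: "\<psi>' k s = 0" if "s \<notin> K" for k s using that by (simp add: \<psi>'_def h0 L0)
  have c': "continuous_on pos_orthant (\<psi>' k)" for k unfolding \<psi>'_def by (intro continuous_intros cont)
  have "(\<integral>s. \<psi>' k s \<partial>lborel) = 0" for k
  proof (rule integral_partial_compact_support[OF K op _ z _ _ c'])
    show "\<psi> k s = 0" if "s \<notin> K" for s using that by (simp add: \<psi>_def h0 ph0)
    show "continuous_on pos_orthant (\<psi> k)" unfolding \<psi>_def by (intro continuous_intros cont)
    show "has_partial k (\<psi> k) (\<psi>' k s) s" if s: "s \<in> pos_orthant" for s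
    proof -
      have "has_partial k (\<lambda>s. h s * partial k g s - g s * partial k h s)
          ((partial k h s * partial k g s + h s * partial k (partial k g) s) -
           (partial k g s * partial k h s + g s * partial k (partial k h) s)) s"
        by (intro DERIV_diff has_partial_mult Ck_on_has_partial[OF h2] Ck_on_has_partial[OF g2]
            Ck_on_has_partial[OF Ck_on_partial[OF h2]] Ck_on_has_partial[OF Ck_on_partial[OF g2]] s)
      from has_partial_mult[OF has_partial_powr_weight[OF s, of k] this]
      have "has_partial k (\<psi> k) ((2 * \<gamma> $ k + 1) / (s $ k) * powr_weight s * (h s * partial k g s - g s * partial k h s) +
          powr_weight s * ((partial k h s * partial k g s + h s * partial k (partial k g) s) -
           (partial k g s * partial k h s + g s * partial k (partial k h) s))) s"
        unfolding \<psi>_def .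
      moreover have "c * W * (a * g1 - b * h1) + W * ((h1 * g1 + a * g2) - (g1 * h1 + b * h2)) =
          W * (a * (g2 + c * g1) - b * (h2 + c * h1))" for c W a b g1 g2 h1 h2 :: real
        by (simp add: algebra_simps)
      ultimately show ?thesis unfolding \<psi>'_def bessel_op_def by (simp only:)
    qed
  qed
  moreover have "integrable lborel (\<psi>' k)" for k
    by (rule integrable_compact_support[OF K op z c'])
  ultimately have "(\<integral>s. (\<Sum>k\<in>UNIV. \<psi>' k s) \<partial>lborel) = 0"
    by (subst Bochner_Integration.integral_sum) auto
  moreover have "(\<Sum>k\<in>UNIV. \<psi>' k s) = h s * weight s * bessel_laplacian \<gamma> g s - bessel_laplacian \<gamma> h s * weight s * g s" for s
  proof (cases "s \<in> K")
    case True
    then have "weight s = powr_weight s" using K(2) by (intro weight_eq) auto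
    then show ?thesis
      unfolding \<psi>'_def bessel_laplacian_def sum_distrib_left[symmetric] sum_subtractf by (simp add: algebra_simps)
  next
    case False
    then show ?thesis by (simp add: z h0 L0 bessel_laplacian_def)
  qed
  ultimately have 0: "(\<integral>s. h s * weight s * bessel_laplacian \<gamma> g s - bessel_laplacian \<gamma> h s * weight s * g s \<partial>lborel) = 0"
    by simp
  have w: "continuous_on pos_orthant weight" using continuous_on_powr_weight weight_eq by (simp cong: continuous_on_cong)
  have LL0: "bessel_laplacian \<gamma> h s = 0" if "s \<notin> K" for s
    using that by (simp add: bessel_laplacian_def L0)
  have i1: "integrable lborel (\<lambda>s. h s * weight s * bessel_laplacian \<gamma> g s)"
  proof (rule integrable_compact_support[OF K op])
    show "continuous_on pos_orthant (\<lambda>s. h s * weight s * bessel_laplacian \<gamma> g s)"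
      by (intro continuous_on_mult cont w)
  qed (simp add: h0)
  have i2: "integrable lborel (\<lambda>s. bessel_laplacian \<gamma> h s * weight s * g s)"
  proof (rule integrable_compact_support[OF K op])
    show "continuous_on pos_orthant (\<lambda>s. bessel_laplacian \<gamma> h s * weight s * g s)"
      by (intro continuous_on_mult cont w)
  qed (simp add: LL0)
  show ?thesis using 0 Bochner_Integration.integral_diff[OF i1 i2] by simp
qed

lemma laplacian_support:
  assumes "compact K" "\<And>s. s \<notin> K \<Longrightarrow> h s = (0::real)" "s \<notin> K"
  shows "bessel_laplacian \<gamma> h s = 0"
proof -
  have opK: "open (- K)" using assms(1) by (simp add: compact_imp_closed open_Compl)
  have "bessel_laplacian \<gamma> h s = bessel_laplacian \<gamma> (\<lambda>_. 0) s"
    using assms(2,3) by (intro bessel_laplacian_cong[OF opK]) auto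
  then show ?thesis by (simp add: bessel_laplacian_def bessel_op_def partial_def[abs_def])
qed

text \<open>For r = 0 this is Green's identity applied to the kernel. Larger r follow by
  differentiating the identity in t and comparing derivatives, so only two derivatives of h are ever
  used.\<close>

lemma heat_td_Suc_laplacian:
  assumes K: "compact K" "K \<subseteq> pos_orthant" and h0: "\<And>s. s \<notin> K \<Longrightarrow> h s = 0"
    and h: "Ck_on 2 pos_orthant h" and t: "0 < t"
  shows "heat_td h (Suc r) x t = heat_td (bessel_laplacian \<gamma> h) r x t"
  using t
proof (induction r arbitrary: t)
  case (0 t)
  have h2: "Ck_on (Suc (Suc 0)) pos_orthant h" using h by (simp only: numeral_2_eq_2)
  have wh: "wadm h" by (rule wadm_compact_support[OF K h0 Ck_on_continuous[OF h]])
  have wL: "wadm (bessel_laplacian \<gamma> h)"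
    by (rule wadm_compact_support[OF K laplacian_support[OF K(1) h0] Ck_on_continuous[OF Ck_on_bessel_laplacian[OF h2]]])
  have kf: "Ck_on 2 pos_orthant (\<lambda>s. kernel_fun x s t)"
    by (rule Ck_on_subset[OF subset_UNIV K.V_Ck_on[OF kernel_fun_V 0]])
  have "(\<integral>s. h s * weight s * (\<integral>\<theta>. kernel_deriv 1 (kernel_exponent x s \<theta>) t \<partial>Theta) \<partial>lborel) =
      (\<integral>s. h s * weight s * bessel_laplacian \<gamma> (\<lambda>s. kernel_fun x s t) s \<partial>lborel)"
  proof (intro Bochner_Integration.integral_cong refl)
    fix s show "h s * weight s * (\<integral>\<theta>. kernel_deriv 1 (kernel_exponent x s \<theta>) t \<partial>Theta) =
        h s * weight s * bessel_laplacian \<gamma> (\<lambda>s. kernel_fun x s t) s"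
      using laplacian_kernel_fun[OF 0, of s x] by (cases "s \<in> pos_orthant") (auto simp: weight_def)
  qed
  also have "\<dots> = (\<integral>s. bessel_laplacian \<gamma> h s * weight s * kernel_fun x s t \<partial>lborel)"
    by (rule green_identity[OF K h0 h kf])
  finally show ?case
    unfolding One_nat_def[symmetric] heat_td_fubini[OF wh 0] heat_td_fubini[OF wL 0] kernel_fun_eq by simp
next
  case (Suc r t)
  have h2: "Ck_on (Suc (Suc 0)) pos_orthant h" using h by (simp only: numeral_2_eq_2)
  have wh: "wadm h" by (rule wadm_compact_support[OF K h0 Ck_on_continuous[OF h]])
  have wL: "wadm (bessel_laplacian \<gamma> h)"
    by (rule wadm_compact_support[OF K laplacian_support[OF K(1) h0] Ck_on_continuous[OF Ck_on_bessel_laplacian[OF h2]]])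
  have "((\<lambda>t. heat_td (bessel_laplacian \<gamma> h) r x t) has_real_derivative heat_td h (Suc (Suc r)) x t) (at t)"
    using heat_td_has_derivative[OF wh Suc.prems, of "Suc r" x]
  proof (rule DERIV_cong_ev[OF refl _ refl, THEN iffD1, rotated])
    show "\<forall>\<^sub>F t in nhds t. heat_td h (Suc r) x t = heat_td (bessel_laplacian \<gamma> h) r x t"
      using eventually_nhds_in_open[of "{0<..}" t] Suc by (auto elim: eventually_mono)
  qed
  from DERIV_unique[OF this heat_td_has_derivative[OF wL Suc.prems, of r x]] show ?case .
qed

lemma heat_td_laplacian_pow:
  assumes K: "compact K" "K \<subseteq> pos_orthant" and t: "0 < t"
  shows "(\<And>s. s \<notin> K \<Longrightarrow> h s = 0) \<Longrightarrow> Ck_on (2 * q) pos_orthant h \<Longrightarrow>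
    heat_td h (q + r) x t = heat_td ((bessel_laplacian \<gamma> ^^ q) h) r x t"
proof (induction q arbitrary: h)
  case (Suc q)
  have h2: "Ck_on 2 pos_orthant h" by (rule Ck_on_mono[OF _ Suc.prems(2)]) simp
  have L: "Ck_on (2 * q) pos_orthant (bessel_laplacian \<gamma> h)"
    using Suc.prems(2) by (intro Ck_on_bessel_laplacian) (simp del: Ck_on.simps)
  have "heat_td h (Suc (q + r)) x t = heat_td (bessel_laplacian \<gamma> h) (q + r) x t"
    by (rule heat_td_Suc_laplacian[OF K Suc.prems(1) h2 t])
  also have "\<dots> = heat_td ((bessel_laplacian \<gamma> ^^ q) (bessel_laplacian \<gamma> h)) r x t"
    by (rule Suc.IH[OF laplacian_support[OF K(1) Suc.prems(1)] L])
  finally show ?case by (simp add: funpow_swap1)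
qed simp

text \<open>Localisation: only the behaviour of \<open>f\<close> near \<open>x\<close> matters, so \<open>f\<close> may be multiplied by a
  cut-off, after which the time derivatives can be moved onto \<open>f\<close>.\<close>

lemma heat_td_initial:
  assumes f: "wadm f" and C: "Ck_on (2 * q) pos_orthant f" and x: "x \<in> pos_orthant"
  shows "((\<lambda>(y, t). t ^ r * heat_td f (q + r) y t) \<longlongrightarrow> (if r = 0 then (bessel_laplacian \<gamma> ^^ q) f x else 0)) (initially x)"
proof -
  obtain \<eta> d K where \<eta>: "d > 0" "compact K" "K \<subseteq> pos_orthant" "ball x d \<subseteq> pos_orthant" "\<And>s. s \<in> ball x d \<Longrightarrow> \<eta> s = 1"
    "\<And>s. s \<notin> K \<Longrightarrow> \<eta> s = 0" "Ck_on (2 * q) UNIV \<eta>"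
    using exists_cutoff[OF open_pos_orthant x, of "2 * q"] by blast
  define h where "h = (\<lambda>s. \<eta> s * f s)"
  define g where "g = (\<lambda>s. f s + (- 1) * h s)"
  have h0: "h s = 0" if "s \<notin> K" for s using \<eta>(6)[OF that] by (simp add: h_def)
  have hC: "Ck_on (2 * q) pos_orthant h" unfolding h_def
    by (intro Ck_on_mult open_pos_orthant C Ck_on_subset[OF subset_UNIV \<eta>(7)])
  have wh: "wadm h" by (rule wadm_compact_support[OF \<eta>(2,3) h0 Ck_on_continuous[OF hC]])
  have wg: "wadm g" unfolding g_def by (intro wadm_add wadm_cmult f wh)
  have L0: "(bessel_laplacian \<gamma> ^^ q) h s = 0" if "s \<notin> K" for s
    using that by (induction q arbitrary: s) (auto simp: h0 intro: laplacian_support[OF \<eta>(2)])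
  have Lc: "continuous_on pos_orthant ((bessel_laplacian \<gamma> ^^ q) h)"
    using Ck_on_bessel_laplacian_pow[of q 0 h \<gamma>] hC by simp
  have wL: "wadm ((bessel_laplacian \<gamma> ^^ q) h)"
    by (rule wadm_compact_support[OF \<eta>(2,3) L0 Lc])
  have Lx: "(bessel_laplacian \<gamma> ^^ q) h x = (bessel_laplacian \<gamma> ^^ q) f x"
    by (rule bessel_laplacian_pow_cong[of "ball x d"]) (use \<eta>(1,5) in \<open>auto simp: h_def\<close>)
  have "((bessel_laplacian \<gamma> ^^ q) h \<longlongrightarrow> (bessel_laplacian \<gamma> ^^ q) f x) (at x within pos_orthant)"
    using Lc x Lx unfolding continuous_on_def by force
  from heat_td_approx_identity[OF wL this Lx, of r]
  have 1: "((\<lambda>(y, t). t ^ r * heat_td ((bessel_laplacian \<gamma> ^^ q) h) r y t) \<longlongrightarrow> (if r = 0 then (bessel_laplacian \<gamma> ^^ q) f x else 0)) (initially x)" .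
  \<comment> \<open>The remainder g is zero on a ball around x, hence contributes nothing in the
    limit, whatever the number of time derivatives and the smoothness of f.\<close>
  have "((\<lambda>(y, t). heat_td g (q + r) y t) \<longlongrightarrow> 0) (initially x)"
    by (rule heat_td_off_diagonal[OF wg \<eta>(1)]) (simp add: g_def h_def \<eta>(5))
  moreover have "((\<lambda>z. snd z ^ r) \<longlongrightarrow> snd (x, 0::real) ^ r) (initially x)" by (intro tendsto_intros)
  ultimately have 2: "((\<lambda>z. snd z ^ r * (case z of (y, t) \<Rightarrow> heat_td g (q + r) y t)) \<longlongrightarrow> snd (x, 0::real) ^ r * 0) (initially x)"
    by (intro tendsto_mult)
  from tendsto_add[OF 1 2]
  have "((\<lambda>z. (case z of (y, t) \<Rightarrow> t ^ r * heat_td ((bessel_laplacian \<gamma> ^^ q) h) r y t) +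
      snd z ^ r * (case z of (y, t) \<Rightarrow> heat_td g (q + r) y t)) \<longlongrightarrow> (if r = 0 then (bessel_laplacian \<gamma> ^^ q) f x else 0)) (initially x)"
    by simp
  then show ?thesis
  proof (rule Lim_transform_eventually)
    show "\<forall>\<^sub>F z in initially x. (case z of (y, t) \<Rightarrow> t ^ r * heat_td ((bessel_laplacian \<gamma> ^^ q) h) r y t) +
      snd z ^ r * (case z of (y, t) \<Rightarrow> heat_td g (q + r) y t) = (case z of (y, t) \<Rightarrow> t ^ r * heat_td f (q + r) y t)"
      using eventually_initially[OF zero_less_one, of x]
    proof (eventually_elim, safe, goal_cases)
      case (1 y t)
      then have t: "0 < t" by auto
      have "heat_td f (q + r) y t = heat_td (\<lambda>s. h s + g s) (q + r) y t" by (simp add: g_def)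
      also have "\<dots> = heat_td ((bessel_laplacian \<gamma> ^^ q) h) r y t + heat_td g (q + r) y t"
        using heat_td_add[OF wh wg t, of "q + r" y] heat_td_laplacian_pow[OF \<eta>(2,3) t h0 hC, of r y] by simp
      finally show ?case by (simp add: distrib_left)
    qed
  qed
qed

end

section \<open>Powers of the heat operator, symmetry and Bessel functions\<close>

text \<open>The coefficient of D b is (k choose b) times the alternating sum of the binomials of k -
  b, which is zero unless b = k.\<close>

lemma binomial_inversion:
  fixes D :: "nat \<Rightarrow> real"
  shows "(\<Sum>l\<le>k. real (k choose l) * (\<Sum>j=0..l. (-1) ^ j * real (l choose j) * D (l - j))) = D k"
proof -
  have inner: "(\<Sum>j=0..l. (-1) ^ j * real (l choose j) * D (l - j)) = (\<Sum>b\<le>k. (-1) ^ (l - b) * real (l choose b) * D b)"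
    if "l \<le> k" for l
  proof -
    have "(\<Sum>j=0..l. (-1) ^ j * real (l choose j) * D (l - j)) = (\<Sum>b\<in>{..l}. (-1) ^ (l - b) * real (l choose b) * D b)"
    proof (rule sum.reindex_bij_witness[where i="\<lambda>b. l - b" and j="\<lambda>j. l - j"])
      fix j assume "j \<in> {0..l}"
      then show "(-1) ^ (l - (l - j)) * real (l choose (l - j)) * D (l - j) = (-1) ^ j * real (l choose j) * D (l - j)"
        by (simp add: binomial_symmetric[of j l, symmetric])
    qed auto
    \<comment> \<open>The range is enlarged to make it independent of l before the sums are swapped;
      for b > l the binomial is zero, so the truncated exponent l - b does no harm.\<close>
    also have "\<dots> = (\<Sum>b\<le>k. (-1) ^ (l - b) * real (l choose b) * D b)"
      using that by (intro sum.mono_neutral_left) auto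
    finally show ?thesis .
  qed
  have coeff: "(\<Sum>l\<le>k. real (k choose l) * ((-1) ^ (l - b) * real (l choose b))) = (if b = k then 1 else 0)" if "b \<le> k" for b
  proof -
    have "(\<Sum>l\<le>k. real (k choose l) * ((-1) ^ (l - b) * real (l choose b))) =
        (\<Sum>l=b..k. real (k choose l) * ((-1) ^ (l - b) * real (l choose b)))"
      by (intro sum.mono_neutral_right) auto
    also have "\<dots> = (\<Sum>l=b..k. real (k choose b) * ((-1) ^ (l - b) * real ((k - b) choose (l - b))))"
    proof (rule sum.cong)
      fix l assume "l \<in> {b..k}"
      then have "(k choose l) * (l choose b) = (k choose b) * ((k - b) choose (l - b))"
        by (intro choose_mult) auto
      then have "real (k choose l) * real (l choose b) = real (k choose b) * real ((k - b) choose (l - b))"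
        by (metis of_nat_mult)
      then show "real (k choose l) * ((-1) ^ (l - b) * real (l choose b)) = real (k choose b) * ((-1) ^ (l - b) * real ((k - b) choose (l - b)))"
        by (simp add: mult_ac)
    qed simp
    also have "\<dots> = real (k choose b) * (\<Sum>i\<le>k - b. (-1) ^ i * real ((k - b) choose i))"
      unfolding sum_distrib_left
      by (rule sum.reindex_bij_witness[where i="\<lambda>i. i + b" and j="\<lambda>l. l - b"]) (use that in auto)
    also have "\<dots> = (if b = k then 1 else 0)"
    proof (cases "b = k")
      case False
      with that have "k - b > 0" by simp
      from choose_alternating_sum[OF this, where 'a=real] False show ?thesis by simp
    qed simp
    finally show ?thesis .
  qed
  have "(\<Sum>l\<le>k. real (k choose l) * (\<Sum>j=0..l. (-1) ^ j * real (l choose j) * D (l - j))) =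
      (\<Sum>l\<le>k. \<Sum>b\<le>k. real (k choose l) * ((-1) ^ (l - b) * real (l choose b)) * D b)"
  proof (intro sum.cong refl)
    fix l assume "l \<in> {..k}"
    then have "l \<le> k" by simp
    show "real (k choose l) * (\<Sum>j=0..l. (-1) ^ j * real (l choose j) * D (l - j)) =
        (\<Sum>b\<le>k. real (k choose l) * ((-1) ^ (l - b) * real (l choose b)) * D b)"
      unfolding inner[OF \<open>l \<le> k\<close>] unfolding sum_distrib_left mult.assoc ..
  qed
  also have "\<dots> = (\<Sum>b\<le>k. (\<Sum>l\<le>k. real (k choose l) * ((-1) ^ (l - b) * real (l choose b))) * D b)"
    by (subst sum.swap) (simp add: sum_distrib_right)
  also have "\<dots> = (\<Sum>b\<le>k. if b = k then D b else 0)"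
    by (intro sum.cong refl) (simp add: coeff)
  also have "\<dots> = D k" by (simp add: sum.delta)
  finally show ?thesis .
qed

text \<open>The inductive step of Leibniz' rule, for sequences in which each function is the
  derivative of its predecessor; the coefficients combine by Pascal's rule.\<close>

lemma leibniz_step:
  fixes a b :: "nat \<Rightarrow> real \<Rightarrow> real"
  assumes "\<And>l. (a l has_real_derivative a (Suc l) t) (at t)" "\<And>l. (b l has_real_derivative b (Suc l) t) (at t)"
  shows "((\<lambda>t. \<Sum>l\<le>k. real (k choose l) * (a l t * b (k - l) t)) has_real_derivative
    (\<Sum>l\<le>Suc k. real (Suc k choose l) * (a l t * b (Suc k - l) t))) (at t)"
proof -
  define A B where "A = (\<lambda>l. a l t)" and "B = (\<lambda>l. b l t)"
  have "((\<lambda>t. \<Sum>l\<le>k. real (k choose l) * (a l t * b (k - l) t)) has_real_derivative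
      (\<Sum>l\<le>k. real (k choose l) * (A (Suc l) * B (k - l) + B (Suc (k - l)) * A l))) (at t)"
    unfolding A_def B_def by (intro DERIV_sum DERIV_cmult DERIV_mult assms)
  moreover have "(\<Sum>l\<le>k. real (k choose l) * (A (Suc l) * B (k - l) + B (Suc (k - l)) * A l)) =
      (\<Sum>l\<le>Suc k. real (Suc k choose l) * (A l * B (Suc k - l)))"
  proof -
    have "(\<Sum>l\<le>Suc k. real (Suc k choose l) * (A l * B (Suc k - l))) =
        A 0 * B (Suc k) + (\<Sum>l\<le>k. real (k choose l) * (A (Suc l) * B (k - l))) + (\<Sum>l\<le>k. real (k choose Suc l) * (A (Suc l) * B (k - l)))"
      by (subst sum.atMost_Suc_shift) (simp add: sum.distrib algebra_simps)
    also have "A 0 * B (Suc k) + (\<Sum>l\<le>k. real (k choose l) * (A (Suc l) * B (k - l))) + (\<Sum>l\<le>k. real (k choose Suc l) * (A (Suc l) * B (k - l))) =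
        (\<Sum>l\<le>k. real (k choose l) * (A (Suc l) * B (k - l))) + (\<Sum>l\<le>Suc k. real (k choose l) * (A l * B (Suc k - l)))"
    proof -
      have "(\<Sum>l\<le>Suc k. real (k choose l) * (A l * B (Suc k - l))) =
          A 0 * B (Suc k) + (\<Sum>l\<le>k. real (k choose Suc l) * (A (Suc l) * B (k - l)))"
        by (subst sum.atMost_Suc_shift) simp
      then show ?thesis by simp
    qed
    also have "(\<Sum>l\<le>Suc k. real (k choose l) * (A l * B (Suc k - l))) = (\<Sum>l\<le>k. real (k choose l) * (A l * B (Suc (k - l))))"
      by (simp add: Suc_diff_le)
    finally show ?thesis by (simp add: sum.distrib algebra_simps)
  qed
  ultimately show ?thesis by (simp add: A_def B_def)
qed

section \<open>Locality of the iterated operators and parity under reflection\<close>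

lemma bessel_heat_op_cong:
  assumes "open U" "open J" "\<And>x t. x \<in> U \<Longrightarrow> t \<in> J \<Longrightarrow> u x t = v x t" "x \<in> U" "t \<in> J"
  shows "bessel_heat_op \<gamma> u x t = bessel_heat_op \<gamma> v x t"
proof -
  have "time_deriv u x t = time_deriv v x t"
    by (rule time_deriv_cong_open[OF assms(2,5)]) (use assms in auto)
  moreover have "bessel_laplacian \<gamma> (\<lambda>y. u y t) x = bessel_laplacian \<gamma> (\<lambda>y. v y t) x"
    by (rule bessel_laplacian_cong[OF assms(1,4)]) (use assms in auto)
  ultimately show ?thesis by (simp add: bessel_heat_op_def)
qed

lemma bessel_heat_op_pow_cong:
  assumes "open U" "open J" "\<And>x t. x \<in> U \<Longrightarrow> t \<in> J \<Longrightarrow> u x t = v x t"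
  shows "x \<in> U \<Longrightarrow> t \<in> J \<Longrightarrow> (bessel_heat_op \<gamma> ^^ m) u x t = (bessel_heat_op \<gamma> ^^ m) v x t"
proof (induction m arbitrary: x t)
  case (Suc m)
  then show ?case by (auto intro: bessel_heat_op_cong[OF assms(1,2)])
qed (use assms(3) in simp)

lemma partial_pow_cong:
  assumes "open U" "\<And>y. y \<in> U \<Longrightarrow> f y = g y"
  shows "x \<in> U \<Longrightarrow> (partial k ^^ l) f x = (partial k ^^ l) g x"
proof (induction l arbitrary: x)
  case (Suc l)
  then show ?case by (auto intro: partial_cong_open[OF assms(1)])
qed (use assms(2) in simp)

definition refl_coord :: "'n \<Rightarrow> real^'n \<Rightarrow> real^'n" where
  "refl_coord j x = (\<chi> i. if i = j then - x $ i else x $ i)"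

lemma refl_coord_line: "refl_coord j x + h *\<^sub>R axis j 1 = refl_coord j (x + (- h) *\<^sub>R axis j 1)"
  by (auto simp: refl_coord_def vec_eq_iff axis_def)

lemma refl_coord_partial:
  assumes "\<And>x. f (refl_coord j x) = c * f x" "\<And>x. has_partial j f (g x) x"
  shows "g (refl_coord j x) = - c * g x"
proof -
  have "((\<lambda>h. f (x + (- h) *\<^sub>R axis j 1)) has_real_derivative g x * (- 1)) (at 0)"
  proof -
    have 1: "((\<lambda>h. f (x + h *\<^sub>R axis j 1)) has_real_derivative g x) (at (- 0))" using assms(2)[of x] by simp
    have 2: "(uminus has_real_derivative - 1) (at (0::real))" by (auto intro!: derivative_eq_intros)
    show ?thesis by (rule DERIV_chain2[OF 1 2])
  qed
  from DERIV_cmult[OF this, of c]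
  have "has_partial j f (c * (g x * (- 1))) (refl_coord j x)"
    unfolding refl_coord_line assms(1) .
  from DERIV_unique[OF assms(2) this] show ?thesis by simp
qed

context gauss_family begin

text \<open>Each derivative in direction j reverses the parity under the reflection of that
  coordinate. The function G does not depend on t, so it can serve for the joint limit in (y, t) at
  a face.\<close>

lemma V_partial_pow:
  assumes "F \<in> V"
  shows "\<exists>G\<in>V. \<forall>t>0. (partial j ^^ l) (\<lambda>y. F y t) = (\<lambda>y. G y t) \<and>
    ((\<forall>x. F (refl_coord j x) t = F x t) \<longrightarrow> (\<forall>x. G (refl_coord j x) t = (-1) ^ l * G x t))"
proof (induction l)
  case 0
  then show ?case using assms by auto
next
  case (Suc l)
  then obtain G where G: "G \<in> V" "\<And>t. t > 0 \<Longrightarrow> (partial j ^^ l) (\<lambda>y. F y t) = (\<lambda>y. G y t)"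
    "\<And>t. t > 0 \<Longrightarrow> (\<forall>x. F (refl_coord j x) t = F x t) \<Longrightarrow> (\<forall>x. G (refl_coord j x) t = (-1) ^ l * G x t)"
    by auto
  obtain H where H: "H \<in> V" "\<And>x t. t > 0 \<Longrightarrow> has_partial j (\<lambda>y. G y t) (H x t) x"
    using V_partial[OF G(1), of j] by auto
  have "(partial j ^^ Suc l) (\<lambda>y. F y t) = (\<lambda>y. H y t)" if "t > 0" for t
    using G(2)[OF that] partialI[OF H(2)[OF that]] by auto
  moreover have "\<forall>x. H (refl_coord j x) t = (-1) ^ Suc l * H x t" if "t > 0" "\<forall>x. F (refl_coord j x) t = F x t" for t
    using refl_coord_partial[of "\<lambda>y. G y t" j "(-1) ^ l" "\<lambda>x. H x t"] G(3)[OF that] H(2)[OF that(1)] by auto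
  ultimately show ?case using H(1) by blast
qed

end

section \<open>Identification of the given formula with the heat extension\<close>

context bessel_heat begin

lemma bessel_I_eq: "bessel_I \<nu> z = (z / 2) powr \<nu> * bessel_series \<nu> z"
  by (simp add: bessel_I_def bessel_series_def)

text \<open>The power in I_\<gamma>(x s / (2 t)) splits as x^\<gamma> s^\<gamma> (4 t)^(-\<gamma>).
  The first factor cancels the prefactor of the solution formula, the second completes
  s^(\<gamma>+1) to the weight, and the third belongs to the normalisation.\<close>

lemma heat_G_eq:
  assumes "x \<in> pos_orthant" "s \<in> pos_orthant" "0 < t"
  shows "heat_G \<gamma> x s t = (\<Prod>j\<in>UNIV. (x $ j) powr (\<gamma> $ j)) * (\<Prod>j\<in>UNIV. (4 * t) powr (- \<gamma> $ j)) *
    (weight s * bessel_gauss x s t)"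
proof -
  have "(s $ j) powr (\<gamma> $ j + 1) * bessel_I (\<gamma> $ j) (x $ j * s $ j / (2 * t)) =
    (x $ j) powr (\<gamma> $ j) * (4 * t) powr (- \<gamma> $ j) * ((s $ j) powr (2 * \<gamma> $ j + 1) * bessel_series (\<gamma> $ j) (x $ j * s $ j / (2 * t)))" for j
  proof -
    have pos: "0 < x $ j" "0 < s $ j" using assms pos_orthantD by auto
    have "(x $ j * s $ j / (2 * t) / 2) powr (\<gamma> $ j) = (x $ j * s $ j / (4 * t)) powr (\<gamma> $ j)" by simp
    also have "\<dots> = (x $ j) powr (\<gamma> $ j) * (s $ j) powr (\<gamma> $ j) * (4 * t) powr (- \<gamma> $ j)"
      unfolding powr_divide powr_mult[of "x $ j"] powr_minus_divide by simp
    finally have 1: "(x $ j * s $ j / (2 * t) / 2) powr (\<gamma> $ j) = (x $ j) powr (\<gamma> $ j) * (s $ j) powr (\<gamma> $ j) * (4 * t) powr (- \<gamma> $ j)" .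
    have 2: "(s $ j) powr (\<gamma> $ j + 1) * (s $ j) powr (\<gamma> $ j) = (s $ j) powr (2 * \<gamma> $ j + 1)"
      by (simp add: powr_add[symmetric] algebra_simps)
    have "p * (a * q * c * d) = a * c * ((p * q) * d)" for p a q c d :: real
      by (simp only: mult_ac)
    then show ?thesis unfolding bessel_I_eq 1 2[symmetric] .
  qed
  then show ?thesis using assms(2) by (simp add: heat_G_def weight_def prod.distrib mult_ac)
qed

lemma indicator_heat_G:
  assumes "x \<in> pos_orthant" "0 < t"
  shows "indicator pos_orthant s *\<^sub>R (f s * heat_G \<gamma> x s t) = (\<Prod>j\<in>UNIV. (x $ j) powr (\<gamma> $ j)) * (\<Prod>j\<in>UNIV. (4 * t) powr (- \<gamma> $ j)) *
    (f s * weight s * bessel_gauss x s t)"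
  by (cases "s \<in> pos_orthant") (simp_all add: heat_G_eq[OF assms(1) _ assms(2)] weight_def[of s])

lemma heat_ext_eq_integral_heat_G:
  assumes f: "wadm f" and x: "x \<in> pos_orthant" and t: "0 < t"
  shows "1 / (2 * t) ^ CARD('n) * (\<Prod>j\<in>UNIV. (x $ j) powr (- (\<gamma> $ j))) * (LINT s:pos_orthant|lborel. f s * heat_G \<gamma> x s t)
    = heat_ext f x t"
proof -
  define J where "J = (\<integral>s. f s * weight s * bessel_gauss x s t \<partial>lborel)"
  have 1: "(LINT s:pos_orthant|lborel. f s * heat_G \<gamma> x s t) = (\<Prod>j\<in>UNIV. (x $ j) powr (\<gamma> $ j)) * (\<Prod>j\<in>UNIV. (4 * t) powr (- \<gamma> $ j)) * J"
    unfolding set_lebesgue_integral_def indicator_heat_G[OF x t] J_def by (rule integral_mult_right_zero)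
  have 2: "(\<Prod>j\<in>UNIV. (x $ j) powr (- (\<gamma> $ j))) * (\<Prod>j\<in>UNIV. (x $ j) powr (\<gamma> $ j)) = 1"
    using pos_orthantD[OF x] by (simp add: prod.distrib[symmetric] powr_add[symmetric] less_imp_neq[symmetric])
  have 3: "1 / (2 * t) ^ CARD('n) * (\<Prod>j\<in>UNIV. (4 * t) powr (- \<gamma> $ j)) = mass_const * t powr (- mass_exponent)"
  proof -
    have "(\<Prod>j\<in>UNIV. (4 * t) powr (- \<gamma> $ j)) = (\<Prod>j\<in>UNIV. 4 powr (- \<gamma> $ j)) * (\<Prod>j\<in>UNIV. t powr (- \<gamma> $ j))"
      by (simp only: powr_mult prod.distrib)
    also have "(\<Prod>j\<in>UNIV. t powr (- \<gamma> $ j)) = t powr (- (\<Sum>j\<in>UNIV. \<gamma> $ j))"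
      using t by (simp add: powr_sum[symmetric] sum_negf)
    finally have 1: "(\<Prod>j\<in>UNIV. (4 * t) powr (- \<gamma> $ j)) = (\<Prod>j\<in>UNIV. 4 powr (- \<gamma> $ j)) * t powr (- (\<Sum>j\<in>UNIV. \<gamma> $ j))" .
    have "- mass_exponent = - real CARD('n) + - (\<Sum>j\<in>UNIV. \<gamma> $ j)" by (simp add: mass_exponent_def)
    then have "t powr (- mass_exponent) = t powr (- real CARD('n)) * t powr (- (\<Sum>j\<in>UNIV. \<gamma> $ j))"
      by (simp only: powr_add)
    also have "t powr (- real CARD('n)) = 1 / t ^ CARD('n)" using t by (simp add: powr_minus_divide powr_realpow)
    finally show ?thesis unfolding 1 mass_const_def by (simp add: power_mult_distrib power_one_over)
  qed
  have "a * b * (c * d * J) = (b * c) * ((a * d) * J)" for a b c d :: real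
    by (simp only: mult_ac)
  from this[of "1 / (2 * t) ^ CARD('n)"] show ?thesis
    unfolding heat_ext_eq[OF f t] J_def[symmetric] 1 by (simp only: 2 3 mult_1)
qed

lemma measurable_mult_weight:
  assumes "continuous_on pos_orthant f"
  shows "(\<lambda>s. f s * weight s) \<in> borel_measurable borel"
proof -
  have "(\<lambda>s. indicator pos_orthant s *\<^sub>R f s) \<in> borel_measurable borel"
    using assms by (intro borel_measurable_continuous_on_indicator borel_open open_pos_orthant)
  then have "(\<lambda>s. (indicator pos_orthant s *\<^sub>R f s) * weight s) \<in> borel_measurable borel"
    by (intro borel_measurable_times weight_measurable)
  moreover have "(\<lambda>s. (indicator pos_orthant s *\<^sub>R f s) * weight s) = (\<lambda>s. f s * weight s)"
    by (auto simp: fun_eq_iff weight_def indicator_def)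
  ultimately show ?thesis by simp
qed

lemma wadm_bounded:
  assumes "continuous_on pos_orthant f" "bounded (f ` pos_orthant)"
  shows "wadm f"
proof -
  obtain C where C: "0 < C" "\<And>s. s \<in> pos_orthant \<Longrightarrow> norm (f s) \<le> C"
    using assms(2) by (auto simp: bounded_pos)
  show ?thesis
    by (rule wadm_bound[OF wadm_cmult[OF wadm_one, of C] measurable_mult_weight[OF assms(1)]])
       (use C in auto)
qed

text \<open>The Bessel series is bounded below by its value 1 / Gamma(\<gamma> + 1) at zero.
  Existence of the integral at one point x and at time 1/(4 e) thus gives integrability against exp
  (- e |s|^2), and all e > 0 are reached by varying t.\<close>

lemma wadm_integrable_heat_G:
  assumes c: "continuous_on pos_orthant f"
    and int: "\<And>x t. x \<in> pos_orthant \<Longrightarrow> 0 < t \<Longrightarrow> set_integrable lborel pos_orthant (\<lambda>s. f s * heat_G \<gamma> x s t)"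
  shows "wadm f"
  unfolding wadm_def
proof (intro conjI allI impI)
  show m: "(\<lambda>s. f s * weight s) \<in> borel_measurable borel" by (rule measurable_mult_weight[OF c])
  fix e :: real assume e: "e > 0"
  define t where "t = 1 / (4 * e)"
  have t: "0 < t" using e by (simp add: t_def)
  define x :: "real^'n" where "x = (\<chi> j. 1)"
  have x: "x \<in> pos_orthant" by (simp add: pos_orthant_def x_def)
  define A where "A = (\<Prod>j\<in>UNIV. (x $ j) powr (\<gamma> $ j)) * (\<Prod>j\<in>UNIV. (4 * t) powr (- \<gamma> $ j))"
  define c0 where "c0 = (\<Prod>j\<in>UNIV. 1 / Gamma (\<gamma> $ j + 1))"
  define E where "E = exp (- (norm x)\<^sup>2 / (4 * t))"
  have A: "A > 0" using t by (auto simp: A_def x_def intro!: mult_pos_pos prod_pos)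
  have G: "0 < 1 / Gamma (\<gamma> $ j + 1)" for j
    using Gamma_real_pos[of "\<gamma> $ j + 1"] gamma_gt'[of j] by simp
  have c0: "c0 > 0" unfolding c0_def by (intro prod_pos G)
  have c0_le: "c0 \<le> (\<Prod>j\<in>UNIV. bessel_series (\<gamma> $ j) (z j))" for z
    unfolding c0_def using G by (intro prod_mono conjI bessel_series_ge gamma_gt' less_imp_le)
  have "integrable lborel (\<lambda>s. A * (f s * weight s * bessel_gauss x s t))"
    using int[OF x t] unfolding set_integrable_def indicator_heat_G[OF x t] A_def .
  then have "integrable lborel (\<lambda>s. 1 / (A * E * c0) * (A * (f s * weight s * bessel_gauss x s t)))"
    by (rule integrable_mult_right)
  then show "integrable lborel (\<lambda>s. f s * weight s * exp (- e * (norm s)\<^sup>2))"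
  proof (rule Bochner_Integration.integrable_bound)
    show "(\<lambda>s. f s * weight s * exp (- e * (norm s)\<^sup>2)) \<in> borel_measurable lborel" using m by measurable
    show "AE s in lborel. norm (f s * weight s * exp (- e * (norm s)\<^sup>2)) \<le>
      norm (1 / (A * E * c0) * (A * (f s * weight s * bessel_gauss x s t)))"
    proof (rule AE_I2)
      fix s :: "real^'n"
      define P where "P = (\<Prod>j\<in>UNIV. bessel_series (\<gamma> $ j) (x $ j * s $ j / (2 * t)))"
      define W where "W = \<bar>f s * weight s\<bar> * exp (- e * (norm s)\<^sup>2)"
      have P: "c0 \<le> P" unfolding P_def by (rule c0_le)
      have W0: "0 \<le> W" by (simp add: W_def)
      have "exp (- ((norm x)\<^sup>2 + (norm s)\<^sup>2) / (4 * t)) = E * exp (- e * (norm s)\<^sup>2)"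
        using e by (simp add: E_def t_def exp_add[symmetric] algebra_simps)
      then have "1 / (A * E * c0) * (A * (f s * weight s * (exp (- ((norm x)\<^sup>2 + (norm s)\<^sup>2) / (4 * t)) * P))) =
          (f s * weight s * exp (- e * (norm s)\<^sup>2)) * (P / c0)"
        using A c0 by (simp add: E_def)
      then have "norm (1 / (A * E * c0) * (A * (f s * weight s * (exp (- ((norm x)\<^sup>2 + (norm s)\<^sup>2) / (4 * t)) * P)))) = W * (P / c0)"
        using P c0 by (simp add: W_def abs_mult)
      moreover have "W * 1 \<le> W * (P / c0)" using W0 P c0 by (intro mult_left_mono) auto
      ultimately show "norm (f s * weight s * exp (- e * (norm s)\<^sup>2)) \<le>
        norm (1 / (A * E * c0) * (A * (f s * weight s * bessel_gauss x s t)))"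
        unfolding P_def[symmetric] by (simp add: W_def abs_mult)
    qed
  qed
qed

text \<open>After removal of the real powers, x enters only through its norm and through even series
  in x_j.\<close>

lemma heat_ext_even:
  assumes "wadm f" "0 < t"
  shows "heat_ext f (refl_coord j x) t = heat_ext f x t"
proof -
  have "(norm (refl_coord j x))\<^sup>2 = (norm x)\<^sup>2"
    unfolding power2_norm_eq_inner inner_vec_def by (intro sum.cong) (auto simp: refl_coord_def)
  moreover have "bessel_series (\<gamma> $ i) (refl_coord j x $ i * s $ i / (2 * t)) = bessel_series (\<gamma> $ i) (x $ i * s $ i / (2 * t))" for i s
    using bessel_series_even[of "\<gamma> $ i" "x $ i * s $ i / (2 * t)"] by (auto simp: refl_coord_def)
  ultimately show ?thesis unfolding heat_ext_eq[OF assms] by simp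
qed

lemma heat_ext_solves:
  assumes f: "wadm f" and x: "x \<in> pos_orthant" and t: "0 < t"
  shows "bessel_heat_op \<gamma> (heat_ext f) x t = 0"
proof -
  define F where "F = (\<lambda>x t. t powr (- mass_exponent) * S.Phi (wext f) x t)"
  have F: "F \<in> S.V" unfolding F_def by (intro S.V.intros wext_adm f)
  obtain G where G: "(F x has_real_derivative G x t) (at t)" using S.V_time[OF F] t by auto
  have "time_deriv (\<lambda>x t. mass_const * F x t) x t = mass_const * time_deriv F x t"
    unfolding time_deriv_def using DERIV_imp_deriv[OF DERIV_cmult[OF G, of mass_const]] DERIV_imp_deriv[OF G] by simp
  moreover have "bessel_laplacian \<gamma> (\<lambda>y. mass_const * F y t) x = mass_const * bessel_laplacian \<gamma> (\<lambda>y. F y t) x"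
    using bessel_laplacian_linear[of "{()}" "\<lambda>_ y. F y t" x \<gamma> "\<lambda>_. mass_const"] x
      Ck_on_subset[OF subset_UNIV S.V_Ck_on[OF F t]] by simp
  ultimately have "bessel_heat_op \<gamma> (\<lambda>x t. mass_const * F x t) x t = mass_const * bessel_heat_op \<gamma> F x t"
    by (simp add: bessel_heat_op_def algebra_simps)
  then show ?thesis
    using bessel_heat_op_heat_ext[OF f x t] by (simp add: F_def heat_ext_def[abs_def])
qed

text \<open>Since each v_k solves the heat equation, the operator sees only the factors t^k / k! and
  lowers each of them by one degree; the sum reappears with v shifted by one index.\<close>

lemma bessel_heat_op_time_polynomial:
  assumes v: "\<And>k. v k \<in> S.V" and sol: "\<And>k x t. x \<in> pos_orthant \<Longrightarrow> 0 < t \<Longrightarrow> bessel_heat_op \<gamma> (v k) x t = 0"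
    and x: "x \<in> pos_orthant" and t: "0 < t"
  shows "bessel_heat_op \<gamma> (\<lambda>x t. \<Sum>k<Suc m. t ^ k / fact k * v k x t) x t = (\<Sum>k<m. t ^ k / fact k * v (Suc k) x t)"
proof -
  have "\<exists>G. (v k x has_real_derivative G) (at t)" for k using S.V_time[OF v, of k] t by auto
  then obtain G where G: "\<And>k. (v k x has_real_derivative G k) (at t)" by metis
  have td: "time_deriv (v k) x t = G k" for k unfolding time_deriv_def by (rule DERIV_imp_deriv[OF G])
  have "((\<lambda>t. \<Sum>k<Suc m. t ^ k / fact k * v k x t) has_real_derivative
      (\<Sum>k<Suc m. real k * t ^ (k - 1) / fact k * v k x t + t ^ k / fact k * G k)) (at t)"
  proof (rule DERIV_sum)
    fix k
    have "((\<lambda>t. t ^ k / fact k) has_real_derivative real k * t ^ (k - 1) / fact k) (at t)"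
      using DERIV_cdivide[OF DERIV_pow[of k t], of "fact k"] by simp
    from DERIV_mult[OF this G[of k]]
    show "((\<lambda>t. t ^ k / fact k * v k x t) has_real_derivative real k * t ^ (k - 1) / fact k * v k x t + t ^ k / fact k * G k) (at t)"
      by (simp add: mult.commute)
  qed
  then have 1: "time_deriv (\<lambda>x t. \<Sum>k<Suc m. t ^ k / fact k * v k x t) x t =
      (\<Sum>k<Suc m. real k * t ^ (k - 1) / fact k * v k x t + t ^ k / fact k * G k)"
    unfolding time_deriv_def by (rule DERIV_imp_deriv)
  have 2: "bessel_laplacian \<gamma> (\<lambda>y. \<Sum>k<Suc m. t ^ k / fact k * v k y t) x = (\<Sum>k<Suc m. t ^ k / fact k * bessel_laplacian \<gamma> (\<lambda>y. v k y t) x)"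
    by (intro bessel_laplacian_linear x Ck_on_subset[OF subset_UNIV S.V_Ck_on[OF v t]]) auto
  have "G k - bessel_laplacian \<gamma> (\<lambda>y. v k y t) x = 0" for k
    using sol[OF x t, of k] by (simp add: bessel_heat_op_def td)
  then have 3: "G k = bessel_laplacian \<gamma> (\<lambda>y. v k y t) x" for k by simp
  have "bessel_heat_op \<gamma> (\<lambda>x t. \<Sum>k<Suc m. t ^ k / fact k * v k x t) x t = (\<Sum>k<Suc m. real k * t ^ (k - 1) / fact k * v k x t)"
    unfolding bessel_heat_op_def 1 2 3 sum.distrib by simp
  also have "\<dots> = (\<Sum>k<m. real (Suc k) * t ^ k / fact (Suc k) * v (Suc k) x t)"
    by (subst sum.lessThan_Suc_shift) simp
  also have "\<dots> = (\<Sum>k<m. t ^ k / fact k * v (Suc k) x t)"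
  proof (intro sum.cong refl)
    fix k
    have "fact (Suc k) = real (Suc k) * fact k" by (rule fact_Suc)
    then show "real (Suc k) * t ^ k / fact (Suc k) * v (Suc k) x t = t ^ k / fact k * v (Suc k) x t"
      by (simp del: of_nat_Suc fact_Suc)
  qed
  finally show ?thesis .
qed

text \<open>The innermost operator is applied first and the induction hypothesis used for the
  shifted family. The intermediate equality holds only on the orthant and for t > 0, so locality of
  the remaining powers is needed.\<close>

lemma bessel_heat_op_pow_time_polynomial:
  assumes "\<And>k. v k \<in> S.V" "\<And>k x t. x \<in> pos_orthant \<Longrightarrow> 0 < t \<Longrightarrow> bessel_heat_op \<gamma> (v k) x t = 0"
    "x \<in> pos_orthant" "0 < t"
  shows "(bessel_heat_op \<gamma> ^^ m) (\<lambda>x t. \<Sum>k<m. t ^ k / fact k * v k x t) x t = 0"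
  using assms(1,2)
proof (induction m arbitrary: v)
  case (Suc m)
  have "(bessel_heat_op \<gamma> ^^ Suc m) (\<lambda>x t. \<Sum>k<Suc m. t ^ k / fact k * v k x t) x t =
      (bessel_heat_op \<gamma> ^^ m) (bessel_heat_op \<gamma> (\<lambda>x t. \<Sum>k<Suc m. t ^ k / fact k * v k x t)) x t"
    by (simp only: funpow_Suc_right o_apply)
  also have "\<dots> = (bessel_heat_op \<gamma> ^^ m) (\<lambda>x t. \<Sum>k<m. t ^ k / fact k * v (Suc k) x t) x t"
    by (rule bessel_heat_op_pow_cong[OF open_pos_orthant open_greaterThan[of 0]])
       (use bessel_heat_op_time_polynomial[OF Suc.prems] assms in auto)
  also have "\<dots> = 0" by (rule Suc.IH[of "\<lambda>k. v (Suc k)"]) (use Suc.prems in auto)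
  finally show ?case .
qed simp

text \<open>Of the q derivatives at most p are moved onto f, and the remaining r \<le> e are paid
  for with t^r. If r < e, a further power of t tends to zero; if r = e, then r \<ge> 1 and the limit
  in \<open>heat_td_initial\<close> is already zero.\<close>

lemma heat_td_initial_decay:
  assumes f: "wadm f" and C: "Ck_on (2 * p) pos_orthant f" and x: "x \<in> pos_orthant" and e: "1 \<le> e" "q \<le> p + e"
  shows "((\<lambda>(y, t). t ^ e * heat_td f q y t) \<longlongrightarrow> 0) (initially x)"
proof -
  define p' r where "p' = min q p" and "r = q - p'"
  have pr: "q = p' + r" "r \<le> e" "p' \<le> p" using e by (auto simp: p'_def r_def)
  have C': "Ck_on (2 * p') pos_orthant f" by (rule Ck_on_mono[OF _ C]) (use pr in simp)
  define L where "L = (if r = 0 then (bessel_laplacian \<gamma> ^^ p') f x else 0)"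
  have 1: "((\<lambda>(y, t). t ^ r * heat_td f q y t) \<longlongrightarrow> L) (initially x)"
    using heat_td_initial[OF f C' x, of r] unfolding pr(1) L_def .
  have "((\<lambda>z. snd z ^ (e - r)) \<longlongrightarrow> snd (x, 0::real) ^ (e - r)) (initially x)" by (intro tendsto_intros)
  from tendsto_mult[OF this 1]
  have "((\<lambda>z. snd z ^ (e - r) * (case z of (y, t) \<Rightarrow> t ^ r * heat_td f q y t)) \<longlongrightarrow> 0 ^ (e - r) * L) (initially x)" by simp
  moreover have "0 ^ (e - r) * L = 0" using e pr by (cases "r = e") (auto simp: L_def)
  moreover have "(\<lambda>z. snd z ^ (e - r) * (case z of (y, t) \<Rightarrow> t ^ r * heat_td f q y t)) = (\<lambda>(y, t). t ^ e * heat_td f q y t)"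
    using pr(2) by (auto simp: fun_eq_iff mult.assoc[symmetric] power_add[symmetric])
  ultimately show ?thesis by simp
qed

end

section \<open>The polyparabolic Cauchy problem\<close>

text \<open>The datum \<phi>_(k-j) has 2(m - k + j) - 1 derivatives, and the j-th power of the
  operator consumes 2 j of them; every term keeps the same number.\<close>

lemma Ck_on_cauchy_data:
  assumes "\<And>j. j < m \<Longrightarrow> Ck_on (2 * (m - j) - 1) pos_orthant (\<phi> j)" "k < m"
  shows "Ck_on (2 * (m - k) - 1) pos_orthant (cauchy_data \<gamma> \<phi> k)"
proof -
  have "Ck_on (2 * (m - k) - 1) pos_orthant ((bessel_laplacian \<gamma> ^^ j) (\<phi> (k - j)))" if "j \<le> k" for j
  proof (rule Ck_on_bessel_laplacian_pow, rule Ck_on_mono)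
    show "Ck_on (2 * (m - (k - j)) - 1) pos_orthant (\<phi> (k - j))" by (rule assms(1)) (use assms(2) in simp)
  qed (use assms(2) that in auto)
  then show ?thesis
    unfolding cauchy_data_def[abs_def]
    by (intro Ck_on_sum Ck_on_mult Ck_on_const open_pos_orthant) auto
qed

text \<open>All terms carry \<phi>_b under the same power k - b of the operator, whichever l
  produced them, so linearity reduces the identity to binomial inversion of numbers.\<close>

lemma cauchy_data_inversion:
  assumes "\<And>j. j < m \<Longrightarrow> Ck_on (2 * (m - j) - 1) pos_orthant (\<phi> j)" "k < m" "x \<in> pos_orthant"
  shows "(\<Sum>l\<le>k. real (k choose l) * (bessel_laplacian \<gamma> ^^ (k - l)) (cauchy_data \<gamma> \<phi> l) x) = \<phi> k x"
proof -
  define D where "D = (\<lambda>b. (bessel_laplacian \<gamma> ^^ (k - b)) (\<phi> b) x)"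
  have "(bessel_laplacian \<gamma> ^^ (k - l)) (cauchy_data \<gamma> \<phi> l) x = (\<Sum>j=0..l. (-1) ^ j * real (l choose j) * D (l - j))"
    if l: "l \<le> k" for l
  proof -
    have "(bessel_laplacian \<gamma> ^^ (k - l)) (cauchy_data \<gamma> \<phi> l) x =
        (\<Sum>j=0..l. (-1) ^ j * real (l choose j) * (bessel_laplacian \<gamma> ^^ (k - l)) ((bessel_laplacian \<gamma> ^^ j) (\<phi> (l - j))) x)"
      unfolding cauchy_data_def[abs_def]
    proof (rule bessel_laplacian_pow_linear[OF _ _ assms(3)])
      show "Ck_on (2 * (k - l)) pos_orthant ((bessel_laplacian \<gamma> ^^ j) (\<phi> (l - j)))" if "j \<in> {0..l}" for j
      proof (rule Ck_on_bessel_laplacian_pow, rule Ck_on_mono)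
        show "Ck_on (2 * (m - (l - j)) - 1) pos_orthant (\<phi> (l - j))" by (rule assms(1)) (use assms(2) l in simp)
      qed (use assms(2) that l in auto)
    qed simp
    also have "\<dots> = (\<Sum>j=0..l. (-1) ^ j * real (l choose j) * D (l - j))"
    proof (intro sum.cong refl)
      fix j assume "j \<in> {0..l}"
      then have "k - (l - j) = (k - l) + j" using l by auto
      then show "(-1) ^ j * real (l choose j) * (bessel_laplacian \<gamma> ^^ (k - l)) ((bessel_laplacian \<gamma> ^^ j) (\<phi> (l - j))) x =
          (-1) ^ j * real (l choose j) * D (l - j)"
        by (simp add: D_def funpow_add)
    qed
    finally show ?thesis .
  qed
  then have "(\<Sum>l\<le>k. real (k choose l) * (bessel_laplacian \<gamma> ^^ (k - l)) (cauchy_data \<gamma> \<phi> l) x) =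
      (\<Sum>l\<le>k. real (k choose l) * (\<Sum>j=0..l. (-1) ^ j * real (l choose j) * D (l - j)))"
    by (intro sum.cong refl) auto
  also have "\<dots> = \<phi> k x" unfolding binomial_inversion by (simp add: D_def)
  finally show ?thesis .
qed

text \<open>The l-th derivative of t^i / i!, with the zero case explicit since i - l is
  truncated.\<close>

definition monomial_deriv :: "nat \<Rightarrow> nat \<Rightarrow> real \<Rightarrow> real" where
  "monomial_deriv i l t = (if l \<le> i then t ^ (i - l) / fact (i - l) else 0)"

lemma monomial_deriv_has_derivative: "(monomial_deriv i l has_real_derivative monomial_deriv i (Suc l) t) (at t)"
proof (cases "Suc l \<le> i")
  case True
  then obtain n where n: "i - l = Suc n" "i - Suc l = n" by (metis Suc_diff_Suc Suc_le_lessD)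
  have "((\<lambda>t. t ^ Suc n / fact (Suc n)) has_real_derivative real (Suc n) * t ^ n / fact (Suc n)) (at t)"
    using DERIV_cdivide[OF DERIV_pow[of "Suc n" t], of "fact (Suc n)"] by simp
  moreover have "real (Suc n) * t ^ n / fact (Suc n) = t ^ n / fact n"
    unfolding fact_Suc by (simp del: of_nat_Suc)
  ultimately show ?thesis using True by (simp add: monomial_deriv_def[abs_def] n del: fact_Suc)
next
  case False
  then have "monomial_deriv i l = (\<lambda>t. if l = i then 1 else 0)" by (auto simp: monomial_deriv_def[abs_def])
  then show ?thesis using False by (auto simp: monomial_deriv_def)
qed

context bessel_heat begin

lemma time_deriv_pow_polynomial:
  assumes f: "\<And>i. i < m \<Longrightarrow> wadm (f i)"
    and u: "\<And>t. 0 < t \<Longrightarrow> u y t = (\<Sum>i<m. t ^ i / fact i * heat_ext (f i) y t)"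
  shows "0 < t \<Longrightarrow> (time_deriv ^^ k) u y t =
    (\<Sum>i<m. \<Sum>l\<le>k. real (k choose l) * (monomial_deriv i l t * heat_td (f i) (k - l) y t))"
proof (induction k arbitrary: t)
  case 0
  then show ?case by (simp add: u monomial_deriv_def heat_ext_conv_td)
next
  case (Suc k)
  have "((\<lambda>t. \<Sum>i<m. \<Sum>l\<le>k. real (k choose l) * (monomial_deriv i l t * heat_td (f i) (k - l) y t)) has_real_derivative
      (\<Sum>i<m. \<Sum>l\<le>Suc k. real (Suc k choose l) * (monomial_deriv i l t * heat_td (f i) (Suc k - l) y t))) (at t)"
    by (intro DERIV_sum leibniz_step monomial_deriv_has_derivative heat_td_has_derivative f Suc.prems) auto
  moreover have "time_deriv ((time_deriv ^^ k) u) y t = deriv (\<lambda>t. \<Sum>i<m. \<Sum>l\<le>k. real (k choose l) * (monomial_deriv i l t * heat_td (f i) (k - l) y t)) t"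
    unfolding time_deriv_def[of _ y]
  proof (rule deriv_cong_ev[OF _ refl])
    show "\<forall>\<^sub>F t in nhds t. (time_deriv ^^ k) u y t = (\<Sum>i<m. \<Sum>l\<le>k. real (k choose l) * (monomial_deriv i l t * heat_td (f i) (k - l) y t))"
      using eventually_nhds_in_open[of "{0<..}" t] Suc by (auto elim: eventually_mono)
  qed
  ultimately show ?case by (simp only: DERIV_imp_deriv funpow.simps o_apply)
qed

lemma polyheat_solution_properties:
  fixes \<phi> :: "nat \<Rightarrow> real^'n \<Rightarrow> real"
  assumes reg: "\<And>j. j < m \<Longrightarrow> Ck_on (2 * (m - j) - 1) pos_orthant (\<phi> j)"
    and bdd: "0 < m \<Longrightarrow> bounded (\<phi> 0 ` pos_orthant)"
    and int: "\<And>k x t. 1 \<le> k \<Longrightarrow> k < m \<Longrightarrow> x \<in> pos_orthant \<Longrightarrow> t > 0 \<Longrightarrow>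
           set_integrable lborel pos_orthant (\<lambda>s. cauchy_data \<gamma> \<phi> k s * heat_G \<gamma> x s t)"
  defines "u \<equiv> polyheat_solution \<gamma> m \<phi>"
  shows "parabolic_Ck_on N pos_orthant {0<..} u"
    and "\<And>x t. x \<in> pos_orthant \<Longrightarrow> 0 < t \<Longrightarrow> (bessel_heat_op \<gamma> ^^ m) u x t = 0"
    and "\<And>k x. k < m \<Longrightarrow> x \<in> pos_orthant \<Longrightarrow> ((\<lambda>(y, t). (time_deriv ^^ k) u y t) \<longlongrightarrow> \<phi> k x) (initially x)"
    and "\<And>t j x. 0 < t \<Longrightarrow> x \<in> orthant_face j \<Longrightarrow>
         ((\<lambda>(y, \<tau>). (partial j ^^ (2 * k + 1)) (\<lambda>z. u z \<tau>) y) \<longlongrightarrow> 0) (at (x, t) within pos_orthant \<times> {0<..})"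
proof -
  define f where "f = cauchy_data \<gamma> \<phi>"
  have fC: "Ck_on (2 * (m - k) - 1) pos_orthant (f k)" if "k < m" for k
    unfolding f_def by (rule Ck_on_cauchy_data[OF reg that])
  have f: "wadm (f k)" if k: "k < m" for k
  proof (cases "k = 0")
    case True
    have "f 0 = \<phi> 0" by (simp add: f_def cauchy_data_def[abs_def])
    then show ?thesis using True k bdd Ck_on_continuous[OF fC[OF k]] by (auto intro: wadm_bounded)
  next
    case False
    with k int show ?thesis unfolding f_def
      by (intro wadm_integrable_heat_G Ck_on_continuous[OF fC[OF k, unfolded f_def]]) auto
  qed
  \<comment> \<open>The lemmas on time polynomials take an infinite family of solutions; beyond m
    the extension of zero fills it up.\<close>
  define v where "v = (\<lambda>k. if k < m then heat_ext (f k) else heat_ext (\<lambda>_. 0))"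
  have w0: "wadm (\<lambda>_. 0)" using wadm_cmult[OF wadm_one, of 0] by simp
  have vV: "v k \<in> S.V" for k unfolding v_def using heat_ext_V f w0 by simp
  have vsol: "bessel_heat_op \<gamma> (v k) x t = 0" if "x \<in> pos_orthant" "0 < t" for k x t
    unfolding v_def using heat_ext_solves[OF f that, of k] heat_ext_solves[OF w0 that] by simp
  have u: "u x t = (\<Sum>k<m. t ^ k / fact k * heat_ext (f k) x t)" if x: "x \<in> pos_orthant" and t: "0 < t" for x t
  proof -
    have "u x t = (\<Sum>k=0..<m. t ^ k / fact k * (1 / (2 * t) ^ CARD('n) * (\<Prod>j\<in>UNIV. (x $ j) powr (- (\<gamma> $ j))) *
        (LINT s:pos_orthant|lborel. f k s * heat_G \<gamma> x s t)))"
      unfolding u_def polyheat_solution_def f_def sum_distrib_left by (intro sum.cong refl) (simp only: mult_ac)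
    also have "\<dots> = (\<Sum>k=0..<m. t ^ k / fact k * heat_ext (f k) x t)"
      by (intro sum.cong refl) (simp only: heat_ext_eq_integral_heat_G[OF f x t] atLeastLessThan_iff)
    finally show ?thesis by (simp add: atLeast0LessThan)
  qed
  \<comment> \<open>The solution rewritten as a member of the smooth class, with t^k as a real
    power. It is defined and even on the whole space, whereas u is given by its formula on the
    orthant only.\<close>
  define w where "w = (\<lambda>x t. \<Sum>k<m. 1 / fact k * (t powr (real k) * v k x t))"
  have wV: "w \<in> S.V" unfolding w_def by (intro S.V_sum S.V.intros vV) auto
  have uw: "u x t = w x t" if "x \<in> pos_orthant" "t \<in> {0<..}" for x t
    using that u by (simp add: w_def v_def powr_realpow)
  show "parabolic_Ck_on N pos_orthant {0<..} u"
    by (subst parabolic_Ck_on_cong[OF open_pos_orthant open_greaterThan uw])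
       (auto intro: parabolic_Ck_on_subset[OF subset_UNIV S.V_parabolic[OF wV]])
  show "(bessel_heat_op \<gamma> ^^ m) u x t = 0" if "x \<in> pos_orthant" "0 < t" for x t
  proof -
    have "(bessel_heat_op \<gamma> ^^ m) u x t = (bessel_heat_op \<gamma> ^^ m) (\<lambda>x t. \<Sum>k<m. t ^ k / fact k * v k x t) x t"
      by (rule bessel_heat_op_pow_cong[OF open_pos_orthant open_greaterThan[of 0]]) (use that u in \<open>auto simp: v_def\<close>)
    also have "\<dots> = 0" by (rule bessel_heat_op_pow_time_polynomial[OF vV vsol that])
    finally show ?thesis .
  qed
  show "((\<lambda>(y, t). (time_deriv ^^ k) u y t) \<longlongrightarrow> \<phi> k x) (initially x)" if k: "k < m" and x: "x \<in> pos_orthant" for k x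
  proof -
    \<comment> \<open>Only the terms with i = l survive at t = 0: for i < l the monomial has been
      differentiated away, for i > l a positive power of t is left.\<close>
    define c where "c = (\<lambda>i l. if i = l then (bessel_laplacian \<gamma> ^^ (k - l)) (f l) x else 0)"
    have lim: "((\<lambda>(y, t). monomial_deriv i l t * heat_td (f i) (k - l) y t) \<longlongrightarrow> c i l) (initially x)"
      if i: "i < m" and l: "l \<le> k" for i l
    proof -
      consider "i < l" | "i = l" | "l < i" by linarith
      then show ?thesis
      proof cases
        case 1
        then show ?thesis by (simp add: monomial_deriv_def c_def case_prod_unfold)
      next
        case 2
        have "Ck_on (2 * (k - l)) pos_orthant (f i)" by (rule Ck_on_mono[OF _ fC[OF i]]) (use 2 k l in auto)
        from heat_td_initial[OF f[OF i] this x, of 0] 2 show ?thesis by (simp add: monomial_deriv_def c_def)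
      next
        case 3
        \<comment> \<open>The odd order 2(m - i) - 1 allows m - 1 - i powers of the operator. With
          the surplus power i - l this covers k - l derivatives, because k \<le> m - 1.\<close>
        have "Ck_on (2 * (m - 1 - i)) pos_orthant (f i)" by (rule Ck_on_mono[OF _ fC[OF i]]) (use i in auto)
        from heat_td_initial_decay[OF f[OF i] this x, of "i - l" "k - l"] 3 k l
        have "((\<lambda>(y, t). t ^ (i - l) * heat_td (f i) (k - l) y t) \<longlongrightarrow> 0) (initially x)" by simp
        from tendsto_mult_right_zero[OF this, of "1 / fact (i - l)"] 3
        show ?thesis by (simp add: monomial_deriv_def c_def case_prod_unfold)
      qed
    qed
    have "((\<lambda>z. \<Sum>i<m. \<Sum>l\<le>k. real (k choose l) * (case z of (y, t) \<Rightarrow> monomial_deriv i l t * heat_td (f i) (k - l) y t)) \<longlongrightarrow>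
        (\<Sum>i<m. \<Sum>l\<le>k. real (k choose l) * c i l)) (initially x)"
      by (intro tendsto_sum tendsto_mult tendsto_const lim) auto
    moreover have "(\<Sum>i<m. \<Sum>l\<le>k. real (k choose l) * c i l) = \<phi> k x"
    proof -
      have "(\<Sum>i<m. \<Sum>l\<le>k. real (k choose l) * c i l) = (\<Sum>l\<le>k. \<Sum>i<m. real (k choose l) * c i l)"
        by (rule sum.swap)
      also have "\<dots> = (\<Sum>l\<le>k. real (k choose l) * (bessel_laplacian \<gamma> ^^ (k - l)) (f l) x)"
      proof (intro sum.cong refl)
        fix l assume "l \<in> {..k}"
        then have "l < m" using k by simp
        have "(\<Sum>i<m. real (k choose l) * c i l) = (\<Sum>i<m. if i = l then real (k choose l) * (bessel_laplacian \<gamma> ^^ (k - l)) (f l) x else 0)"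
          by (intro sum.cong refl) (simp add: c_def)
        also have "\<dots> = real (k choose l) * (bessel_laplacian \<gamma> ^^ (k - l)) (f l) x"
          using \<open>l < m\<close> by (simp add: sum.delta)
        finally show "(\<Sum>i<m. real (k choose l) * c i l) = real (k choose l) * (bessel_laplacian \<gamma> ^^ (k - l)) (f l) x" .
      qed
      also have "\<dots> = \<phi> k x" unfolding f_def by (rule cauchy_data_inversion[OF reg k x])
      finally show ?thesis .
    qed
    ultimately have "((\<lambda>z. \<Sum>i<m. \<Sum>l\<le>k. real (k choose l) * (case z of (y, t) \<Rightarrow> monomial_deriv i l t * heat_td (f i) (k - l) y t)) \<longlongrightarrow> \<phi> k x) (initially x)"
      by simp
    then show ?thesis
    proof (rule Lim_transform_eventually)
      show "\<forall>\<^sub>F z in initially x. (\<Sum>i<m. \<Sum>l\<le>k. real (k choose l) * (case z of (y, t) \<Rightarrow> monomial_deriv i l t * heat_td (f i) (k - l) y t)) =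
          (case z of (y, t) \<Rightarrow> (time_deriv ^^ k) u y t)"
        using eventually_initially[OF zero_less_one, of x]
      proof (eventually_elim, safe, goal_cases)
        case (1 y t)
        then have y: "y \<in> pos_orthant" and t: "0 < t" by auto
        show ?case using time_deriv_pow_polynomial[of m f u y t k, OF f u[OF y] t] by simp
      qed
    qed
  qed
  show "((\<lambda>(y, \<tau>). (partial j ^^ (2 * k + 1)) (\<lambda>z. u z \<tau>) y) \<longlongrightarrow> 0) (at (x, t) within pos_orthant \<times> {0<..})"
    if t: "0 < t" and x: "x \<in> orthant_face j" for t j x
  proof -
    obtain G where G: "G \<in> S.V" "\<And>t. 0 < t \<Longrightarrow> (partial j ^^ (2 * k + 1)) (\<lambda>y. w y t) = (\<lambda>y. G y t)"
      "\<And>t x. 0 < t \<Longrightarrow> (\<forall>x. w (refl_coord j x) t = w x t) \<Longrightarrow> G (refl_coord j x) t = (-1) ^ (2 * k + 1) * G x t"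
      using S.V_partial_pow[OF wV, where l="2 * k + 1" and j=j] by blast
    have "w (refl_coord j x) t = w x t" for x
      unfolding w_def v_def using heat_ext_even[OF f t] by (intro sum.cong refl) simp
    then have "G (refl_coord j x) t = - G x t" using G(3)[OF t, of x] by simp
    \<comment> \<open>A point of the face is its own mirror image, so the odd function G equals its
      negative there.\<close>
    moreover have "refl_coord j x = x" using x by (auto simp: refl_coord_def orthant_face_def vec_eq_iff)
    ultimately have G0: "G x t = 0" by simp
    have "((\<lambda>(y, \<tau>). G y \<tau>) \<longlongrightarrow> G x t) (at (x, t) within UNIV \<times> {0<..})"
      using S.V_continuous[OF G(1)] t unfolding continuous_on_def by force
    then have "((\<lambda>(y, \<tau>). G y \<tau>) \<longlongrightarrow> 0) (at (x, t) within pos_orthant \<times> {0<..})"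
      unfolding G0 by (rule tendsto_within_subset) auto
    then show ?thesis
    proof (rule Lim_transform_eventually)
      show "\<forall>\<^sub>F z in at (x, t) within pos_orthant \<times> {0<..}. (case z of (y, \<tau>) \<Rightarrow> G y \<tau>) =
          (case z of (y, \<tau>) \<Rightarrow> (partial j ^^ (2 * k + 1)) (\<lambda>z. u z \<tau>) y)"
        unfolding eventually_at_filter
      proof (intro always_eventually allI impI)
        fix z :: "(real^'n) \<times> real" assume "z \<in> pos_orthant \<times> {0<..}"
        then obtain y \<tau> where z: "z = (y, \<tau>)" "y \<in> pos_orthant" "0 < \<tau>" by auto
        have "(partial j ^^ (2 * k + 1)) (\<lambda>z. u z \<tau>) y = (partial j ^^ (2 * k + 1)) (\<lambda>z. w z \<tau>) y"
          by (rule partial_pow_cong[OF open_pos_orthant]) (use uw z in auto)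
        then show "(case z of (y, \<tau>) \<Rightarrow> G y \<tau>) = (case z of (y, \<tau>) \<Rightarrow> (partial j ^^ (2 * k + 1)) (\<lambda>z. u z \<tau>) y)"
          using G(2)[OF z(3)] by (simp add: z(1))
      qed
    qed
  qed
qed

end

theorem theorem8:
  fixes \<gamma> :: "real^'n" and m :: nat and \<phi> :: "nat \<Rightarrow> real^'n \<Rightarrow> real"
  assumes "m \<ge> 1"
    and "\<And>j. \<bar>\<gamma> $ j\<bar> < 1 / 2"
    and "\<And>j. j < m \<Longrightarrow> Ck_on (2 * (m - j) - 1) pos_orthant (\<phi> j)"
    and "\<And>j. j < m \<Longrightarrow> continuous_on pos_orthant (\<phi> j)"
    and "\<And>j. j < m \<Longrightarrow> bounded (\<phi> j ` pos_orthant)"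
    and "\<And>j ks k y. j < m \<Longrightarrow> length ks \<le> 2 * (m - j) - 1 \<Longrightarrow> y \<in> orthant_face k \<Longrightarrow>
           (mixed_partial ks (\<phi> j) \<longlongrightarrow> 0) (at y within pos_orthant)"
    \<comment> \<open>The integrals in the definition of the solution exist (for k = 0 this is automatic).
        For k > 0 the derivatives of the data entering the k-th integrand are not assumed
        bounded, so this is what gives the formula a meaning.\<close>
    and "\<And>k x t. 1 \<le> k \<Longrightarrow> k < m \<Longrightarrow> x \<in> pos_orthant \<Longrightarrow> t > 0 \<Longrightarrow>
           set_integrable lborel pos_orthant (\<lambda>s. cauchy_data \<gamma> \<phi> k s * heat_G \<gamma> x s t)"
  defines "u \<equiv> polyheat_solution \<gamma> m \<phi>"
  shows "parabolic_Ck_on (2 * m) pos_orthant {0<..} u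
    \<and> (\<forall>x\<in>pos_orthant. \<forall>t>0. (bessel_heat_op \<gamma> ^^ m) u x t = 0)
    \<and> (\<forall>k<m. \<forall>x\<in>pos_orthant.
         ((\<lambda>(y, t). (time_deriv ^^ k) u y t) \<longlongrightarrow> \<phi> k x)
           (at (x, 0) within pos_orthant \<times> {0<..}))
    \<and> (\<forall>t>0. \<forall>j. \<forall>k<m. \<forall>x\<in>orthant_face j.
         ((\<lambda>(y, \<tau>). (partial j ^^ (2 * k + 1)) (\<lambda>z. u z \<tau>) y) \<longlongrightarrow> 0)
           (at (x, t) within pos_orthant \<times> {0<..}))"
proof -
  have "- 1 / 2 < \<gamma> $ j" for j using assms(2)[of j] by linarith
  then interpret bessel_heat \<gamma> by unfold_locales
  note main = polyheat_solution_properties[of m \<phi>, OF assms(3) assms(5) assms(7), folded u_def]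
  show ?thesis using main by blast
qed

end
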